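(* Let $X$ be a quasi-Banach space. The following conditions are equivalent. (i) Every Lipschitz map $F\colon\mathbb{R}\to X$ is differentiable almost everywhere. (ii) Every Lipschitz map $F\colon\mathbb{R}\to X$ is differentiable at some point. (iii) $X$ is locally convex and has the Radon--Nikodým property.
   Context: A quasi-norm on a real or complex vector space $X$ is a map $\|\cdot\|_X\colon X\to[0,\infty)$ with $\|x\|_X>0$ for $x\neq 0$, $\|\alpha x\|_X=|\alpha|\,\|x\|_X$ for all scalars $\alpha$, and $\|x+y\|_X\le\kappa(\|x\|_X+\|y\|_X)$ for some constant $\kappa\ge 1$ and all $x,y\in X$. It induces a metrizable linear topology on $X$; $X$ is a quasi-Banach space if it is complete. $X$ is locally convex if the origin has a neighbourhood basis of absolutely convex sets; equivalently, there is a norm on $X$ equivalent to $\|\cdot\|_X$, i.e. $X$ is isomorphic to a Banach space. A map $F\colon\mathbb{R}\to X$ is Lipschitz if there is $L<\infty$ with $\|F(t)-F(s)\|_X\le L|t-s|$ for all $s,t$. It is differentiable at $s$ if there is $v\in X$ with $\lim_{t\to s}\left\|\frac{F(t)-F(s)}{t-s}-v\right\|_X=0$. "Almost everywhere" refers to Lebesgue measure. A Banach space $Y$ has the Radon--Nikodým property (RNP) if for every finite measure space $(\Omega,\Sigma,\mu)$, every $\mu$-continuous countably additive vector measure $\nu\colon\Sigma\to Y$ of bounded variation has a Bochner integrable density with respect to $\mu$. The RNP is invariant under linear isomorphism; a locally convex quasi-Banach space is said to have the RNP if a Banach space isomorphic to it (that is, the space itself under an equivalent norm) has it. *)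

theory Defs
  imports "HOL-Analysis.Analysis"
begin

section \<open>Quasi-Banach spaces\<close>

text \<open>
  A space is given by an additive group type, a scalar multiplication and a quasi-norm, all
  of them explicit arguments, because a quasi-normed space is in general not an instance of
  \<^class>\<open>real_normed_vector\<close>. The scalar field ranges over \<^class>\<open>real_normed_field\<close>: by the
  Gelfand--Mazur theorem, its members are exactly (up to isometric isomorphism) the real and
  the complex numbers, so this covers the real and the complex case simultaneously.
\<close>

locale quasi_normed_space = vector_space smul
  for smul :: "'k::real_normed_field \<Rightarrow> 'a::ab_group_add \<Rightarrow> 'a" +
  fixes q :: "'a \<Rightarrow> real"
  assumes nonneg: "0 \<le> q x"
    and pos: "x \<noteq> 0 \<Longrightarrow> 0 < q x"
    and homogeneous: "q (smul c x) = norm c * q x"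
    and quasi_triangle: "\<exists>\<kappa>\<ge>1. \<forall>x y. q (x + y) \<le> \<kappa> * (q x + q y)"

definition complete_wrt :: "('a::ab_group_add \<Rightarrow> real) \<Rightarrow> bool" where
  "complete_wrt q \<longleftrightarrow>
    (\<forall>u :: nat \<Rightarrow> 'a. (\<forall>e>0. \<exists>n0. \<forall>m\<ge>n0. \<forall>n\<ge>n0. q (u m - u n) < e) \<longrightarrow>
      (\<exists>l. (\<lambda>n. q (u n - l)) \<longlonglongrightarrow> 0))"

locale quasi_banach_space = quasi_normed_space +
  assumes complete: "complete_wrt q"

locale banach_norm = quasi_banach_space +
  assumes triangle: "q (x + y) \<le> q x + q y"

definition quasi_norm_topology :: "('a::ab_group_add \<Rightarrow> real) \<Rightarrow> 'a topology" where
  "quasi_norm_topology q = topology (\<lambda>U. \<forall>x\<in>U. \<exists>r>0. \<forall>y. q (y - x) < r \<longrightarrow> y \<in> U)"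

lemma openin_quasi_norm_topology:
  "openin (quasi_norm_topology q) U \<longleftrightarrow> (\<forall>x\<in>U. \<exists>r>0. \<forall>y. q (y - x) < r \<longrightarrow> y \<in> U)"
proof -
  have "istopology (\<lambda>U. \<forall>x\<in>U. \<exists>r>0. \<forall>y. q (y - x) < r \<longrightarrow> y \<in> U)"
    unfolding istopology_def
  proof (intro conjI allI impI ballI)
    fix S T x
    assume S: "\<forall>x\<in>S. \<exists>r>0. \<forall>y. q (y - x) < r \<longrightarrow> y \<in> S"
      and T: "\<forall>x\<in>T. \<exists>r>0. \<forall>y. q (y - x) < r \<longrightarrow> y \<in> T" and x: "x \<in> S \<inter> T"
    obtain a b where "a > 0" "\<forall>y. q (y - x) < a \<longrightarrow> y \<in> S"
      "b > 0" "\<forall>y. q (y - x) < b \<longrightarrow> y \<in> T"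
      using S T x by blast
    then show "\<exists>r>0. \<forall>y. q (y - x) < r \<longrightarrow> y \<in> S \<inter> T"
      by (intro exI[of _ "min a b"]) simp
  next
    fix \<K> x
    assume "\<forall>K\<in>\<K>. \<forall>x\<in>K. \<exists>r>0. \<forall>y. q (y - x) < r \<longrightarrow> y \<in> K" "x \<in> \<Union>\<K>"
    then show "\<exists>r>0. \<forall>y. q (y - x) < r \<longrightarrow> y \<in> \<Union>\<K>"
      by (meson UnionE UnionI)
  qed
  then show ?thesis
    by (simp add: quasi_norm_topology_def topology_inverse')
qed

definition zero_neighbourhood :: "('a::ab_group_add \<Rightarrow> real) \<Rightarrow> 'a set \<Rightarrow> bool" where
  "zero_neighbourhood q U \<longleftrightarrow> (\<exists>V. openin (quasi_norm_topology q) V \<and> 0 \<in> V \<and> V \<subseteq> U)"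

definition absolutely_convex :: "('k::real_normed_field \<Rightarrow> 'a::ab_group_add \<Rightarrow> 'a) \<Rightarrow> 'a set \<Rightarrow> bool" where
  "absolutely_convex smul U \<longleftrightarrow>
    (\<forall>x\<in>U. \<forall>y\<in>U. \<forall>a b. norm a + norm b \<le> 1 \<longrightarrow> smul a x + smul b y \<in> U)"

definition locally_convex ::
    "('k::real_normed_field \<Rightarrow> 'a::ab_group_add \<Rightarrow> 'a) \<Rightarrow> ('a \<Rightarrow> real) \<Rightarrow> bool" where
  "locally_convex smul q \<longleftrightarrow>
    (\<forall>W. zero_neighbourhood q W \<longrightarrow>
      (\<exists>U\<subseteq>W. zero_neighbourhood q U \<and> absolutely_convex smul U))"

definition equivalent_quasi_norms :: "('a \<Rightarrow> real) \<Rightarrow> ('a \<Rightarrow> real) \<Rightarrow> bool" where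
  "equivalent_quasi_norms p q \<longleftrightarrow> (\<exists>c>0. \<exists>C>0. \<forall>x. c * q x \<le> p x \<and> p x \<le> C * q x)"


section \<open>Lipschitz curves and their derivatives\<close>

definition lipschitz_curve :: "('a::ab_group_add \<Rightarrow> real) \<Rightarrow> (real \<Rightarrow> 'a) \<Rightarrow> bool" where
  "lipschitz_curve q F \<longleftrightarrow> (\<exists>L. \<forall>s t. q (F t - F s) \<le> L * \<bar>t - s\<bar>)"

definition curve_differentiable_at ::
    "('k::real_normed_field \<Rightarrow> 'a::ab_group_add \<Rightarrow> 'a) \<Rightarrow> ('a \<Rightarrow> real) \<Rightarrow> (real \<Rightarrow> 'a) \<Rightarrow> real \<Rightarrow> bool"
  where
  "curve_differentiable_at smul q F s \<longleftrightarrow>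
    (\<exists>v. ((\<lambda>t. q (smul (of_real (inverse (t - s))) (F t - F s) - v)) \<longlongrightarrow> 0) (at s))"


section \<open>Bochner integration\<close>

text \<open>
  The Bochner integral of the library is restricted to second countable Banach space types.
  Here the norm \<open>N\<close> is an explicit argument and no separability is assumed. Since
  a strongly measurable function is only an almost everywhere limit of simple functions,
  \<open>\<lambda>x. N (f x - s n x)\<close> below agrees almost everywhere with a measurable function; by
  \<open>nn_integral_cong_AE\<close> its \<^const>\<open>nn_integral\<close> is the intended integral.
\<close>

definition strongly_measurable :: "('a::ab_group_add \<Rightarrow> real) \<Rightarrow> 'w measure \<Rightarrow> ('w \<Rightarrow> 'a) \<Rightarrow> bool" where
  "strongly_measurable N M f \<longleftrightarrow>
    (\<exists>s :: nat \<Rightarrow> 'w \<Rightarrow> 'a. (\<forall>n. simple_function M (s n)) \<and>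
      (AE x in M. (\<lambda>n. N (f x - s n x)) \<longlonglongrightarrow> 0))"

definition simple_vector_integral ::
    "('k::real_normed_field \<Rightarrow> 'a::ab_group_add \<Rightarrow> 'a) \<Rightarrow> 'w measure \<Rightarrow> ('w \<Rightarrow> 'a) \<Rightarrow> 'a" where
  "simple_vector_integral smul M s =
    (\<Sum>y\<in>s ` space M. smul (of_real (measure M (s -` {y} \<inter> space M))) y)"

text \<open>For finite measures \<open>M\<close> only; there, all simple functions are integrable.\<close>

definition has_vector_integral ::
    "('k::real_normed_field \<Rightarrow> 'a::ab_group_add \<Rightarrow> 'a) \<Rightarrow> ('a \<Rightarrow> real) \<Rightarrow> 'w measure \<Rightarrow> ('w \<Rightarrow> 'a) \<Rightarrow> 'a \<Rightarrow> bool"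
  where
  "has_vector_integral smul N M f I \<longleftrightarrow>
    strongly_measurable N M f \<and>
    (\<exists>s :: nat \<Rightarrow> 'w \<Rightarrow> 'a. (\<forall>n. simple_function M (s n)) \<and>
      (\<lambda>n. \<integral>\<^sup>+ x. ennreal (N (f x - s n x)) \<partial>M) \<longlonglongrightarrow> 0 \<and>
      (\<lambda>n. N (simple_vector_integral smul M (s n) - I)) \<longlonglongrightarrow> 0)"

definition vector_integrable ::
    "('k::real_normed_field \<Rightarrow> 'a::ab_group_add \<Rightarrow> 'a) \<Rightarrow> ('a \<Rightarrow> real) \<Rightarrow> 'w measure \<Rightarrow> ('w \<Rightarrow> 'a) \<Rightarrow> bool"
  where
  "vector_integrable smul N M f \<longleftrightarrow> (\<exists>I. has_vector_integral smul N M f I)"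


section \<open>Vector measures and the Radon--Nikodym property\<close>

definition vector_measure ::
    "('a::ab_group_add \<Rightarrow> real) \<Rightarrow> 'w measure \<Rightarrow> ('w set \<Rightarrow> 'a) \<Rightarrow> bool" where
  "vector_measure N M \<nu> \<longleftrightarrow>
    (\<forall>A :: nat \<Rightarrow> 'w set. range A \<subseteq> sets M \<longrightarrow> disjoint_family A \<longrightarrow>
      (\<lambda>n. N ((\<Sum>i<n. \<nu> (A i)) - \<nu> (\<Union>i. A i))) \<longlonglongrightarrow> 0)"

definition bounded_variation ::
    "('a::ab_group_add \<Rightarrow> real) \<Rightarrow> 'w measure \<Rightarrow> ('w set \<Rightarrow> 'a) \<Rightarrow> bool" where
  "bounded_variation N M \<nu> \<longleftrightarrow>
    (\<exists>C. \<forall>P. finite P \<longrightarrow> P \<subseteq> sets M \<longrightarrow> disjoint P \<longrightarrow> \<Union>P = space M \<longrightarrow>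
      (\<Sum>E\<in>P. N (\<nu> E)) \<le> C)"

definition measure_continuous ::
    "('a::ab_group_add \<Rightarrow> real) \<Rightarrow> 'w measure \<Rightarrow> ('w set \<Rightarrow> 'a) \<Rightarrow> bool" where
  "measure_continuous N M \<nu> \<longleftrightarrow>
    (\<forall>e>0. \<exists>d>0. \<forall>E\<in>sets M. measure M E < d \<longrightarrow> N (\<nu> E) < e)"

definition has_density ::
    "('k::real_normed_field \<Rightarrow> 'a::ab_group_add \<Rightarrow> 'a) \<Rightarrow> ('a \<Rightarrow> real) \<Rightarrow> 'w measure \<Rightarrow> ('w set \<Rightarrow> 'a) \<Rightarrow> ('w \<Rightarrow> 'a) \<Rightarrow> bool"
  where
  "has_density smul N M \<nu> f \<longleftrightarrow>
    vector_integrable smul N M f \<and>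
    (\<forall>E\<in>sets M. has_vector_integral smul N M (\<lambda>x. if x \<in> E then f x else 0) (\<nu> E))"

text \<open>
  HOL cannot quantify over all types inside a formula, so the type \<open>'w\<close> supplying the points of
  the measure spaces is a parameter; all finite measure spaces on all subsets of \<open>'w\<close>, with
  arbitrary sigma-algebras, are considered.
\<close>

definition radon_nikodym_property ::
    "'w itself \<Rightarrow> ('k::real_normed_field \<Rightarrow> 'a::ab_group_add \<Rightarrow> 'a) \<Rightarrow> ('a \<Rightarrow> real) \<Rightarrow> bool"
  where
  "radon_nikodym_property (_ :: 'w itself) smul N \<longleftrightarrow>
    (\<forall>(M :: 'w measure) \<nu>.
      finite_measure M \<longrightarrow> vector_measure N M \<nu> \<longrightarrow> measure_continuous N M \<nu> \<longrightarrow>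
      bounded_variation N M \<nu> \<longrightarrow> (\<exists>f. has_density smul N M \<nu> f))"

text \<open>The property of a quasi-Banach space, defined through equivalent Banach norms on it.\<close>

definition has_RNP ::
    "'w itself \<Rightarrow> ('k::real_normed_field \<Rightarrow> 'a::ab_group_add \<Rightarrow> 'a) \<Rightarrow> ('a \<Rightarrow> real) \<Rightarrow> bool"
  where
  "has_RNP W smul q \<longleftrightarrow>
    (\<exists>N. banach_norm smul N \<and> equivalent_quasi_norms N q \<and> radon_nikodym_property W smul N)"

text \<open>
  The type \<open>'w\<close> must be able to carry the non-atomic measure spaces; on a countable type every
  space has the property above. As the theorem is polymorphic in \<open>'w\<close>, this
  is the only restriction: every measure space lives, up to renaming points, on such a type.
\<close>

definition at_least_continuum :: "'w itself \<Rightarrow> bool" where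
  "at_least_continuum (_ :: 'w itself) \<longleftrightarrow> (\<exists>g :: real \<Rightarrow> 'w. inj g)"

end

theory Submission
  imports Defs
begin

text \<open>
  If \<open>q (\<Sum> y\<^sub>i) \<le> R * \<Sum> q y\<^sub>i\<close> fails for every \<open>R\<close>, a shortest list violating the bound yields a polygon
  that is Lipschitz with a constant independent of \<open>R\<close>, has very small slopes at small scales
  and slope at least one at large scales. A sum of such polygons, folded periodically and
  with well separated scales, is a Lipschitz curve without any point of differentiability. If
  the bound holds for some \<open>R\<close>, then \<open>x \<mapsto> inf {\<Sum> q y\<^sub>i | \<Sum> y\<^sub>i = x}\<close> is an equivalent norm.

  For a norm, a dominated vector measure \<open>\<nu>\<close> whose averages \<open>\<nu> G / \<mu> G\<close> oscillate on every set of positive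
  measure gives a tree of nested finite partitions along which averages keep jumping. Ordering
  the partitions linearly produces a chain of sets \<open>T t\<close> with \<open>\<mu> (T t) = t\<close>, and \<open>t \<mapsto> \<nu> (T t)\<close> is a
  Lipschitz curve that is differentiable nowhere. Otherwise the averages are almost constant on the
  pieces of countable partitions, and these constants converge to a density.

  Conversely, a Lipschitz curve induces a vector measure on the Borel sets of a unit interval, and
  the curve is differentiable wherever the Lebesgue differentiation theorem holds for the
  density.
\<close>

section \<open>Quasi-norms and derivatives of curves\<close>

text \<open>Slopes and integrals involve real factors only, so curves and vector measures are
  treated over the reals, and the scalar field of the theorem enters through \<open>of_real\<close>.
  Two defects of a quasi-norm shape the estimates: a sum of n terms costs powers of
  \<open>\<kappa>\<close>, and a limit costs a factor \<open>\<kappa>\<close> because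
  \<open>q\<close> need not be continuous. The decay of heights and scales is therefore chosen
  against \<open>\<kappa>\<close>. Since there may be no continuous functionals to test with,
  failure of differentiability is always shown directly: two chords over short intervals that both
  contain the point have slopes a fixed distance apart. Both nowhere differentiable curves are built
  to offer such pairs at every point and at arbitrarily small scales. For the superposed polygons
  these are a steep chord of length \<open>D\<close> and a level chord of length
  \<open>2 * D\<close>; for a vector measure they are the chords belonging to a piece of a partition
  and to one of its children. The implications are proved in the cycle (i), (ii), (iii), (i). The
  last one works with measures on the real line, so the property is first carried from
  \<open>'w\<close> to the reals along an injection.\<close>

locale real_quasi_normed = vector_space sc
  for sc :: "real \<Rightarrow> 'a::ab_group_add \<Rightarrow> 'a" +
  fixes q :: "'a \<Rightarrow> real" and \<kappa> :: real
  assumes q_nonneg: "0 \<le> q x"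
    and q_pos: "x \<noteq> 0 \<Longrightarrow> 0 < q x"
    and q_scale: "q (sc r x) = \<bar>r\<bar> * q x"
    and kappa_ge_1: "1 \<le> \<kappa>"
    and q_add: "q (x + y) \<le> \<kappa> * (q x + q y)"
begin

lemma q_zero [simp]: "q 0 = 0"
  using q_scale[of 0 0] by simp

lemma q_minus [simp]: "q (- x) = q x"
  using q_scale[of "-1" x] by simp

lemma q_diff_commute: "q (x - y) = q (y - x)"
  by (metis minus_diff_eq q_minus)

lemma q_diff: "q (x - y) \<le> \<kappa> * (q x + q y)"
  using q_add[of x "- y"] by simp

lemma q_triangle: "q (x - z) \<le> \<kappa> * (q (x - y) + q (y - z))"
  using q_add[of "x - y" "y - z"] by simp

lemma q_zero_iff [simp]: "q x = 0 \<longleftrightarrow> x = 0"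
  using q_pos[of x] by force

text \<open>The number of terms is absorbed into powers of \<open>\<kappa>\<close>, so that a sum
  converges as soon as its terms decay faster than \<open>\<kappa> ^ - k\<close>.\<close>

lemma q_sum_le: "q (\<Sum>k<n. x k) \<le> (\<Sum>k<n. \<kappa> ^ Suc k * q (x k))"
proof (induction n arbitrary: x)
  case (Suc n)
  have "q (\<Sum>k<Suc n. x k) = q (x 0 + (\<Sum>k<n. x (Suc k)))"
    by (simp only: sum.lessThan_Suc_shift)
  also have "\<dots> \<le> \<kappa> * (q (x 0) + q (\<Sum>k<n. x (Suc k)))"
    by (rule q_add)
  also have "\<dots> \<le> \<kappa> * (q (x 0) + (\<Sum>k<n. \<kappa> ^ Suc k * q (x (Suc k))))"
    using Suc.IH[of "\<lambda>k. x (Suc k)"] kappa_ge_1 by (intro mult_left_mono add_left_mono) auto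
  also have "\<dots> = (\<Sum>k<Suc n. \<kappa> ^ Suc k * q (x k))"
    by (simp add: sum.lessThan_Suc_shift algebra_simps sum_distrib_left del: sum.lessThan_Suc)
  finally show ?case .
qed simp

text \<open>A quasi-norm need not be continuous, so a bound on the terms survives the limit only up
  to the factor \<open>\<kappa>\<close> of one quasi-triangle inequality.\<close>

lemma q_limit_le:
  assumes "(\<lambda>n. q (u n - l)) \<longlonglongrightarrow> 0" and "\<forall>\<^sub>F n in sequentially. q (u n) \<le> B"
  shows "q l \<le> \<kappa> * B"
proof (rule tendsto_lowerbound)
  show "(\<lambda>n. \<kappa> * (q (u n - l) + B)) \<longlonglongrightarrow> \<kappa> * B"
    using tendsto_intros(1) by (auto intro!: tendsto_eq_intros assms(1))
  show "\<forall>\<^sub>F n in sequentially. q l \<le> \<kappa> * (q (u n - l) + B)"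
    using assms(2)
  proof eventually_elim
    case (elim n)
    have "q l \<le> \<kappa> * (q (l - u n) + q (u n))"
      using q_add[of "l - u n" "u n"] by simp
    also have "\<dots> \<le> \<kappa> * (q (u n - l) + B)"
      using elim kappa_ge_1 by (intro mult_left_mono) (auto simp: q_diff_commute)
    finally show ?case .
  qed
qed simp

lemma q_tendsto_0I:
  assumes "\<And>n. q (u n) \<le> v n" and "v \<longlonglongrightarrow> 0"
  shows "(\<lambda>n. q (u n)) \<longlonglongrightarrow> 0"
  by (rule tendsto_sandwich[OF _ _ tendsto_const assms(2)]) (use assms(1) q_nonneg in simp_all)

definition slope :: "(real \<Rightarrow> 'a) \<Rightarrow> real \<Rightarrow> real \<Rightarrow> 'a" where
  "slope F a b = sc (1 / (b - a)) (F b - F a)"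

text \<open>The multiplied-out form is meaningful at \<open>t = s\<close>, and the set
  \<open>S\<close> admits one-sided derivatives at the ends of an interval, which occur when a curve
  is folded.\<close>

definition has_derivative_within :: "(real \<Rightarrow> 'a) \<Rightarrow> real set \<Rightarrow> real \<Rightarrow> 'a \<Rightarrow> bool" where
  "has_derivative_within F S s v \<longleftrightarrow>
    (\<forall>e>0. \<exists>d>0. \<forall>t\<in>S. \<bar>t - s\<bar> < d \<longrightarrow> q (F t - F s - sc (t - s) v) \<le> e * \<bar>t - s\<bar>)"

lemma q_quotient_diff:
  assumes "r \<noteq> 0"
  shows "q (sc (inverse r) x - v) = q (x - sc r v) / \<bar>r\<bar>"
proof -
  have "sc (inverse r) x - v = sc (inverse r) (x - sc r v)"
    using assms by (simp add: scale_right_diff_distrib)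
  then show ?thesis
    using assms by (simp add: q_scale divide_inverse_commute)
qed

lemma curve_differentiable_at_iff:
  "curve_differentiable_at sc q F s \<longleftrightarrow> (\<exists>v. has_derivative_within F UNIV s v)"
proof -
  have "((\<lambda>t. q (sc (of_real (inverse (t - s))) (F t - F s) - v)) \<longlongrightarrow> 0) (at s) \<longleftrightarrow>
      has_derivative_within F UNIV s v" for v
  proof
    assume L: "((\<lambda>t. q (sc (of_real (inverse (t - s))) (F t - F s) - v)) \<longlongrightarrow> 0) (at s)"
    show "has_derivative_within F UNIV s v"
      unfolding has_derivative_within_def
    proof (intro allI impI)
      fix e :: real assume "e > 0"
      with L have "\<forall>\<^sub>F t in at s. q (sc (inverse (t - s)) (F t - F s) - v) < e"
        by (simp add: order_tendstoD(2))
      then obtain d where d: "d > 0"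
        "\<And>t. t \<noteq> s \<Longrightarrow> \<bar>t - s\<bar> < d \<Longrightarrow> q (sc (inverse (t - s)) (F t - F s) - v) < e"
        by (auto simp: eventually_at dist_real_def)
      have "q (F t - F s - sc (t - s) v) \<le> e * \<bar>t - s\<bar>" if "\<bar>t - s\<bar> < d" for t
      proof (cases "t = s")
        case False
        then have "q (F t - F s - sc (t - s) v) / \<bar>t - s\<bar> < e"
          using d(2)[OF False that] q_quotient_diff[of "t - s" "F t - F s" v] by simp
        then show ?thesis using False by (simp add: pos_divide_less_eq del: scale_left_diff_distrib)
      qed simp
      then show "\<exists>d>0. \<forall>t\<in>UNIV. \<bar>t - s\<bar> < d \<longrightarrow> q (F t - F s - sc (t - s) v) \<le> e * \<bar>t - s\<bar>"
        using d(1) by blast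
    qed
  next
    assume R: "has_derivative_within F UNIV s v"
    show "((\<lambda>t. q (sc (of_real (inverse (t - s))) (F t - F s) - v)) \<longlongrightarrow> 0) (at s)"
    proof (rule tendstoI)
      fix e :: real assume "e > 0"
      then obtain d where d: "d > 0"
        "\<And>t. \<bar>t - s\<bar> < d \<Longrightarrow> q (F t - F s - sc (t - s) v) \<le> e / 2 * \<bar>t - s\<bar>"
        using R unfolding has_derivative_within_def by (meson UNIV_I half_gt_zero)
      have "q (sc (inverse (t - s)) (F t - F s) - v) < e" if "t \<noteq> s" "\<bar>t - s\<bar> < d" for t
      proof -
        have "q (sc (inverse (t - s)) (F t - F s) - v) \<le> e / 2"
          using d(2)[of t] that q_quotient_diff[of "t - s" "F t - F s" v]
          by (simp add: pos_divide_le_eq)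
        then show ?thesis using \<open>e > 0\<close> by linarith
      qed
      then show "\<forall>\<^sub>F t in at s.
          dist (q (sc (of_real (inverse (t - s))) (F t - F s) - v)) 0 < e"
        using d(1) by (auto simp: eventually_at dist_real_def q_nonneg intro!: exI[of _ d])
    qed
  qed
  then show ?thesis by (auto simp: curve_differentiable_at_def)
qed

text \<open>Straddling is essential: if \<open>s\<close> lies between \<open>a\<close> and
  \<open>b\<close>, the distances \<open>\<bar>a - s\<bar>\<close> and
  \<open>\<bar>b - s\<bar>\<close> add up to \<open>b - a\<close>, so division by
  \<open>b - a\<close> does not magnify the two errors.\<close>

lemma slope_near_derivative:
  assumes "has_derivative_within F S s v" "e > 0"
  obtains d where "d > 0"
    "\<And>a b. \<lbrakk>a \<in> S; b \<in> S; a \<le> s; s \<le> b; a < b; b - a < d\<rbrakk> \<Longrightarrow> q (slope F a b - v) \<le> e"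
proof -
  have "e / \<kappa> > 0" using assms(2) kappa_ge_1 by simp
  then obtain d where d: "d > 0"
    "\<And>t. t \<in> S \<Longrightarrow> \<bar>t - s\<bar> < d \<Longrightarrow> q (F t - F s - sc (t - s) v) \<le> e / \<kappa> * \<bar>t - s\<bar>"
    using assms(1) unfolding has_derivative_within_def by meson
  have "q (slope F a b - v) \<le> e"
    if "a \<in> S" "b \<in> S" "a \<le> s" "s \<le> b" "a < b" "b - a < d" for a b
  proof -
    have "F b - F a - sc (b - a) v = (F b - F s - sc (b - s) v) - (F a - F s - sc (a - s) v)"
      by (simp add: scale_left_diff_distrib algebra_simps)
    then have "q (F b - F a - sc (b - a) v)
        \<le> \<kappa> * (q (F b - F s - sc (b - s) v) + q (F a - F s - sc (a - s) v))"
      using q_diff[of "F b - F s - sc (b - s) v" "F a - F s - sc (a - s) v"] by (simp only:)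
    also have "\<dots> \<le> \<kappa> * (e / \<kappa> * \<bar>b - s\<bar> + e / \<kappa> * \<bar>a - s\<bar>)"
      using that d(2)[of a] d(2)[of b] kappa_ge_1 by (intro mult_left_mono add_mono) auto
    also have "\<dots> = e * (b - a)"
      using that kappa_ge_1 by (simp add: field_simps)
    finally have "q (F b - F a - sc (b - a) v) / \<bar>b - a\<bar> \<le> e"
      using \<open>a < b\<close> by (simp add: field_simps)
    then show ?thesis
      using \<open>a < b\<close> q_quotient_diff[of "b - a" "F b - F a" v]
      by (simp add: slope_def inverse_eq_divide)
  qed
  with d(1) show thesis by (rule that)
qed

text \<open>Both slopes would be within \<open>\<delta> / (4 * \<kappa>)\<close> of
  \<open>v\<close>, hence within \<open>\<delta> / 2\<close> of each other. The criterion contains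
  no candidate derivative.\<close>

lemma not_differentiable_withinI:
  assumes "\<delta> > 0"
    and osc: "\<And>d. d > 0 \<Longrightarrow> \<exists>a b a' b'. {a, b, a', b'} \<subseteq> S \<and> a \<le> s \<and> s \<le> b \<and> a < b \<and> b - a < d \<and>
      a' \<le> s \<and> s \<le> b' \<and> a' < b' \<and> b' - a' < d \<and> \<delta> \<le> q (slope F a b - slope F a' b')"
  shows "\<not> has_derivative_within F S s v"
proof
  assume "has_derivative_within F S s v"
  moreover have "\<delta> / (4 * \<kappa>) > 0" using assms(1) kappa_ge_1 by simp
  ultimately obtain d where d: "d > 0"
    "\<And>a b. \<lbrakk>a \<in> S; b \<in> S; a \<le> s; s \<le> b; a < b; b - a < d\<rbrakk> \<Longrightarrow> q (slope F a b - v) \<le> \<delta> / (4 * \<kappa>)"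
    by (rule slope_near_derivative) metis
  obtain a b a' b' where I: "{a, b, a', b'} \<subseteq> S" "a \<le> s" "s \<le> b" "a < b" "b - a < d"
    "a' \<le> s" "s \<le> b'" "a' < b'" "b' - a' < d" "\<delta> \<le> q (slope F a b - slope F a' b')"
    using osc[OF d(1)] by blast
  have "q (slope F a b - slope F a' b') \<le> \<kappa> * (q (slope F a b - v) + q (v - slope F a' b'))"
    by (rule q_triangle)
  also have "\<dots> \<le> \<kappa> * (\<delta> / (4 * \<kappa>) + \<delta> / (4 * \<kappa>))"
    using I d(2)[of a b] d(2)[of a' b'] kappa_ge_1
    by (intro mult_left_mono add_mono) (auto simp: q_diff_commute[of v])
  also have "\<dots> = \<delta> / 2" using kappa_ge_1 by (simp add: field_simps)
  finally show False using I assms(1) by linarith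
qed

end

section \<open>Folding the line onto an interval: the distance to the nearest multiple of
  \<open>2 * m\<close>\<close>

definition triangle_wave :: "real \<Rightarrow> real \<Rightarrow> real" where
  "triangle_wave m t = \<bar>t - 2 * m * of_int (round (t / (2 * m)))\<bar>"

lemma triangle_wave_le:
  assumes "m > 0"
  shows "triangle_wave m t \<le> \<bar>t - 2 * m * of_int k\<bar>"
proof -
  have "\<bar>t / (2 * m) - of_int (round (t / (2 * m)))\<bar> \<le> \<bar>t / (2 * m) - of_int k\<bar>"
    by (rule round_diff_minimal)
  then have "2 * m * \<bar>t / (2 * m) - of_int (round (t / (2 * m)))\<bar> \<le> 2 * m * \<bar>t / (2 * m) - of_int k\<bar>"
    using assms by (intro mult_left_mono) auto
  moreover have "2 * m * \<bar>t / (2 * m) - j\<bar> = \<bar>t - 2 * m * j\<bar>" for j :: real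
  proof -
    have "2 * m * \<bar>t / (2 * m) - j\<bar> = \<bar>2 * m * (t / (2 * m) - j)\<bar>"
      using assms by (simp add: abs_mult)
    also have "2 * m * (t / (2 * m) - j) = t - 2 * m * j" using assms by (simp add: field_simps)
    finally show ?thesis .
  qed
  ultimately show ?thesis unfolding triangle_wave_def by simp
qed

lemma triangle_wave_nonneg: "0 \<le> triangle_wave m t"
  by (simp add: triangle_wave_def)

lemma triangle_wave_bound:
  assumes "m > 0"
  shows "triangle_wave m t \<le> m"
proof -
  have "\<bar>t / (2 * m) - of_int (round (t / (2 * m)))\<bar> \<le> 1 / 2"
    using of_int_round_abs_le[of "t / (2 * m)"] by (simp add: abs_minus_commute)
  moreover have "\<bar>t - 2 * m * of_int (round (t / (2 * m)))\<bar>
      = \<bar>2 * m * (t / (2 * m) - of_int (round (t / (2 * m))))\<bar>"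
    using assms by (simp only: right_diff_distrib) simp
  ultimately show ?thesis
    using assms by (simp add: triangle_wave_def abs_mult)
qed

text \<open>A distance to a fixed set is 1-Lipschitz: compare with the multiple of
  \<open>2 * m\<close> that is nearest to the other point.\<close>

lemma triangle_wave_lipschitz:
  assumes "m > 0"
  shows "\<bar>triangle_wave m t - triangle_wave m s\<bar> \<le> \<bar>t - s\<bar>"
proof -
  have "triangle_wave m t \<le> triangle_wave m s + \<bar>t - s\<bar>" for s t
    using triangle_wave_le[OF assms, of t "round (s / (2 * m))"]
    by (simp add: triangle_wave_def[of m s])
  from this[of s t] this[of t s] show ?thesis by linarith
qed

text \<open>The map sending \<open>u\<close> to \<open>2 * m * of_int k + \<sigma> * u\<close> is an
  inverse branch of the folding: \<open>k\<close> chooses the valley, \<open>\<sigma>\<close> the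
  side of it.\<close>

lemma triangle_wave_unfold:
  assumes "m > 0" "\<bar>\<sigma>\<bar> = 1" "0 \<le> u" "u \<le> m"
  shows "triangle_wave m (2 * m * of_int k + \<sigma> * u) = u"
proof (rule antisym)
  have "triangle_wave m (2 * m * of_int k + \<sigma> * u) \<le> \<bar>\<sigma> * u\<bar>"
    using triangle_wave_le[OF assms(1), of "2 * m * of_int k + \<sigma> * u" k] by simp
  then show "triangle_wave m (2 * m * of_int k + \<sigma> * u) \<le> u"
    using assms by (simp add: abs_mult)
  let ?j = "round ((2 * m * of_int k + \<sigma> * u) / (2 * m))"
  have "u \<le> \<bar>2 * m * of_int k + \<sigma> * u - 2 * m * of_int ?j\<bar>"
  proof (cases "?j = k")
    case True
    then show ?thesis using assms by (simp add: abs_mult)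
  next
    case False
    then have "1 \<le> \<bar>real_of_int (k - ?j)\<bar>" by linarith
    then have "2 * m * 1 \<le> 2 * m * \<bar>real_of_int (k - ?j)\<bar>"
      using assms(1) by (intro mult_left_mono) auto
    moreover have "2 * m * \<bar>real_of_int (k - ?j)\<bar> = \<bar>2 * m * of_int k - 2 * m * of_int ?j\<bar>"
      using assms(1) by (simp add: abs_mult flip: right_diff_distrib)
    moreover have "\<bar>\<sigma> * u\<bar> = u" using assms by (simp add: abs_mult)
    ultimately show ?thesis using assms(4) by linarith
  qed
  then show "u \<le> triangle_wave m (2 * m * of_int k + \<sigma> * u)"
    by (simp add: triangle_wave_def)
qed

lemma triangle_wave_cases:
  obtains k :: int and \<sigma> :: real where "\<bar>\<sigma>\<bar> = 1" "t = 2 * m * of_int k + \<sigma> * triangle_wave m t"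
proof -
  let ?k = "round (t / (2 * m))"
  show thesis
  proof (cases "t \<ge> 2 * m * of_int ?k")
    case True
    then show thesis using that[of 1 ?k] by (simp add: triangle_wave_def)
  next
    case False
    then show thesis using that[of "-1" ?k] by (simp add: triangle_wave_def)
  qed
qed

context real_quasi_normed
begin

text \<open>The hypothesis speaks of curves on the whole line, while the curve built from a vector
  measure lives on \<open>{0..m}\<close>. Folding extends it with the same Lipschitz constant, and a
  derivative of the folded curve is read off along an inverse branch, where \<open>\<sigma>\<close>
  is the direction of travel.\<close>

lemma differentiable_somewhere_within:
  assumes diff: "\<And>F. lipschitz_curve q F \<Longrightarrow> \<exists>s. curve_differentiable_at sc q F s"
    and "m > 0"
    and lip: "\<And>s t. s \<in> {0..m} \<Longrightarrow> t \<in> {0..m} \<Longrightarrow> q (F t - F s) \<le> L * \<bar>t - s\<bar>"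
  shows "\<exists>s\<in>{0..m}. \<exists>v. has_derivative_within F {0..m} s v"
proof -
  let ?G = "\<lambda>t. F (triangle_wave m t)"
  have tw: "triangle_wave m t \<in> {0..m}" for t
    using triangle_wave_nonneg triangle_wave_bound[OF \<open>m > 0\<close>] by simp
  have "L \<ge> 0"
    using lip[of 0 m] \<open>m > 0\<close> q_nonneg[of "F m - F 0"]
    by (auto simp: zero_le_mult_iff dest: order_trans)
  have "q (?G t - ?G s) \<le> L * \<bar>t - s\<bar>" for s t
  proof -
    have "q (?G t - ?G s) \<le> L * \<bar>triangle_wave m t - triangle_wave m s\<bar>"
      using lip tw by blast
    also have "\<dots> \<le> L * \<bar>t - s\<bar>"
      using triangle_wave_lipschitz[OF \<open>m > 0\<close>] \<open>L \<ge> 0\<close> by (rule mult_left_mono)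
    finally show ?thesis .
  qed
  then have "lipschitz_curve q ?G" unfolding lipschitz_curve_def by blast
  then obtain s v where D: "has_derivative_within ?G UNIV s v"
    using diff curve_differentiable_at_iff by blast
  obtain k \<sigma> where \<sigma>: "\<bar>\<sigma>\<bar> = 1" and s: "s = 2 * m * of_int k + \<sigma> * triangle_wave m s"
    by (rule triangle_wave_cases[of s m])
  let ?u = "triangle_wave m s"
  have "has_derivative_within F {0..m} ?u (sc \<sigma> v)"
    unfolding has_derivative_within_def
  proof (intro allI impI)
    fix e :: real assume "e > 0"
    then obtain d where d: "d > 0"
      "\<And>t. \<bar>t - s\<bar> < d \<Longrightarrow> q (?G t - ?G s - sc (t - s) v) \<le> e * \<bar>t - s\<bar>"
      using D unfolding has_derivative_within_def by blast
    have "q (F t - F ?u - sc (t - ?u) (sc \<sigma> v)) \<le> e * \<bar>t - ?u\<bar>"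
      if "t \<in> {0..m}" "\<bar>t - ?u\<bar> < d" for t
    proof -
      \<comment> \<open>The point over \<open>t\<close> on the branch through \<open>s\<close>;
        since \<open>\<bar>\<sigma>\<bar> = 1\<close>, distances on the branch agree with those in
        \<open>{0..m}\<close>.\<close>
      let ?t = "2 * m * of_int k + \<sigma> * t"
      have ts: "?t - s = (t - ?u) * \<sigma>" by (subst s) (simp add: algebra_simps)
      have "\<bar>?t - s\<bar> = \<bar>t - ?u\<bar>" unfolding ts using \<sigma> by (simp add: abs_mult)
      moreover have "?G ?t = F t"
        using triangle_wave_unfold[OF \<open>m > 0\<close> \<sigma>] that by simp
      ultimately show ?thesis
        using d(2)[of ?t] that(2) by (simp add: ts)
    qed
    then show "\<exists>d>0. \<forall>t\<in>{0..m}. \<bar>t - ?u\<bar> < d \<longrightarrow>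
        q (F t - F ?u - sc (t - ?u) (sc \<sigma> v)) \<le> e * \<bar>t - ?u\<bar>"
      using d(1) by blast
  qed
  with tw show ?thesis by blast
qed

end

section \<open>Nowhere differentiable Lipschitz curves in spaces that are not locally convex\<close>

context real_quasi_normed
begin

text \<open>Uniformity in the length of the list is the point: the existence of such an
  \<open>R\<close> amounts to equivalence of \<open>q\<close> with a norm, whereas for lists of a
  fixed length a constant always exists.\<close>

definition sum_bounded :: "real \<Rightarrow> bool" where
  "sum_bounded R \<longleftrightarrow> (\<forall>ys. q (sum_list ys) \<le> R * sum_list (map q ys))"

text \<open>A shortest list violating the bound \<open>R\<close> still obeys the bound \<open>\<kappa> * (R + 1)\<close>, as does every
  list of the same length: split off one term.\<close>

lemma minimal_violation:
  assumes "\<not> sum_bounded R" "R \<ge> 0"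
  obtains ys where "0 \<notin> set ys" "R * sum_list (map q ys) < q (sum_list ys)"
    "\<And>zs. length zs = length ys \<Longrightarrow> q (sum_list zs) \<le> \<kappa> * (R + 1) * sum_list (map q zs)"
proof -
  define bad where "bad n \<longleftrightarrow> (\<exists>ys. length ys = n \<and> R * sum_list (map q ys) < q (sum_list ys))" for n
  have "\<exists>n. bad n" using assms(1) unfolding sum_bounded_def bad_def by (metis not_le)
  define n where "n = (LEAST n. bad n)"
  have "bad n" unfolding n_def using \<open>\<exists>n. bad n\<close> by (rule LeastI_ex)
  then obtain ys where ys: "length ys = n" "R * sum_list (map q ys) < q (sum_list ys)"
    unfolding bad_def by blast
  have min: "q (sum_list zs) \<le> R * sum_list (map q zs)" if "length zs < n" for zs
    using not_less_Least[of "length zs" bad] that unfolding n_def bad_def by force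
  \<comment> \<open>A zero term could be deleted, giving a shorter violation. The terms have to be
    nonzero because the polygon divides by \<open>q y\<close>.\<close>
  have "0 \<notin> set ys"
  proof
    assume 0: "0 \<in> set ys"
    have "length (remove1 0 ys) < n"
      using 0 ys(1) by (metis length_pos_if_in_set length_remove1 diff_less zero_less_one)
    moreover have "sum_list (remove1 0 ys) = sum_list ys"
      "sum_list (map q (remove1 0 ys)) = sum_list (map q ys)"
      using 0 sum_list_map_remove1[of 0 ys "\<lambda>x. x"] sum_list_map_remove1[of 0 ys q] by simp_all
    ultimately show False using min[of "remove1 0 ys"] ys(2) by simp
  qed
  moreover have "q (sum_list zs) \<le> \<kappa> * (R + 1) * sum_list (map q zs)" if "length zs = length ys" for zs
  proof (cases zs)
    case (Cons z zs')
    have S: "0 \<le> sum_list (map q zs')" by (rule sum_list_nonneg) (auto simp: q_nonneg)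
    have "q (sum_list zs) \<le> \<kappa> * (q z + q (sum_list zs'))"
      using Cons q_add by simp
    also have "\<dots> \<le> \<kappa> * (q z + R * sum_list (map q zs'))"
      using min[of zs'] that ys(1) Cons kappa_ge_1 by (intro mult_left_mono add_left_mono) auto
    also have "\<dots> \<le> \<kappa> * ((R + 1) * (q z + sum_list (map q zs')))"
      using S q_nonneg[of z] assms(2) kappa_ge_1 by (intro mult_left_mono) (auto simp: algebra_simps)
    finally show ?thesis using Cons by (simp add: mult.assoc)
  qed simp
  ultimately show thesis using ys(2) that by blast
qed

text \<open>The segments are run through one after the other, segment \<open>y\<close> in time
  \<open>q y\<close>: each has unit speed with respect to \<open>q\<close>, and the total time is
  \<open>sum_list (map q ys)\<close>. Outside this time span the curve rests.\<close>

primrec polygon :: "'a list \<Rightarrow> real \<Rightarrow> 'a" where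
  "polygon [] t = 0"
| "polygon (y # ys) t = sc (max 0 (min (q y) t) / q y) y + polygon ys (t - q y)"

lemma polygon_nonpos: "t \<le> 0 \<Longrightarrow> polygon ys t = 0"
proof (induction ys arbitrary: t)
  case (Cons y ys)
  then show ?case using q_nonneg[of y] by simp
qed simp

lemma polygon_end:
  "0 \<notin> set ys \<Longrightarrow> sum_list (map q ys) \<le> t \<Longrightarrow> polygon ys t = sum_list ys"
proof (induction ys arbitrary: t)
  case (Cons y ys)
  have "0 \<le> sum_list (map q ys)" by (rule sum_list_nonneg) (auto simp: q_nonneg)
  moreover have "q y > 0" using Cons.prems q_pos by auto
  ultimately have "max 0 (min (q y) t) / q y = 1" using Cons.prems by simp
  then show ?case using Cons by simp
qed simp

text \<open>An increment splits into one multiple of each segment, possibly zero. Keeping the zero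
  terms preserves the length of the list, so that the bound from \<open>minimal_violation\<close>
  applies to every chord.\<close>

lemma polygon_increment:
  assumes "0 \<notin> set ys" "s \<le> t"
  shows "\<exists>zs. length zs = length ys \<and> polygon ys t - polygon ys s = sum_list zs \<and>
    sum_list (map q zs) \<le> max 0 t - max 0 s"
  using assms
proof (induction ys arbitrary: s t)
  case (Cons y ys)
  then obtain zs where zs: "length zs = length ys"
    "polygon ys (t - q y) - polygon ys (s - q y) = sum_list zs"
    "sum_list (map q zs) \<le> max 0 (t - q y) - max 0 (s - q y)"
    by (metis diff_right_mono list.set_intros(2))
  let ?c = "\<lambda>t. max 0 (min (q y) t)"
  have qy: "q y > 0" using Cons.prems q_pos by auto
  have c: "?c s \<le> ?c t" using Cons.prems by auto
  have qz: "q (sc (?c t / q y - ?c s / q y) y) = ?c t - ?c s"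
    using qy c by (simp add: q_scale flip: diff_divide_distrib)
  have "polygon (y # ys) t - polygon (y # ys) s = sum_list (sc (?c t / q y - ?c s / q y) y # zs)"
    unfolding sum_list.Cons zs(2)[symmetric] scale_left_diff_distrib by simp
  moreover have "sum_list (map q (sc (?c t / q y - ?c s / q y) y # zs)) \<le> max 0 t - max 0 s"
    using zs(3) qy Cons.prems(2) by (simp add: qz)
  ultimately show ?case using zs(1) by (metis length_Cons)
qed simp

text \<open>Below the length of the shortest segment a chord meets at most two consecutive segments,
  so a single quasi-triangle inequality suffices. The second conjunct serves the induction at a
  corner: shortly after the start only the first segment has been touched.\<close>

lemma polygon_fine:
  assumes "0 \<notin> set ys"
  shows "\<exists>\<delta>>0. (\<forall>s t. s \<le> t \<longrightarrow> t \<le> s + \<delta> \<longrightarrow> q (polygon ys t - polygon ys s) \<le> \<kappa> * (t - s)) \<and>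
    (\<forall>u. 0 \<le> u \<longrightarrow> u \<le> \<delta> \<longrightarrow> q (polygon ys u) \<le> u)"
  using assms
proof (induction ys)
  case Nil
  then show ?case using kappa_ge_1 by (intro exI[of _ 1]) auto
next
  case (Cons y ys)
  then obtain \<delta> where \<delta>: "\<delta> > 0"
    "\<And>s t. s \<le> t \<Longrightarrow> t \<le> s + \<delta> \<Longrightarrow> q (polygon ys t - polygon ys s) \<le> \<kappa> * (t - s)"
    "\<And>u. 0 \<le> u \<Longrightarrow> u \<le> \<delta> \<Longrightarrow> q (polygon ys u) \<le> u"
    by auto
  have qy: "q y > 0" using Cons.prems q_pos by auto
  let ?c = "\<lambda>t. max 0 (min (q y) t)"
  have qz: "q (sc (?c t / q y) y - sc (?c s / q y) y) = ?c t - ?c s" if "s \<le> t" for s t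
  proof -
    have "?c s \<le> ?c t" using that by auto
    then show ?thesis
      using qy by (simp add: q_scale flip: scale_left_diff_distrib diff_divide_distrib)
  qed
  have "q (polygon (y # ys) t - polygon (y # ys) s) \<le> \<kappa> * (t - s)"
    if "s \<le> t" "t \<le> s + min \<delta> (q y)" for s t
  proof -
    have k: "t - s \<le> \<kappa> * (t - s)" using that(1) kappa_ge_1 mult_right_mono[of 1 \<kappa> "t - s"] by simp
    consider "t \<le> q y" | "q y \<le> s" | "s < q y" "q y < t" by linarith
    then show ?thesis
    proof cases
      case 1
      then have "q (polygon (y # ys) t - polygon (y # ys) s) = ?c t - ?c s"
        using that by (simp add: polygon_nonpos qz del: max.absorb1 max.absorb2 min.absorb1 min.absorb2)
      also have "\<dots> \<le> t - s" using that by auto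
      finally show ?thesis using k by linarith
    next
      case 2
      then have "polygon (y # ys) t - polygon (y # ys) s = polygon ys (t - q y) - polygon ys (s - q y)"
      proof -
        have "?c t = q y" "?c s = q y" using 2 that qy by auto
        then show ?thesis by simp
      qed
      then show ?thesis using \<delta>(2)[of "s - q y" "t - q y"] that by (simp del: polygon.simps)
    next
      case 3
      then have "polygon (y # ys) t - polygon (y # ys) s
          = (sc (?c t / q y) y - sc (?c s / q y) y) + polygon ys (t - q y)"
        by (simp add: polygon_nonpos)
      then have "q (polygon (y # ys) t - polygon (y # ys) s)
          \<le> \<kappa> * ((?c t - ?c s) + q (polygon ys (t - q y)))"
        using q_add[of "sc (?c t / q y) y - sc (?c s / q y) y" "polygon ys (t - q y)"]
          qz[OF that(1)] by (simp only:)
      also have "\<dots> \<le> \<kappa> * ((?c t - ?c s) + (t - q y))"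
        using \<delta>(3)[of "t - q y"] 3 that kappa_ge_1 by (intro mult_left_mono add_left_mono) auto
      also have "\<dots> \<le> \<kappa> * (t - s)"
        using 3 kappa_ge_1 qy by (intro mult_left_mono) auto
      finally show ?thesis .
    qed
  qed
  moreover have "q (polygon (y # ys) u) \<le> u" if "0 \<le> u" "u \<le> min \<delta> (q y)" for u
    using that qy by (simp add: polygon_nonpos q_scale)
  ultimately show ?case using \<delta>(1) qy by (intro exI[of _ "min \<delta> (q y)"]) auto
qed

text \<open>One layer of the later curve: steep at scale \<open>D\<close>, nearly flat up to scale
  \<open>d\<close>, and of height at most \<open>e * d0\<close>, hence negligible in chords of
  length at least \<open>d0\<close>. The last two clauses provide, around every point, a chord of
  slope at least one and a chord of slope zero.\<close>

definition oscillation :: "real \<Rightarrow> real \<Rightarrow> (real \<Rightarrow> 'a) \<Rightarrow> real \<Rightarrow> real \<Rightarrow> bool" where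
  "oscillation e d0 G d D \<longleftrightarrow> 0 < d \<and> d < D \<and> 2 * D \<le> d0 \<and>
    (\<forall>s t. q (G t - G s) \<le> 2 * \<kappa> * \<bar>t - s\<bar>) \<and>
    (\<forall>s t. \<bar>t - s\<bar> \<le> d \<longrightarrow> q (G t - G s) \<le> e * \<bar>t - s\<bar>) \<and>
    (\<forall>t. q (G t) \<le> e * d0) \<and>
    (\<forall>s. \<exists>a b. a \<le> s \<and> s \<le> b \<and> b - a = D \<and> D \<le> q (G b - G a)) \<and>
    (\<forall>s. \<exists>a b. a \<le> s \<and> s \<le> b \<and> b - a = 2 * D \<and> G b = G a)"

text \<open>The polygon of a minimal violation has a chord of slope above \<open>R\<close>,
  Lipschitz constant \<open>\<kappa> * (R + 1)\<close> and fine slopes at most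
  \<open>\<kappa>\<close>. Division by \<open>R\<close> turns these into more than one, at most
  \<open>2 * \<kappa>\<close> and at most \<open>e\<close>. Dilating time and space by the same
  factor keeps the slopes and gives the steep chord the length \<open>D\<close>.\<close>

lemma oscillation_exists:
  assumes unbounded: "\<And>R. \<not> sum_bounded R" and "e > 0" "d0 > 0"
  shows "\<exists>G d D. oscillation e d0 G d D"
proof -
  \<comment> \<open>\<open>\<kappa> / e\<close> makes the fine slopes at most \<open>e\<close> after
    division by \<open>R\<close>; \<open>R \<ge> 1\<close> keeps the Lipschitz constant at most
    \<open>2 * \<kappa>\<close>.\<close>
  define R where "R = max 1 (\<kappa> / e)"
  have R: "R \<ge> 1" "\<kappa> / R \<le> e" "\<kappa> * (R + 1) / R \<le> 2 * \<kappa>"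
  proof -
    show R1: "R \<ge> 1" by (simp add: R_def)
    have "\<kappa> / e \<le> R" by (simp add: R_def)
    then show "\<kappa> / R \<le> e" using assms(2) R1 by (simp add: field_simps)
    have "\<kappa> * 1 \<le> \<kappa> * R" using kappa_ge_1 R1 by (intro mult_left_mono) auto
    then show "\<kappa> * (R + 1) / R \<le> 2 * \<kappa>" using R1 by (simp add: field_simps)
  qed
  obtain ys where ys: "0 \<notin> set ys" "R * sum_list (map q ys) < q (sum_list ys)"
    "\<And>zs. length zs = length ys \<Longrightarrow> q (sum_list zs) \<le> \<kappa> * (R + 1) * sum_list (map q zs)"
    using minimal_violation[OF unbounded, of R] R(1) by (metis order_trans zero_le_one)
  define \<Lambda> where "\<Lambda> = sum_list (map q ys)"
  define P where "P = polygon ys"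
  have P0: "P 0 = 0" and P\<Lambda>: "P \<Lambda> = sum_list ys"
    using polygon_nonpos polygon_end[OF ys(1)] by (auto simp: P_def \<Lambda>_def)
  have "\<Lambda> \<ge> 0" unfolding \<Lambda>_def by (rule sum_list_nonneg) (auto simp: q_nonneg)
  moreover have "\<Lambda> \<noteq> 0"
  proof
    assume "\<Lambda> = 0"
    then show False using P0 P\<Lambda> ys(2) unfolding \<Lambda>_def by simp
  qed
  ultimately have \<Lambda>: "\<Lambda> > 0" by simp
  have Plip: "q (P t - P s) \<le> \<kappa> * (R + 1) * \<bar>t - s\<bar>" for s t
  proof -
    have *: "q (P t - P s) \<le> \<kappa> * (R + 1) * (t - s)" if st: "s \<le> t" for s t
    proof -
      obtain zs where zs: "length zs = length ys" "P t - P s = sum_list zs"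
        "sum_list (map q zs) \<le> max 0 t - max 0 s"
        using polygon_increment[OF ys(1) st] unfolding P_def by blast
      have "q (P t - P s) \<le> \<kappa> * (R + 1) * sum_list (map q zs)" using ys(3) zs by simp
      also have "\<dots> \<le> \<kappa> * (R + 1) * (t - s)"
        using zs(3) st R kappa_ge_1 by (intro mult_left_mono) auto
      finally show ?thesis .
    qed
    show ?thesis using *[of s t] *[of t s] q_diff_commute[of "P t"] by (cases "s \<le> t") auto
  qed
  obtain \<delta> where \<delta>: "\<delta> > 0" "\<And>s t. s \<le> t \<Longrightarrow> t \<le> s + \<delta> \<Longrightarrow> q (P t - P s) \<le> \<kappa> * (t - s)"
    using polygon_fine[OF ys(1)] unfolding P_def by blast
  have Pfine: "q (P t - P s) \<le> \<kappa> * \<bar>t - s\<bar>" if "\<bar>t - s\<bar> \<le> \<delta>" for s t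
    using \<delta>(2)[of s t] \<delta>(2)[of t s] that q_diff_commute[of "P t"] by (cases "s \<le> t") auto

  define D where "D = min (d0 / 2) (e * d0 / (2 * \<kappa>))"
  have D: "D > 0" "2 * D \<le> d0" "2 * \<kappa> * D \<le> e * d0"
  proof -
    show "D > 0" "2 * D \<le> d0" using assms kappa_ge_1 by (auto simp: D_def)
    have "D \<le> e * d0 / (2 * \<kappa>)" by (simp add: D_def)
    then show "2 * \<kappa> * D \<le> e * d0" using kappa_ge_1 by (simp add: field_simps)
  qed
  define \<rho> where "\<rho> = D / \<Lambda>"
  have \<rho>: "\<rho> > 0" "\<rho> * \<Lambda> = D" using D \<Lambda> by (auto simp: \<rho>_def)
  \<comment> \<open>Running to and fro along the polygon makes \<open>G\<close> periodic with period
    \<open>2 * D\<close>; it vanishes in the valleys and is large at the peaks, which are at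
    distance \<open>D\<close> from them.\<close>
  define tri where "tri t = triangle_wave \<Lambda> (t / \<rho>)" for t
  define G where "G t = sc (\<rho> / R) (P (tri t))" for t
  have trilip: "\<bar>tri t - tri s\<bar> \<le> \<bar>t - s\<bar> / \<rho>" for s t
    using triangle_wave_lipschitz[OF \<Lambda>, of "t / \<rho>" "s / \<rho>"] \<rho>(1)
    by (simp add: tri_def flip: diff_divide_distrib)
  have qG: "q (G t - G s) = \<rho> / R * q (P (tri t) - P (tri s))" for s t
    using \<rho>(1) R(1) by (simp add: G_def q_scale flip: scale_right_diff_distrib)
  have *: "q (G t - G s) \<le> c / R * \<bar>t - s\<bar>"
    if "q (P (tri t) - P (tri s)) \<le> c * \<bar>tri t - tri s\<bar>" "c \<ge> 0" for s t c
  proof -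
    have "q (G t - G s) \<le> \<rho> / R * (c * \<bar>tri t - tri s\<bar>)"
      unfolding qG using that \<rho> R by (intro mult_left_mono) auto
    also have "\<dots> \<le> \<rho> / R * (c * (\<bar>t - s\<bar> / \<rho>))"
      using trilip that(2) \<rho> R by (intro mult_left_mono) auto
    finally show ?thesis using \<rho> by simp
  qed
  have Glip: "q (G t - G s) \<le> 2 * \<kappa> * \<bar>t - s\<bar>" for s t
  proof -
    have "q (G t - G s) \<le> \<kappa> * (R + 1) / R * \<bar>t - s\<bar>"
      using Plip R kappa_ge_1 by (intro *) auto
    also have "\<dots> \<le> 2 * \<kappa> * \<bar>t - s\<bar>" using R(3) by (rule mult_right_mono) simp
    finally show ?thesis .
  qed
  \<comment> \<open>\<open>\<delta> * \<rho>\<close> is the fine scale of the polygon after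
    dilation; \<open>D / 2\<close> keeps \<open>d\<close> below \<open>D\<close>.\<close>
  define d where "d = min (\<delta> * \<rho>) (D / 2)"
  have Gfine: "q (G t - G s) \<le> e * \<bar>t - s\<bar>" if "\<bar>t - s\<bar> \<le> d" for s t
  proof -
    have "\<bar>t - s\<bar> \<le> \<delta> * \<rho>" using that by (simp add: d_def)
    then have "\<bar>t - s\<bar> / \<rho> \<le> \<delta>" using \<rho>(1) by (simp add: pos_divide_le_eq)
    then have "\<bar>tri t - tri s\<bar> \<le> \<delta>" using trilip[of t s] by linarith
    then have "q (G t - G s) \<le> \<kappa> / R * \<bar>t - s\<bar>"
      using Pfine kappa_ge_1 by (intro *) auto
    also have "\<dots> \<le> e * \<bar>t - s\<bar>" using R(2) by (rule mult_right_mono) simp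
    finally show ?thesis .
  qed
  have tri_eq: "tri (\<rho> * (2 * \<Lambda> * of_int k + \<sigma> * u)) = u"
    if "\<bar>\<sigma>\<bar> = 1" "0 \<le> u" "u \<le> \<Lambda>" for k \<sigma> u
    using triangle_wave_unfold[OF \<Lambda> that] \<rho>(1) by (simp add: tri_def)
  have Gz: "G (\<rho> * (2 * \<Lambda> * of_int k)) = 0" for k
    using tri_eq[of 1 0 k] \<Lambda> by (simp add: G_def P0)
  have Gbound: "q (G t) \<le> e * d0" for t
  proof -
    have t0: "\<bar>tri t\<bar> \<le> \<Lambda>"
      using triangle_wave_bound[OF \<Lambda>] triangle_wave_nonneg by (simp add: tri_def)
    have "q (G t) = \<rho> / R * q (P (tri t) - P 0)"
      using \<rho>(1) R(1) by (simp add: G_def q_scale P0)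
    also have "\<dots> \<le> \<rho> / R * (\<kappa> * (R + 1) * \<bar>tri t - 0\<bar>)"
      using Plip[of "tri t" 0] \<rho> R by (intro mult_left_mono) (auto simp del: \<rho>(2))
    also have "\<dots> = \<kappa> * (R + 1) / R * (\<rho> * \<bar>tri t\<bar>)" by simp
    also have "\<dots> \<le> 2 * \<kappa> * (\<rho> * \<Lambda>)"
      using R(3) t0 \<rho>(1) kappa_ge_1 R(1) by (intro mult_mono) auto
    also have "\<dots> \<le> e * d0" using D(3) \<rho>(2) by simp
    finally show ?thesis .
  qed
  have "(\<exists>a b. a \<le> s \<and> s \<le> b \<and> b - a = D \<and> D \<le> q (G b - G a)) \<and>
      (\<exists>a b. a \<le> s \<and> s \<le> b \<and> b - a = 2 * D \<and> G b = G a)" for s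
  proof -
    obtain k \<sigma> where k: "\<bar>\<sigma>\<bar> = 1" "s / \<rho> = 2 * \<Lambda> * of_int k + \<sigma> * tri s"
      unfolding tri_def by (rule triangle_wave_cases)
    \<comment> \<open>\<open>z\<close> is the valley of the branch through \<open>s\<close>, and
      \<open>z'\<close> the peak next to it on the side of \<open>s\<close>. The steep chord runs
      between them; a whole period starting at \<open>z\<close> towards \<open>s\<close> gives the
      level chord.\<close>
    define z where "z = \<rho> * (2 * \<Lambda> * of_int k)"
    define z' where "z' = \<rho> * (2 * \<Lambda> * of_int k + \<sigma> * \<Lambda>)"
    have "s = \<rho> * (2 * \<Lambda> * of_int k + \<sigma> * tri s)" using k(2) \<rho>(1) by (simp add: field_simps)
    then have s: "s = z + \<sigma> * (\<rho> * tri s)" unfolding z_def by (simp add: algebra_simps)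
    have z': "z' = z + \<sigma> * D" unfolding z'_def z_def by (simp add: algebra_simps flip: \<rho>(2))
    have u: "0 \<le> \<rho> * tri s" "\<rho> * tri s \<le> D"
      using triangle_wave_bound[OF \<Lambda>, of "s / \<rho>"] triangle_wave_nonneg[of \<Lambda> "s / \<rho>"] \<rho>
      by (auto simp: tri_def simp flip: \<rho>(2))
    have Gz0: "G z = 0" using Gz[of k] by (simp add: z_def)
    have "q (G z') = \<rho> / R * q (sum_list ys)"
      using tri_eq[of \<sigma> \<Lambda> k] k(1) \<Lambda> \<rho> R by (simp add: G_def z'_def P\<Lambda> q_scale)
    also have "\<dots> \<ge> \<rho> / R * (R * \<Lambda>)"
      using ys(2) \<rho> R by (intro mult_left_mono) (auto simp: \<Lambda>_def)
    finally have Gz': "D \<le> q (G z')" using R(1) \<rho>(2) by simp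
    have pm: "\<sigma> = 1 \<or> \<sigma> = -1" using k(1) by linarith
    have e1: "G (z + 2 * D) = 0" using Gz[of "k + 1"] by (simp add: z_def algebra_simps flip: \<rho>(2))
    have e2: "G (z - 2 * D) = 0" using Gz[of "k - 1"] by (simp add: z_def algebra_simps flip: \<rho>(2))
    from pm show ?thesis
    proof
      assume "\<sigma> = 1"
      moreover have "z \<le> s \<and> s \<le> z + D" using s u \<open>\<sigma> = 1\<close> by auto
      ultimately have "z \<le> s \<and> s \<le> z' \<and> z' - z = D \<and> D \<le> q (G z' - G z)"
        "z \<le> s \<and> s \<le> z + 2 * D \<and> z + 2 * D - z = 2 * D \<and> G (z + 2 * D) = G z"
        using z' Gz0 Gz' e1 D(1) by auto
      then show ?thesis by blast
    next
      assume "\<sigma> = -1"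
      moreover have "z - D \<le> s \<and> s \<le> z" using s u \<open>\<sigma> = -1\<close> by auto
      ultimately have "z' \<le> s \<and> s \<le> z \<and> z - z' = D \<and> D \<le> q (G z - G z')"
        "z - 2 * D \<le> s \<and> s \<le> z \<and> z - (z - 2 * D) = 2 * D \<and> G z = G (z - 2 * D)"
        using z' Gz0 Gz' e2 D(1) by auto
      then show ?thesis by blast
    qed
  qed
  moreover have "0 < d" "d < D" using \<delta>(1) \<rho>(1) D(1) by (auto simp: d_def)
  ultimately have "oscillation e d0 G d D"
    unfolding oscillation_def using D(2) Glip Gfine Gbound by simp
  then show ?thesis by blast
qed

section \<open>Superposition of layers at all scales\<close>

lemma q_series_converges:
  assumes "complete_wrt q" and x: "\<And>k. \<kappa> ^ Suc k * q (x k) \<le> c / 2 ^ Suc k"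
  shows "\<exists>l. (\<lambda>n. q ((\<Sum>k<n. x k) - l)) \<longlonglongrightarrow> 0"
proof -
  have c: "c \<ge> 0" using order_trans[OF _ x[of 0], of 0] q_nonneg[of "x 0"] kappa_ge_1 by simp
  have tail: "q ((\<Sum>k<n. x k) - (\<Sum>k<m. x k)) \<le> c / 2 ^ m" if "m \<le> n" for m n
  proof -
    have "(\<Sum>k<m + j. x k) - (\<Sum>k<m. x k) = (\<Sum>k<j. x (m + k))" for j
      by (induction j) (simp_all add: algebra_simps)
    from this[of "n - m"] have "(\<Sum>k<n. x k) - (\<Sum>k<m. x k) = (\<Sum>k<n - m. x (m + k))"
      using that by simp
    then have "q ((\<Sum>k<n. x k) - (\<Sum>k<m. x k)) \<le> (\<Sum>k<n - m. \<kappa> ^ Suc k * q (x (m + k)))"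
      using q_sum_le by simp
    also have "\<dots> \<le> (\<Sum>k<n - m. c / 2 ^ Suc (m + k))"
    proof (rule sum_mono)
      fix k
      \<comment> \<open>The weights of the tail restart at \<open>\<kappa>\<close>; replacing them
        by the weights of the full series only increases the sum.\<close>
      have "\<kappa> ^ Suc k * q (x (m + k)) \<le> \<kappa> ^ Suc (m + k) * q (x (m + k))"
        using kappa_ge_1 q_nonneg by (intro mult_right_mono power_increasing) auto
      then show "\<kappa> ^ Suc k * q (x (m + k)) \<le> c / 2 ^ Suc (m + k)" using x[of "m + k"] by linarith
    qed
    also have "\<dots> = c / 2 ^ m * (1 - (1 / 2) ^ (n - m))"
    proof -
      have "(\<Sum>k<j. c / 2 ^ Suc (m + k)) = c / 2 ^ m * (1 - (1 / 2) ^ j)" for j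
        by (induction j) (simp_all add: power_add field_simps)
      then show ?thesis .
    qed
    also have "\<dots> \<le> c / 2 ^ m" using c by (intro mult_left_le) auto
    finally show ?thesis .
  qed
  have "\<exists>n0. \<forall>m\<ge>n0. \<forall>n\<ge>n0. q ((\<Sum>k<m. x k) - (\<Sum>k<n. x k)) < e" if e: "e > 0" for e :: real
  proof -
    have "(\<lambda>n. c / 2 ^ n) \<longlonglongrightarrow> 0"
      by (rule LIMSEQ_divide_realpow_zero) simp
    then have "\<forall>\<^sub>F n in sequentially. c / 2 ^ n < e" using e by (rule order_tendstoD(2))
    then obtain n0 where n0: "\<And>n. n \<ge> n0 \<Longrightarrow> c / 2 ^ n < e"
      unfolding eventually_sequentially by blast
    have "q ((\<Sum>k<m. x k) - (\<Sum>k<n. x k)) < e" if "m \<ge> n0" "n \<ge> n0" for m n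
    proof (cases "m \<le> n")
      case True
      then show ?thesis
        using tail[OF True] n0[OF that(1)] q_diff_commute[of "\<Sum>k<m. x k" "\<Sum>k<n. x k"] by linarith
    next
      case False
      then show ?thesis using tail[of n m] n0[OF that(2)] by simp
    qed
    then show ?thesis by blast
  qed
  with assms(1)[unfolded complete_wrt_def, THEN spec, of "\<lambda>n. \<Sum>k<n. x k"]
  show ?thesis by (elim impE) (intro allI impI)
qed


text \<open>At a length between \<open>d (Suc k)\<close> and \<open>d k\<close> the earlier layers
  are in their flat regime and the later ones are too low to count, so the curve moves almost like
  \<open>G k\<close> alone. The steep and the level chords of \<open>G k\<close>, of lengths
  \<open>D k\<close> and \<open>2 * D k\<close>, both fall into this window.\<close>

lemma sum_bounded_if_differentiable:
  assumes compl: "complete_wrt q"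
    and diff: "\<And>F. lipschitz_curve q F \<Longrightarrow> \<exists>s. curve_differentiable_at sc q F s"
  shows "\<exists>R. sum_bounded R"
proof (rule ccontr)
  assume "\<nexists>R. sum_bounded R"
  then have unb: "\<And>R. \<not> sum_bounded R" by blast
  obtain g f h where gfh: "\<And>e d0. e > 0 \<Longrightarrow> d0 > 0 \<Longrightarrow> oscillation e d0 (g e d0) (f e d0) (h e d0)"
    using oscillation_exists[OF unb] by metis
  \<comment> \<open>With this value the other layers are bounded by \<open>1 / 2\<close> in the
    final comparison of slopes, against a jump of at least one.\<close>
  define \<tau> where "\<tau> = 1 / (8 * \<kappa> ^ 4)"
  \<comment> \<open>\<open>\<kappa> ^ Suc k\<close> in the denominator cancels the weights of
    \<open>q_sum_le\<close>; the remaining powers of two sum to at most one.\<close>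
  define e where "e k = \<tau> / (2 * \<kappa>) ^ Suc k" for k
  \<comment> \<open>The flat scale of each layer is the reference scale of the next one.\<close>
  define d where "d = rec_nat 1 (\<lambda>k. f (e k))"
  define G where "G k = g (e k) (d k)" for k
  define D where "D k = h (e k) (d k)" for k
  have d0: "d 0 = 1" and dS: "d (Suc k) = f (e k) (d k)" for k by (simp_all add: d_def)
  have \<tau>: "\<tau> > 0" "\<kappa> * (\<kappa> * (2 * \<kappa> * (2 * \<kappa> * \<tau>))) * 2 = 1"
    using kappa_ge_1 by (auto simp: \<tau>_def power_numeral_reduce)
  have e: "e k > 0" for k using \<tau> kappa_ge_1 by (simp add: e_def)
  have ke: "\<kappa> ^ Suc k * e k = \<tau> / 2 ^ Suc k" for k
    using kappa_ge_1 by (simp add: e_def power_mult_distrib)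
  have dpos: "d k > 0" for k
  proof (induction k)
    case (Suc k)
    then show ?case using gfh[OF e Suc, of k] by (simp add: dS oscillation_def)
  qed (simp add: d0)
  have osc: "oscillation (e k) (d k) (G k) (d (Suc k)) (D k)" for k
    using gfh[OF e dpos] by (simp add: dS G_def D_def)
  have Dd: "d (Suc k) < D k" "2 * D k \<le> d k" for k using osc[of k] by (auto simp: oscillation_def)
  have dhalf: "d (Suc k) \<le> d k / 2" for k using Dd[of k] by linarith
  have dle: "d k \<le> 1 / 2 ^ k" for k
  proof (induction k)
    case (Suc k)
    then show ?case using dhalf[of k] by simp
  qed (simp add: d0)
  have dmono: "d j \<le> d i" if "i \<le> j" for i j
  proof (rule lift_Suc_antimono_le[OF _ that])
    show "d (Suc n) \<le> d n" for n using dhalf[of n] dpos[of n] by linarith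
  qed
  have dsmall: "\<exists>k. d k < z" if z: "z > 0" for z
  proof -
    obtain k where "(1 / 2) ^ k < z" using real_arch_pow_inv[OF z, of "1/2"] by auto
    then show ?thesis using dle[of k] by (intro exI[of _ k]) (simp add: power_divide)
  qed
  have Glip: "q (G k t - G k s) \<le> 2 * \<kappa> * \<bar>t - s\<bar>" for k s t
    using osc[of k] by (simp add: oscillation_def)
  have Gfine: "q (G k t - G k s) \<le> e k * \<bar>t - s\<bar>" if "\<bar>t - s\<bar> \<le> d (Suc k)" for k s t
    using osc[of k] that by (simp add: oscillation_def)
  have Gbd: "q (G k t) \<le> e k * d k" for k t using osc[of k] by (simp add: oscillation_def)
  have Gbd1: "q (G k t) \<le> e k" for k t
    using Gbd[of k t] mult_left_mono[of "d k" 1 "e k"] dmono[of 0 k] less_imp_le[OF e[of k]]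
    by (simp add: d0)
  have "\<exists>l. (\<lambda>n. q ((\<Sum>k<n. G k t) - l)) \<longlonglongrightarrow> 0" for t
  proof (rule q_series_converges[OF compl])
    show "\<kappa> ^ Suc k * q (G k t) \<le> \<tau> / 2 ^ Suc k" for k
      using mult_left_mono[OF Gbd1[of k t], of "\<kappa> ^ Suc k"] kappa_ge_1 by (simp only: ke) simp
  qed
  then obtain F where F: "\<And>t. (\<lambda>n. q ((\<Sum>k<n. G k t) - F t)) \<longlonglongrightarrow> 0" by metis

  have sumle: "q l \<le> \<kappa> * (B * \<tau>)"
    if x: "\<And>j. q (x j) \<le> B * e j" and lim: "(\<lambda>n. q ((\<Sum>j<n. x j) - l)) \<longlonglongrightarrow> 0" and B: "B \<ge> 0"
    for x l B
  proof (rule q_limit_le[OF lim])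
    have "q (\<Sum>j<n. x j) \<le> B * \<tau>" for n
    proof -
      have "q (\<Sum>j<n. x j) \<le> (\<Sum>j<n. \<kappa> ^ Suc j * q (x j))" by (rule q_sum_le)
      also have "\<dots> \<le> (\<Sum>j<n. B * \<tau> / 2 ^ Suc j)"
      proof (rule sum_mono)
        fix j
        have "\<kappa> ^ Suc j * q (x j) \<le> \<kappa> ^ Suc j * (B * e j)"
          using x kappa_ge_1 by (intro mult_left_mono) auto
        also have "\<dots> = B * (\<kappa> ^ Suc j * e j)" by simp
        finally show "\<kappa> ^ Suc j * q (x j) \<le> B * \<tau> / 2 ^ Suc j" unfolding ke by simp
      qed
      also have "\<dots> = B * \<tau> * (1 - (1 / 2) ^ n)"
        by (induction n) (simp_all add: field_simps)
      also have "\<dots> \<le> B * \<tau>" using B \<tau>(1) by (simp add: mult_left_le)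
      finally show ?thesis .
    qed
    then show "\<forall>\<^sub>F n in sequentially. q (\<Sum>j<n. x j) \<le> B * \<tau>" by simp
  qed
  have limdiff: "(\<lambda>n. q ((\<Sum>j<n. G j t - G j s) - (F t - F s))) \<longlonglongrightarrow> 0" for s t
  proof (rule q_tendsto_0I)
    show "(\<lambda>n. \<kappa> * (q ((\<Sum>j<n. G j t) - F t) + q ((\<Sum>j<n. G j s) - F s))) \<longlonglongrightarrow> 0"
      by (auto intro!: tendsto_eq_intros F)
    show "q ((\<Sum>j<n. G j t - G j s) - (F t - F s))
        \<le> \<kappa> * (q ((\<Sum>j<n. G j t) - F t) + q ((\<Sum>j<n. G j s) - F s))" for n
      using q_diff[of "(\<Sum>j<n. G j t) - F t" "(\<Sum>j<n. G j s) - F s"]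
      by (simp add: sum_subtractf algebra_simps)
  qed

  let ?\<theta> = "\<kappa> * (2 * \<kappa> * \<tau>)"
  have \<theta>: "?\<theta> \<ge> 0" using \<tau> kappa_ge_1 by simp
  have main: "q ((F t - F s) - (G k t - G k s)) \<le> ?\<theta> * \<bar>t - s\<bar>"
    if ts: "d (Suc k) < \<bar>t - s\<bar>" "\<bar>t - s\<bar> \<le> d k" for s t k
  proof -
    \<comment> \<open>Layer \<open>k\<close> is deleted from the series rather than estimated; at
      this length every other layer \<open>j\<close> has slope at most
      \<open>2 * \<kappa> * e j\<close>.\<close>
    define x where "x j = (if j = k then 0 else G j t - G j s)" for j
    have xs: "(\<Sum>j<n. x j) = (\<Sum>j<n. G j t - G j s) - (G k t - G k s)" if "n > k" for n
      using that unfolding x_def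
      by (subst (2) sum.remove[of _ k]) (auto simp: sum.If_cases Int_def intro!: sum.cong)
    have lim: "(\<lambda>n. q ((\<Sum>j<n. x j) - ((F t - F s) - (G k t - G k s)))) \<longlonglongrightarrow> 0"
    proof (rule Lim_transform_eventually[OF limdiff[of t s]])
      show "\<forall>\<^sub>F n in sequentially. q ((\<Sum>j<n. G j t - G j s) - (F t - F s))
          = q ((\<Sum>j<n. x j) - ((F t - F s) - (G k t - G k s)))"
        using eventually_gt_at_top[of k] by eventually_elim (simp add: xs)
    qed
    have "q (x j) \<le> 2 * \<kappa> * \<bar>t - s\<bar> * e j" for j
    proof -
      consider "j = k" | "j < k" | "j > k" by linarith
      then show ?thesis
      proof cases
        case 1
        then show ?thesis using e[of j] kappa_ge_1 by (simp add: x_def)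
      next
        case 2
        then have "\<bar>t - s\<bar> \<le> d (Suc j)" using ts(2) dmono[of "Suc j" k] by simp
        then have "q (x j) \<le> e j * \<bar>t - s\<bar>" using Gfine 2 by (simp add: x_def)
        also have "\<dots> \<le> 2 * \<kappa> * (e j * \<bar>t - s\<bar>)"
          using kappa_ge_1 e[of j] mult_right_mono[of 1 "2 * \<kappa>" "e j * \<bar>t - s\<bar>"] by simp
        finally show ?thesis by (simp add: mult_ac)
      next
        case 3
        then have dj: "d j \<le> \<bar>t - s\<bar>" using ts(1) dmono[of "Suc k" j] by simp
        have "q (x j) \<le> \<kappa> * (q (G j t) + q (G j s))" using 3 q_diff by (simp add: x_def)
        also have "\<dots> \<le> \<kappa> * (e j * d j + e j * d j)"
          using Gbd kappa_ge_1 by (intro mult_left_mono add_mono) auto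
        also have "\<dots> = 2 * \<kappa> * e j * d j" by simp
        also have "\<dots> \<le> 2 * \<kappa> * e j * \<bar>t - s\<bar>"
          using dj e[of j] kappa_ge_1 by (intro mult_left_mono) auto
        finally show ?thesis by (simp add: mult_ac)
      qed
    qed
    from sumle[OF this lim] kappa_ge_1 show ?thesis by (simp add: mult_ac)
  qed

  have lip: "q (F t - F s) \<le> \<kappa> * (2 * \<kappa> + ?\<theta>) * \<bar>t - s\<bar>" for s t
  proof -
    consider "t = s" | "\<bar>t - s\<bar> > 1" | "0 < \<bar>t - s\<bar>" "\<bar>t - s\<bar> \<le> 1" by fastforce
    then show ?thesis
    proof cases
      case 2
      \<comment> \<open>Lengths above \<open>d 0 = 1\<close> belong to no window; there the heights
        of the layers bound the increment.\<close>
      have "q (F t - F s) \<le> \<kappa> * (2 * \<kappa> * \<tau>)"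
      proof (rule sumle[OF _ limdiff])
        fix j
        have "q (G j t - G j s) \<le> \<kappa> * (q (G j t) + q (G j s))" by (rule q_diff)
        also have "\<dots> \<le> \<kappa> * (e j + e j)"
          using Gbd1 kappa_ge_1 by (intro mult_left_mono add_mono) auto
        finally show "q (G j t - G j s) \<le> 2 * \<kappa> * e j" by simp
      qed (use kappa_ge_1 in simp)
      also have "\<dots> \<le> ?\<theta> * \<bar>t - s\<bar>" using 2 \<theta> by (simp add: mult_le_cancel_left1)
      also have "\<dots> \<le> \<kappa> * (2 * \<kappa> + ?\<theta>) * \<bar>t - s\<bar>"
      proof (rule mult_right_mono)
        show "?\<theta> \<le> \<kappa> * (2 * \<kappa> + ?\<theta>)"
        proof -
          have "2 * \<kappa> + ?\<theta> \<le> \<kappa> * (2 * \<kappa> + ?\<theta>)"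
            using kappa_ge_1 \<theta> mult_right_mono[of 1 \<kappa> "2 * \<kappa> + ?\<theta>"] by simp
          then show ?thesis using kappa_ge_1 by linarith
        qed
      qed simp
      finally show ?thesis .
    next
      case 3
      obtain n where n: "d n < \<bar>t - s\<bar>" using dsmall 3 by blast
      \<comment> \<open>The first scale below the length determines the window; \<open>m\<close> is
        not zero because \<open>d 0 = 1\<close>.\<close>
      define m where "m = (LEAST n. d n < \<bar>t - s\<bar>)"
      have m: "d m < \<bar>t - s\<bar>" unfolding m_def using n by (rule LeastI)
      obtain k where k: "m = Suc k" using m 3 d0 by (cases m) auto
      have "\<bar>t - s\<bar> \<le> d k"
        using not_less_Least[of k "\<lambda>n. d n < \<bar>t - s\<bar>"] k unfolding m_def by simp
      then have "q ((F t - F s) - (G k t - G k s)) \<le> ?\<theta> * \<bar>t - s\<bar>" using main m k by blast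
      then have "\<kappa> * (q (G k t - G k s) + q ((F t - F s) - (G k t - G k s)))
          \<le> \<kappa> * (2 * \<kappa> * \<bar>t - s\<bar> + ?\<theta> * \<bar>t - s\<bar>)"
        using Glip[of k t s] kappa_ge_1 by (intro mult_left_mono add_mono) auto
      moreover have "q (F t - F s) \<le> \<kappa> * (q (G k t - G k s) + q ((F t - F s) - (G k t - G k s)))"
        using q_add[of "G k t - G k s" "(F t - F s) - (G k t - G k s)"] by simp
      ultimately show ?thesis by (simp add: algebra_simps)
    qed simp
  qed

  have "\<not> has_derivative_within F UNIV s v" for s v
  proof (rule not_differentiable_withinI)
    show "1 / (2 * \<kappa>) > 0" using kappa_ge_1 by simp
    fix z :: real assume "z > 0"
    then obtain k where k: "d k < z" using dsmall by blast
    obtain a b where ab: "a \<le> s" "s \<le> b" "b - a = D k" "D k \<le> q (G k b - G k a)"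
      using osc[of k] unfolding oscillation_def by blast
    obtain a' b' where ab': "a' \<le> s" "s \<le> b'" "b' - a' = 2 * D k" "G k b' = G k a'"
      using osc[of k] unfolding oscillation_def by blast
    have Dk: "D k > 0" using Dd[of k] dpos[of "Suc k"] by linarith
    let ?E = "(F b - F a) - (G k b - G k a)" and ?E' = "F b' - F a'"
    have E: "q ?E \<le> ?\<theta> * D k" using main[of k b a] ab Dd[of k] Dk by simp
    have E': "q ?E' \<le> ?\<theta> * (2 * D k)" using main[of k b' a'] ab' Dd[of k] Dk by simp
    let ?X = "slope F a b - slope F a' b'"
    let ?Y = "sc (1 / (2 * D k)) ?E' - sc (1 / D k) ?E"
    have "slope F a b = sc (1 / D k) (G k b - G k a) + sc (1 / D k) ?E"
      unfolding slope_def ab(3) scale_right_distrib[symmetric] by simp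
    \<comment> \<open>The chord of \<open>G k\<close> over the interval from \<open>a'\<close> to
      \<open>b'\<close> is zero, so the slope of \<open>F\<close> there is pure error and goes into
      \<open>?Y\<close>.\<close>
    then have XY: "sc (1 / D k) (G k b - G k a) = ?X + ?Y"
      unfolding slope_def ab' by simp
    have "q ?Y \<le> \<kappa> * (q (sc (1 / (2 * D k)) ?E') + q (sc (1 / D k) ?E))" by (rule q_diff)
    also have "\<dots> \<le> \<kappa> * (?\<theta> + ?\<theta>)"
      using E E' Dk kappa_ge_1
      by (intro mult_left_mono add_mono) (auto simp: q_scale pos_divide_le_eq)
    finally have Y: "\<kappa> * q ?Y \<le> \<kappa> * (\<kappa> * (?\<theta> + ?\<theta>))" using kappa_ge_1 by simp
    have "1 \<le> q (sc (1 / D k) (G k b - G k a))" using ab(4) Dk by (simp add: q_scale pos_le_divide_eq)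
    also have "\<dots> \<le> \<kappa> * (q ?X + q ?Y)" unfolding XY by (rule q_add)
    finally have "1 \<le> \<kappa> * q ?X + 1 / 2" using Y \<tau>(2) by (simp add: algebra_simps)
    then have "1 / (2 * \<kappa>) \<le> q ?X" using kappa_ge_1 by (simp add: field_simps)
    then show "\<exists>a b a' b'. {a, b, a', b'} \<subseteq> UNIV \<and> a \<le> s \<and> s \<le> b \<and> a < b \<and> b - a < z \<and>
        a' \<le> s \<and> s \<le> b' \<and> a' < b' \<and> b' - a' < z \<and> 1 / (2 * \<kappa>) \<le> q (slope F a b - slope F a' b')"
      using ab ab' Dk Dd[of k] k by (intro exI[of _ a] exI[of _ b] exI[of _ a'] exI[of _ b']) auto
  qed
  moreover have "lipschitz_curve q F" using lip unfolding lipschitz_curve_def by blast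
  ultimately show False using diff curve_differentiable_at_iff by blast
qed

end

section \<open>The largest norm below a quasi-norm\<close>

text \<open>The gauge of the convex hull of the unit ball of \<open>q\<close>: by homogeneity, the
  coefficients of convex combinations are absorbed into the terms of the list.\<close>

definition hull_norm :: "('a::ab_group_add \<Rightarrow> real) \<Rightarrow> 'a \<Rightarrow> real" where
  "hull_norm q x = Inf {sum_list (map q ys) |ys. sum_list ys = x}"

context quasi_banach_space
begin

abbreviation rscale :: "real \<Rightarrow> 'b \<Rightarrow> 'b" where
  "rscale r \<equiv> smul (of_real r)"

lemma real_quasi_normed: "\<exists>\<kappa>. real_quasi_normed rscale q \<kappa>"
proof -
  obtain \<kappa> where "\<kappa> \<ge> 1" "\<And>x y. q (x + y) \<le> \<kappa> * (q x + q y)"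
    using quasi_triangle by blast
  then have "real_quasi_normed rscale q \<kappa>"
    by unfold_locales
      (auto simp: scale_right_distrib scale_left_distrib nonneg pos homogeneous)
  then show ?thesis ..
qed

lemma q_sum_list_nonneg: "0 \<le> sum_list (map q ys)"
  by (rule sum_list_nonneg) (auto simp: nonneg)

lemma hull_norm_le: "hull_norm q (sum_list ys) \<le> sum_list (map q ys)"
  unfolding hull_norm_def
  by (rule cInf_lower) (auto simp: q_sum_list_nonneg intro!: bdd_belowI[of _ 0])

lemma hull_norm_le_q: "hull_norm q x \<le> q x"
  using hull_norm_le[of "[x]"] by simp

lemma hull_norm_greatest:
  assumes "\<And>ys. sum_list ys = x \<Longrightarrow> B \<le> sum_list (map q ys)"
  shows "B \<le> hull_norm q x"
  unfolding hull_norm_def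
proof (rule cInf_greatest)
  have "sum_list [x] = x" by simp
  then show "{sum_list (map q ys) |ys. sum_list ys = x} \<noteq> {}" by blast
qed (use assms in blast)

lemma hull_norm_nonneg: "0 \<le> hull_norm q x"
  by (rule hull_norm_greatest) (rule q_sum_list_nonneg)

lemma hull_norm_triangle: "hull_norm q (x + y) \<le> hull_norm q x + hull_norm q y"
proof -
  have "hull_norm q (x + y) - hull_norm q y \<le> hull_norm q x"
  proof (rule hull_norm_greatest)
    fix ys assume ys: "sum_list ys = x"
    have "hull_norm q (x + y) - sum_list (map q ys) \<le> hull_norm q y"
    proof (rule hull_norm_greatest)
      fix zs assume "sum_list zs = y"
      then show "hull_norm q (x + y) - sum_list (map q ys) \<le> sum_list (map q zs)"
        using hull_norm_le[of "ys @ zs"] ys by simp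
    qed
    then show "hull_norm q (x + y) - hull_norm q y \<le> sum_list (map q ys)" by simp
  qed
  then show ?thesis by simp
qed

lemma hull_norm_smul_le: "hull_norm q (smul c x) \<le> norm c * hull_norm q x"
proof (cases "c = 0")
  case True
  then show ?thesis using hull_norm_le[of "[]"] by simp
next
  case False
  have "hull_norm q (smul c x) / norm c \<le> hull_norm q x"
  proof (rule hull_norm_greatest)
    fix ys assume "sum_list ys = x"
    moreover have "sum_list (map (smul c) ys) = smul c (sum_list ys)"
      by (induction ys) (auto simp: scale_right_distrib)
    moreover have "sum_list (map q (map (smul c) ys)) = norm c * sum_list (map q ys)"
      by (induction ys) (auto simp: homogeneous algebra_simps)
    ultimately show "hull_norm q (smul c x) / norm c \<le> sum_list (map q ys)"
      using hull_norm_le[of "map (smul c) ys"] False by (simp add: pos_divide_le_eq mult.commute)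
  qed
  then show ?thesis using False by (simp add: pos_divide_le_eq mult.commute)
qed

lemma hull_norm_smul: "hull_norm q (smul c x) = norm c * hull_norm q x"
proof (rule antisym)
  show "norm c * hull_norm q x \<le> hull_norm q (smul c x)"
  proof (cases "c = 0")
    case False
    have "hull_norm q x \<le> norm (inverse c) * hull_norm q (smul c x)"
      using hull_norm_smul_le[of "inverse c" "smul c x"] False by simp
    then have "norm c * hull_norm q x \<le> norm c * (norm (inverse c) * hull_norm q (smul c x))"
      by (rule mult_left_mono) simp
    also have "\<dots> = norm (c * inverse c) * hull_norm q (smul c x)"
      by (simp only: norm_mult mult.assoc)
    finally show ?thesis using False by simp
  qed (simp add: hull_norm_nonneg)
qed (rule hull_norm_smul_le)

lemma complete_wrt_equivalent:
  assumes "equivalent_quasi_norms p q"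
  shows "complete_wrt p"
proof -
  obtain c C where cC: "c > 0" "C > 0" "\<And>x. c * q x \<le> p x" "\<And>x. p x \<le> C * q x"
    using assms unfolding equivalent_quasi_norms_def by blast
  show ?thesis
    unfolding complete_wrt_def
  proof (intro allI impI)
    fix u :: "nat \<Rightarrow> 'b"
    assume u: "\<forall>e>0. \<exists>n0. \<forall>m\<ge>n0. \<forall>n\<ge>n0. p (u m - u n) < e"
    have "\<exists>n0. \<forall>m\<ge>n0. \<forall>n\<ge>n0. q (u m - u n) < e" if "e > 0" for e
    proof -
      obtain n0 where n0: "\<forall>m\<ge>n0. \<forall>n\<ge>n0. p (u m - u n) < c * e"
        using u \<open>e > 0\<close> cC(1) by (meson mult_pos_pos)
      have "q (u m - u n) < e" if "m \<ge> n0" "n \<ge> n0" for m n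
      proof -
        have "c * q (u m - u n) < c * e" using n0 that cC(3) by (meson le_less_trans)
        then show ?thesis using cC(1) by simp
      qed
      then show ?thesis by blast
    qed
    then obtain l where l: "(\<lambda>n. q (u n - l)) \<longlonglongrightarrow> 0"
      using complete unfolding complete_wrt_def by blast
    have "(\<lambda>n. p (u n - l)) \<longlonglongrightarrow> 0"
    proof (rule tendsto_sandwich[OF _ _ tendsto_const])
      show "(\<lambda>n. C * q (u n - l)) \<longlonglongrightarrow> 0" by (auto intro!: tendsto_eq_intros l)
      have "0 \<le> p x" for x
        using cC(1) cC(3)[of x] nonneg[of x] by (meson less_imp_le mult_nonneg_nonneg order_trans)
      then show "\<forall>\<^sub>F n in sequentially. 0 \<le> p (u n - l)" by simp
    qed (use cC(4) in simp)
    then show "\<exists>l. (\<lambda>n. p (u n - l)) \<longlonglongrightarrow> 0" by blast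
  qed
qed

lemma banach_norm_if_sum_bounded:
  assumes "\<And>ys. q (sum_list ys) \<le> R * sum_list (map q ys)"
  shows "banach_norm smul (hull_norm q)" "equivalent_quasi_norms (hull_norm q) q"
proof -
  \<comment> \<open>The maximum keeps the factor positive, so that its inverse can serve as the
    lower constant of the equivalence.\<close>
  define r where "r = max 1 R"
  have r: "r > 0" by (simp add: r_def)
  have ge: "1 / r * q x \<le> hull_norm q x" for x
  proof (rule hull_norm_greatest)
    fix ys assume "sum_list ys = x"
    then have "q x \<le> R * sum_list (map q ys)" using assms by blast
    also have "\<dots> \<le> r * sum_list (map q ys)"
      by (rule mult_right_mono) (auto simp: r_def q_sum_list_nonneg)
    finally show "1 / r * q x \<le> sum_list (map q ys)" using r by (simp add: pos_divide_le_eq mult.commute)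
  qed
  have "\<exists>c>0. \<exists>C>0. \<forall>x. c * q x \<le> hull_norm q x \<and> hull_norm q x \<le> C * q x"
    using ge hull_norm_le_q r by (intro exI[of _ "1 / r"] conjI exI[of _ 1]) auto
  then show eq: "equivalent_quasi_norms (hull_norm q) q"
    unfolding equivalent_quasi_norms_def .
  show "banach_norm smul (hull_norm q)"
  proof unfold_locales
    fix x :: 'b assume "x \<noteq> 0"
    then have "0 < 1 / r * q x" using r pos by simp
    then show "0 < hull_norm q x" using ge[of x] by linarith
  next
    have "hull_norm q (x + y) \<le> 1 * (hull_norm q x + hull_norm q y)" for x y
      using hull_norm_triangle by simp
    then show "\<exists>\<kappa>\<ge>1. \<forall>x y. hull_norm q (x + y) \<le> \<kappa> * (hull_norm q x + hull_norm q y)" by blast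
  qed (simp_all add: hull_norm_nonneg hull_norm_smul hull_norm_triangle complete_wrt_equivalent[OF eq])
qed

text \<open>Balls of a quasi-norm need be neither open nor convex. Balls of an equivalent norm are
  both, and small ones lie in any given neighbourhood of zero.\<close>

lemma locally_convex_if_equivalent:
  assumes "banach_norm smul p" and "equivalent_quasi_norms p q"
  shows "locally_convex smul q"
proof -
  interpret p: banach_norm smul p by fact
  obtain c C where cC: "c > 0" "C > 0" "\<And>x. c * q x \<le> p x" "\<And>x. p x \<le> C * q x"
    using assms unfolding equivalent_quasi_norms_def by blast
  have p0: "p 0 = 0" using p.homogeneous[of 0 0] by simp
  show ?thesis
    unfolding locally_convex_def
  proof (intro allI impI)
    fix W assume "zero_neighbourhood q W"
    then obtain V where V: "openin (quasi_norm_topology q) V" "0 \<in> V" "V \<subseteq> W"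
      unfolding zero_neighbourhood_def by blast
    then obtain r where r: "r > 0" "\<And>y. q y < r \<Longrightarrow> y \<in> V"
      unfolding openin_quasi_norm_topology by (metis diff_zero)
    define U where "U = {x. p x < c * r}"
    have "openin (quasi_norm_topology q) U"
      unfolding openin_quasi_norm_topology
    proof
      fix x assume x: "x \<in> U"
      have "y \<in> U" if "q (y - x) < (c * r - p x) / C" for y
      proof -
        have "p (y - x) < c * r - p x"
          using that cC(2) cC(4)[of "y - x"] by (simp add: pos_less_divide_eq mult.commute)
        moreover have "p y \<le> p (y - x) + p x" using p.triangle[of "y - x" x] by simp
        ultimately show ?thesis by (simp add: U_def)
      qed
      moreover have "(c * r - p x) / C > 0" using x cC(2) by (simp add: U_def)
      ultimately show "\<exists>\<rho>>0. \<forall>y. q (y - x) < \<rho> \<longrightarrow> y \<in> U" by blast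
    qed
    moreover have "0 \<in> U" using cC(1) r(1) by (simp add: U_def p0)
    ultimately have "zero_neighbourhood q U" unfolding zero_neighbourhood_def by blast
    moreover have "U \<subseteq> W"
    proof
      fix x assume "x \<in> U"
      then have "c * q x < c * r" using cC(3)[of x] by (simp add: U_def)
      then have "q x < r" using cC(1) by simp
      then show "x \<in> W" using r(2) V(3) by blast
    qed
    moreover have "absolutely_convex smul U"
      unfolding absolutely_convex_def
    proof (intro ballI allI impI)
      fix x y and a b :: 'a assume xy: "x \<in> U" "y \<in> U" and ab: "norm a + norm b \<le> 1"
      define m where "m = max (p x) (p y)"
      have m: "0 \<le> m" "p x \<le> m" "p y \<le> m" "m < c * r"
        using xy p.nonneg[of x] by (auto simp: m_def U_def)
      have "p (smul a x + smul b y) \<le> norm a * p x + norm b * p y"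
        using p.triangle[of "smul a x" "smul b y"] by (simp add: p.homogeneous)
      also have "\<dots> \<le> norm a * m + norm b * m"
        using m by (intro add_mono mult_left_mono) auto
      also have "\<dots> \<le> m" using mult_right_mono[OF ab m(1)] by (simp add: algebra_simps)
      finally show "smul a x + smul b y \<in> U" using m(4) by (simp add: U_def)
    qed
    ultimately show "\<exists>U\<subseteq>W. zero_neighbourhood q U \<and> absolutely_convex smul U" by blast
  qed
qed

end

section \<open>Vector measures\<close>

lemma (in finite_measure) exhaustion:
  assumes "\<G> \<subseteq> sets M" "E \<in> sets M"
  obtains A :: "nat \<Rightarrow> 'a set" where "disjoint_family A"
    "\<And>n. A n \<in> insert {} \<G>" "\<And>n. A n \<in> sets M" "\<And>n. A n \<subseteq> E"
    "\<And>G. G \<in> \<G> \<Longrightarrow> G \<subseteq> E - (\<Union>n. A n) \<Longrightarrow> measure M G = 0"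
proof -
  let ?\<G> = "\<lambda>U. {G \<in> insert {} \<G>. G \<subseteq> E - U}"
  have ex: "\<exists>G\<in>?\<G> U. \<forall>H\<in>?\<G> U. measure M H \<le> 2 * measure M G" for U
  proof -
    let ?s = "SUP G\<in>?\<G> U. measure M G"
    have bdd: "bdd_above (measure M ` ?\<G> U)"
      by (rule bdd_aboveI[of _ "measure M (space M)"]) (auto simp: bounded_measure)
    have le: "measure M H \<le> ?s" if "H \<in> ?\<G> U" for H
      using that bdd by (rule cSUP_upper)
    show ?thesis
    proof (cases "?s > 0")
      case True
      have "?\<G> U \<noteq> {}" by blast
      then have "\<exists>G\<in>?\<G> U. ?s / 2 < measure M G"
        using less_cSUP_iff[OF _ bdd, of "?s / 2"] True by simp
      then obtain G where "G \<in> ?\<G> U" "?s / 2 < measure M G" ..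
      then show ?thesis using le by (intro bexI[of _ G]) force+
    next
      case False
      then show ?thesis using le by (intro bexI[of _ "{}"]) force+
    qed
  qed
  define pick where "pick U = (SOME G. G \<in> ?\<G> U \<and> (\<forall>H\<in>?\<G> U. measure M H \<le> 2 * measure M G))" for U
  have "pick U \<in> ?\<G> U \<and> (\<forall>H\<in>?\<G> U. measure M H \<le> 2 * measure M (pick U))" for U
    unfolding pick_def by (rule someI_ex) (use ex[of U] in blast)
  then have pick: "\<And>U. pick U \<in> ?\<G> U"
    "\<And>U H. H \<in> ?\<G> U \<Longrightarrow> measure M H \<le> 2 * measure M (pick U)"
    by simp_all
  define U where "U = rec_nat {} (\<lambda>_ U. U \<union> pick U)"
  define A where "A n = pick (U n)" for n
  have U_Suc: "U (Suc n) = U n \<union> A n" for n by (simp add: U_def A_def)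
  have U_0: "U 0 = {}" by (simp add: U_def)
  have U_eq: "U n = (\<Union>i<n. A i)" for n
    by (induction n) (simp_all add: U_0 U_Suc lessThan_Suc Un_commute)
  have A: "A n \<in> insert {} \<G>" "A n \<subseteq> E - U n" for n using pick(1)[of "U n"] by (auto simp: A_def)
  have disj: "disjoint_family A"
  proof -
    have "A i \<inter> A j = {}" if "i < j" for i j
      using A(2)[of j] that by (auto simp: U_eq)
    then show ?thesis unfolding disjoint_family_on_def by (metis Int_commute nat_neq_iff)
  qed
  have sets: "A n \<in> sets M" for n using A(1)[of n] assms(1) by auto
  have "(\<lambda>n. measure M (A n)) sums measure M (\<Union>n. A n)"
    using sets disj by (intro finite_measure_UNION) auto
  then have lim: "(\<lambda>n. measure M (A n)) \<longlonglongrightarrow> 0"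
    by (simp add: sums_summable summable_LIMSEQ_zero)
  have "measure M G = 0" if "G \<in> \<G>" "G \<subseteq> E - (\<Union>n. A n)" for G
  proof -
    have "measure M G \<le> 2 * measure M (A n)" for n
    proof -
      have "G \<in> ?\<G> (U n)" using that by (auto simp: U_eq)
      then show ?thesis unfolding A_def by (rule pick(2))
    qed
    then have "measure M G \<le> 2 * 0"
      using lim by (intro tendsto_lowerbound[OF tendsto_mult_left[OF lim]]) auto
    then show ?thesis using measure_nonneg[of M G] by linarith
  qed
  then show thesis using that[of A] A disj sets by blast
qed

section \<open>Vector measures with values in a normed space\<close>

locale real_normed = real_quasi_normed sc q 1 for sc :: "real \<Rightarrow> 'a::ab_group_add \<Rightarrow> 'a" and q
begin

lemma norm_add: "q (x + y) \<le> q x + q y"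
  using q_add[of x y] by simp

lemma norm_diff: "q (x - y) \<le> q x + q y"
  using q_diff[of x y] by simp

lemma norm_sum: "q (sum f A) \<le> (\<Sum>i\<in>A. q (f i))"
proof (induction A rule: infinite_finite_induct)
  case (insert i A)
  then show ?case using norm_add[of "f i" "sum f A"] by simp
qed simp_all

end

locale normed_finite_measure = real_normed sc q + finite_measure M
  for sc :: "real \<Rightarrow> 'a::ab_group_add \<Rightarrow> 'a" and q :: "'a \<Rightarrow> real" and M :: "'w measure"

locale vector_measure_space = normed_finite_measure sc q M
  for sc :: "real \<Rightarrow> 'a::ab_group_add \<Rightarrow> 'a" and q :: "'a \<Rightarrow> real" and M :: "'w measure" +
  fixes \<nu> :: "'w set \<Rightarrow> 'a"
  assumes countably_additive: "vector_measure q M \<nu>"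
    and absolutely_continuous: "measure_continuous q M \<nu>"
begin

text \<open>The partial sums for the constant sequence \<open>{}\<close> are multiples of
  \<open>\<nu> {}\<close>; as they converge, their successive differences tend to zero.\<close>

lemma nu_empty [simp]: "\<nu> {} = 0"
proof -
  define S where "S n = (\<Sum>i<n. \<nu> {})" for n :: nat
  have lim: "(\<lambda>n. q (S n - \<nu> {})) \<longlonglongrightarrow> 0"
    using countably_additive[unfolded vector_measure_def, rule_format, of "\<lambda>_. {}"]
    by (simp add: S_def disjoint_family_on_def)
  have "q (\<nu> {}) \<le> 0 + 0"
  proof (rule tendsto_lowerbound)
    show "(\<lambda>n. q (S (Suc n) - \<nu> {}) + q (S n - \<nu> {})) \<longlonglongrightarrow> 0 + 0"
      by (intro tendsto_add lim LIMSEQ_Suc[OF lim])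
    have "q (\<nu> {}) \<le> q (S (Suc n) - \<nu> {}) + q (S n - \<nu> {})" for n
      using norm_diff[of "S (Suc n) - \<nu> {}" "S n - \<nu> {}"] by (simp add: S_def)
    then show "\<forall>\<^sub>F n in sequentially. q (\<nu> {}) \<le> q (S (Suc n) - \<nu> {}) + q (S n - \<nu> {})" by simp
  qed simp
  then show ?thesis using q_nonneg[of "\<nu> {}"] by (simp add: order_antisym)
qed

lemma nu_Un:
  assumes "A \<in> sets M" "B \<in> sets M" "A \<inter> B = {}"
  shows "\<nu> (A \<union> B) = \<nu> A + \<nu> B"
proof -
  let ?D = "\<lambda>i::nat. if i = 0 then A else if i = 1 then B else {}"
  have "(\<lambda>n. q ((\<Sum>i<n. \<nu> (?D i)) - \<nu> (\<Union>i. ?D i))) \<longlonglongrightarrow> 0"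
  proof (rule countably_additive[unfolded vector_measure_def, rule_format])
    show "range ?D \<subseteq> sets M" using assms by auto
    show "disjoint_family ?D" using assms(3) by (auto simp: disjoint_family_on_def)
  qed
  moreover have "(\<Union>i. ?D i) = A \<union> B" by (auto split: if_splits intro: exI[of _ "0::nat"] exI[of _ "1::nat"])
  moreover have "(\<Sum>i<n + 2. \<nu> (?D i)) = \<nu> A + \<nu> B" for n
    by (induction n) (simp_all add: numeral_2_eq_2)
  ultimately have "(\<lambda>n::nat. q (\<nu> A + \<nu> B - \<nu> (A \<union> B))) \<longlonglongrightarrow> 0"
    using LIMSEQ_ignore_initial_segment[of "\<lambda>n. q ((\<Sum>i<n. \<nu> (?D i)) - \<nu> (\<Union>i. ?D i))" 0 2] by simp
  then show ?thesis by (simp add: LIMSEQ_const_iff)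
qed

lemma nu_Diff:
  assumes "A \<in> sets M" "B \<in> sets M" "B \<subseteq> A"
  shows "\<nu> (A - B) = \<nu> A - \<nu> B"
proof -
  have "\<nu> (B \<union> (A - B)) = \<nu> B + \<nu> (A - B)" using assms by (intro nu_Un) auto
  moreover have "B \<union> (A - B) = A" using assms(3) by blast
  ultimately show ?thesis by (simp add: algebra_simps)
qed

lemma nu_finite_Union:
  assumes "finite I" "\<And>i. i \<in> I \<Longrightarrow> A i \<in> sets M" "disjoint_family_on A I"
  shows "\<nu> (\<Union>i\<in>I. A i) = (\<Sum>i\<in>I. \<nu> (A i))"
  using assms
proof (induction I rule: finite_induct)
  case (insert i I)
  have "\<nu> (A i \<union> (\<Union>i\<in>I. A i)) = \<nu> (A i) + \<nu> (\<Union>i\<in>I. A i)"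
    using insert by (intro nu_Un sets.finite_UN) (auto simp: disjoint_family_on_def)
  moreover have "disjoint_family_on A I" using insert.prems by (auto simp: disjoint_family_on_def)
  ultimately show ?case using insert by simp
qed simp

lemma nu_null:
  assumes "A \<in> sets M" "measure M A = 0"
  shows "\<nu> A = 0"
proof -
  have "q (\<nu> A) < e" if "e > 0" for e
    using absolutely_continuous assms that unfolding measure_continuous_def by (metis)
  then show ?thesis by (metis less_irrefl q_pos)
qed

lemma bounded_variation_sum:
  assumes "bounded_variation q M \<nu>"
  obtains C where "C \<ge> 0"
    "\<And>(A :: nat \<Rightarrow> 'w set) n. disjoint_family A \<Longrightarrow> range A \<subseteq> sets M \<Longrightarrow> (\<Sum>i<n. q (\<nu> (A i))) \<le> C"
proof -
  obtain C where C: "\<And>P. finite P \<Longrightarrow> P \<subseteq> sets M \<Longrightarrow> disjoint P \<Longrightarrow> \<Union>P = space M \<Longrightarrow> (\<Sum>E\<in>P. q (\<nu> E)) \<le> C"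
    using assms unfolding bounded_variation_def by blast
  have *: "(\<Sum>i<n. q (\<nu> (A i))) \<le> C" if "disjoint_family A" "range A \<subseteq> sets M" for A :: "nat \<Rightarrow> _" and n
  proof -
    have A: "A i \<in> sets M" "A i \<inter> A j = {}" if "i \<noteq> j" for i j
      using \<open>disjoint_family A\<close> \<open>range A \<subseteq> sets M\<close> that by (auto simp: disjoint_family_on_def)
    let ?R = "space M - (\<Union>i<n. A i)"
    let ?P = "insert ?R (A ` {..<n})"
    \<comment> \<open>A partition is a set of sets, so equal members collapse; disjoint sets that
      are equal are empty and contribute zero.\<close>
    have "(\<Sum>i<n. q (\<nu> (A i))) = (\<Sum>E\<in>A ` {..<n}. q (\<nu> E))"
    proof (subst sum.reindex_nontrivial)
      fix i j assume "i \<noteq> j" "A i = A j"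
      then have "A i = {}" using A(2)[of i j] by simp
      then show "q (\<nu> (A i)) = 0" by simp
    qed simp_all
    also have "\<dots> \<le> (\<Sum>E\<in>?P. q (\<nu> E))"
      by (rule sum_mono2) (auto simp: q_nonneg)
    also have "\<dots> \<le> C"
    proof (rule C)
      show "?P \<subseteq> sets M" using that(2) by auto
      then show "\<Union>?P = space M" using sets.sets_into_space by auto
      have "A i = A j \<or> A i \<inter> A j = {}" for i j using A(2)[of i j] by blast
      then show "disjoint ?P" unfolding disjoint_def by blast
    qed simp
    finally show ?thesis .
  qed
  have "0 \<le> C" using *[of "\<lambda>_. {}" 0] by (simp add: disjoint_family_on_def)
  then show thesis by (rule that[OF _ *])
qed

text \<open>Disjoint sets on which \<open>\<nu>\<close> exceeds \<open>K * measure M\<close> cannot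
  fill \<open>E\<close>, since their total variation is at most \<open>C\<close>. After exhaustion
  any such set in the remainder is null, and null sets do not violate the bound.\<close>

lemma bounded_piece:
  assumes "bounded_variation q M \<nu>" "E \<in> sets M" "measure M E > 0"
  obtains F K where "F \<in> sets M" "F \<subseteq> E" "measure M F > 0"
    "\<And>G. G \<in> sets M \<Longrightarrow> G \<subseteq> F \<Longrightarrow> q (\<nu> G) \<le> K * measure M G"
proof -
  obtain C where C: "C \<ge> 0"
    "\<And>(A :: nat \<Rightarrow> 'w set) n. disjoint_family A \<Longrightarrow> range A \<subseteq> sets M \<Longrightarrow> (\<Sum>i<n. q (\<nu> (A i))) \<le> C"
    by (rule bounded_variation_sum[OF assms(1)]) (rule that)
  \<comment> \<open>If the sets \<open>A n\<close> filled \<open>E\<close>, the variation would have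
    to reach \<open>K * measure M E = C + 1\<close>.\<close>
  define K where "K = (C + 1) / measure M E"
  let ?\<G> = "{G \<in> sets M. K * measure M G < q (\<nu> G)}"
  obtain A :: "nat \<Rightarrow> _" where A: "disjoint_family A" "\<And>n. A n \<in> insert {} ?\<G>" "\<And>n. A n \<in> sets M"
    "\<And>n. A n \<subseteq> E" "\<And>G. G \<in> ?\<G> \<Longrightarrow> G \<subseteq> E - (\<Union>n. A n) \<Longrightarrow> measure M G = 0"
    by (rule exhaustion[OF _ assms(2), of ?\<G>]) (blast, rule that)
  have sums: "(\<lambda>n. measure M (A n)) sums measure M (\<Union>n. A n)"
    by (rule finite_measure_UNION[OF _ A(1)]) (use A(3) in blast)
  have Kle: "K * measure M (\<Union>n. A n) \<le> C"
  proof (rule LIMSEQ_le_const2)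
    show "(\<lambda>n. K * (\<Sum>i<n. measure M (A i))) \<longlonglongrightarrow> K * measure M (\<Union>n. A n)"
      using sums unfolding sums_def by (rule tendsto_mult_left)
    have "K * (\<Sum>i<n. measure M (A i)) \<le> C" for n
    proof -
      have "K * (\<Sum>i<n. measure M (A i)) \<le> (\<Sum>i<n. q (\<nu> (A i)))"
        unfolding sum_distrib_left
      proof (rule sum_mono)
        fix i
        show "K * measure M (A i) \<le> q (\<nu> (A i))" using A(2)[of i] by auto
      qed
      also have "\<dots> \<le> C" by (rule C(2)[OF A(1)]) (use A(3) in blast)
      finally show ?thesis .
    qed
    then show "\<exists>N. \<forall>n\<ge>N. K * (\<Sum>i<n. measure M (A i)) \<le> C" by blast
  qed
  let ?F = "E - (\<Union>n. A n)"
  have UA: "(\<Union>n. A n) \<in> sets M" using A(3) by (rule sets.countable_nat_UN[OF image_subsetI])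
  have "measure M (\<Union>n. A n) \<noteq> measure M E"
    using Kle assms(3) by (auto simp: K_def)
  moreover have "measure M ?F = measure M E - measure M (\<Union>n. A n)"
    by (rule finite_measure_Diff[OF assms(2) UA]) (use A(4) in blast)
  ultimately have "measure M ?F > 0" using measure_nonneg[of M ?F] by linarith
  moreover have "q (\<nu> G) \<le> K * measure M G" if "G \<in> sets M" "G \<subseteq> ?F" for G
  proof (rule ccontr)
    assume "\<not> q (\<nu> G) \<le> K * measure M G"
    then have G: "K * measure M G < q (\<nu> G)" by simp
    then have "measure M G = 0" using A(5)[of G] that by simp
    then show False using G nu_null[OF that(1)] by simp
  qed
  ultimately show thesis using that[of ?F K] UA assms(2) by blast
qed

text \<open>All subsets of \<open>F\<close> are tested, not only \<open>F\<close> itself. For a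
  \<open>\<nu>\<close> with a density this expresses that the density lies within
  \<open>\<epsilon>\<close> of \<open>x\<close> almost everywhere on \<open>F\<close>.\<close>

definition good :: "real \<Rightarrow> 'w set \<Rightarrow> 'a \<Rightarrow> bool" where
  "good \<epsilon> F x \<longleftrightarrow> (\<forall>G\<in>sets M. G \<subseteq> F \<longrightarrow> q (\<nu> G - sc (measure M G) x) \<le> \<epsilon> * measure M G)"

text \<open>Lists rather than sets of pieces, because the order of the pieces determines the
  parameter of the curve.\<close>

abbreviation disjoint_list :: "'w set list \<Rightarrow> bool" where
  "disjoint_list \<equiv> sorted_wrt (\<lambda>A B. A \<inter> B = {})"

lemma disjoint_list_additive:
  assumes "disjoint_list xs" "set xs \<subseteq> sets M"
  shows "\<nu> (\<Union>(set xs)) = sum_list (map \<nu> xs) \<and>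
    measure M (\<Union>(set xs)) = sum_list (map (measure M) xs)"
  using assms
proof (induction xs)
  case (Cons x xs)
  have D: "x \<inter> \<Union>(set xs) = {}" "x \<in> sets M" "\<Union>(set xs) \<in> sets M"
    using Cons.prems by auto
  show ?case
    using nu_Un[OF D(2,3,1)] finite_measure_Union[OF D(2,3,1)] Cons by simp
qed simp

end

lemma list_locate_strict:
  fixes w :: "'b \<Rightarrow> real"
  assumes "0 < t" "t \<le> sum_list (map w xs)"
  obtains us x vs where "xs = us @ x # vs" "sum_list (map w us) < t"
    "t \<le> sum_list (map w us) + w x"
proof -
  have "\<exists>us x vs. xs = us @ x # vs \<and> sum_list (map w us) < t \<and> t \<le> sum_list (map w us) + w x"
    using assms
  proof (induction xs arbitrary: t)
    case (Cons y ys)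
    show ?case
    proof (cases "t \<le> w y")
      case True
      then show ?thesis using Cons.prems by (intro exI[of _ "[]"] exI[of _ y] exI[of _ ys]) simp
    next
      case False
      then obtain us x vs where "ys = us @ x # vs" "sum_list (map w us) < t - w y"
        "t - w y \<le> sum_list (map w us) + w x"
        using Cons.IH[of "t - w y"] Cons.prems by auto
      then show ?thesis by (intro exI[of _ "y # us"] exI[of _ x] exI[of _ vs]) simp
    qed
  qed simp
  then show thesis using that by blast
qed
text \<open>Weak inequalities include \<open>t = 0\<close>, where no prefix has a sum strictly below
  \<open>t\<close>.\<close>

lemma list_locate:
  fixes w :: "'b \<Rightarrow> real"
  assumes "xs \<noteq> []" "\<And>x. 0 \<le> w x" "0 \<le> t" "t \<le> sum_list (map w xs)"
  obtains us x vs where "xs = us @ x # vs" "sum_list (map w us) \<le> t"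
    "t \<le> sum_list (map w us) + w x"
proof (cases "t = 0")
  case True
  then show thesis using that[of "[]" "hd xs" "tl xs"] assms(1,2) by simp
next
  case False
  then show thesis
    using list_locate_strict[of t w xs] assms(3,4) that by (metis less_le)
qed

section \<open>Oscillating averages give nowhere differentiable Lipschitz curves\<close>

context vector_measure_space
begin

text \<open>The exhausting sequence splits \<open>F\<close> into infinitely many pieces; the tail is absorbed into
  one of them, where it is too small to matter.\<close>

lemma split_piece:
  assumes F: "F \<in> sets M" "measure M F > 0"
    and K: "\<And>G. G \<in> sets M \<Longrightarrow> G \<subseteq> F \<Longrightarrow> q (\<nu> G) \<le> K * measure M G"
    and "\<epsilon> > 0"
    and nogood: "\<And>H. H \<in> sets M \<Longrightarrow> H \<subseteq> F \<Longrightarrow> measure M H > 0 \<Longrightarrow> \<not> good \<epsilon> H a"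
  shows "\<exists>L. disjoint_list L \<and> \<Union>(set L) = F \<and> (\<forall>H\<in>set L. H \<in> sets M \<and> measure M H > 0 \<and>
    \<epsilon> / 2 * measure M H \<le> q (\<nu> H - sc (measure M H) a))"
proof -
  let ?\<G> = "{G \<in> sets M. \<epsilon> * measure M G < q (\<nu> G - sc (measure M G) a)}"
  obtain A :: "nat \<Rightarrow> _" where A: "disjoint_family A" "\<And>n. A n \<in> insert {} ?\<G>" "\<And>n. A n \<in> sets M"
    "\<And>n. A n \<subseteq> F" "\<And>G. G \<in> ?\<G> \<Longrightarrow> G \<subseteq> F - (\<Union>n. A n) \<Longrightarrow> measure M G = 0"
    by (rule exhaustion[OF _ F(1), of ?\<G>]) (blast, rule that)
  have member: "measure M G > 0" if "G \<in> ?\<G>" for G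
  proof (rule ccontr)
    assume "\<not> measure M G > 0"
    then have "measure M G = 0" using measure_nonneg[of M G] by linarith
    then show False using that nu_null[of G] by simp
  qed
  have UA: "(\<Union>n. A n) \<in> sets M" using A(3) by (rule sets.countable_nat_UN[OF image_subsetI])
  \<comment> \<open>Otherwise the remainder, not being good for \<open>a\<close>, would contain a
    set in \<open>?\<G>\<close>. Such sets have positive measure, but the exhaustion leaves only
    null ones.\<close>
  have rest0: "measure M (F - (\<Union>n. A n)) = 0"
  proof (rule ccontr)
    assume "measure M (F - (\<Union>n. A n)) \<noteq> 0"
    then have "measure M (F - (\<Union>n. A n)) > 0" by (simp add: zero_less_measure_iff)
    then have "\<not> good \<epsilon> (F - (\<Union>n. A n)) a" using F(1) UA by (intro nogood) auto
    then obtain G where "G \<in> sets M" and G: "G \<subseteq> F - (\<Union>n. A n)"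
      "\<not> q (\<nu> G - sc (measure M G) a) \<le> \<epsilon> * measure M G"
      unfolding good_def by blast
    then have G: "G \<in> ?\<G>" "G \<subseteq> F - (\<Union>n. A n)" by simp_all
    show False using A(5)[OF G] member[OF G(1)] by simp
  qed
  have "(\<lambda>i. measure M (A i)) sums measure M (\<Union>n. A n)"
    by (rule finite_measure_UNION[OF _ A(1)]) (use A(3) in blast)
  moreover have "measure M (F - (\<Union>n. A n)) = measure M F - measure M (\<Union>n. A n)"
    by (rule finite_measure_Diff[OF F(1) UA]) (use A(4) in blast)
  ultimately have sums: "(\<lambda>i. measure M (A i)) sums measure M F" using rest0 by simp
  obtain i0 where i0: "A i0 \<noteq> {}"
  proof (rule ccontr)
    assume "\<not> thesis"
    then have "A i = {}" for i using that by blast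
    then have "(\<lambda>i. measure M (A i)) = (\<lambda>_. 0)" by simp
    then show False using sums F(2) sums_unique2[OF sums, of 0] by simp
  qed
  have Ai0: "A i0 \<in> ?\<G>" using A(2)[of i0] i0 by blast
  define R where "R n = F - (\<Union>i<n. A i)" for n
  have R: "R n \<in> sets M" "R n \<subseteq> F" for n using F(1) A(3) by (auto simp: R_def)
  have mR: "measure M (R n) = measure M F - (\<Sum>i<n. measure M (A i))" for n
  proof -
    have "measure M (\<Union>i<n. A i) = (\<Sum>i<n. measure M (A i))"
      by (rule finite_measure_finite_Union)
        (use A(3) disjoint_family_on_mono[OF subset_UNIV A(1)] in blast)+
    moreover have "measure M (R n) = measure M F - measure M (\<Union>i<n. A i)"
      unfolding R_def by (rule finite_measure_Diff[OF F(1)]) (use A(3,4) in blast)+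
    ultimately show ?thesis by simp
  qed
  have "(\<lambda>n. measure M (R n)) \<longlonglongrightarrow> measure M F - measure M F"
    unfolding mR using sums unfolding sums_def by (intro tendsto_diff tendsto_const)
  \<comment> \<open>The three terms pay for \<open>\<nu> (R n)\<close>, for the multiple of
    \<open>a\<close> on \<open>R n\<close>, and for the measure that \<open>R n\<close> adds to the
    piece absorbing it.\<close>
  then have "(\<lambda>n. (K + q a + \<epsilon> / 2) * measure M (R n)) \<longlonglongrightarrow> (K + q a + \<epsilon> / 2) * 0"
    by (intro tendsto_mult tendsto_const) simp
  moreover have "(K + q a + \<epsilon> / 2) * 0 < \<epsilon> / 2 * measure M (A i0)"
    using member[OF Ai0] \<open>\<epsilon> > 0\<close> by simp
  ultimately have "\<forall>\<^sub>F n in sequentially. (K + q a + \<epsilon> / 2) * measure M (R n) < \<epsilon> / 2 * measure M (A i0)"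
    by (rule order_tendstoD(2))
  then obtain n where n: "n > i0" "(K + q a + \<epsilon> / 2) * measure M (R n) < \<epsilon> / 2 * measure M (A i0)"
    unfolding eventually_sequentially by (metis le_add2 less_Suc_eq_le add_Suc_right le_add1)
  let ?H = "A i0 \<union> R n"
  \<comment> \<open>Empty pieces are filtered out, as every piece must have positive
    measure.\<close>
  define L where "L = ?H # filter (\<lambda>X. X \<noteq> {}) (map A (filter (\<lambda>i. i \<noteq> i0) [0..<n]))"
  have disj: "A i \<inter> A j = {}" if "i \<noteq> j" for i j
    using A(1) that by (auto simp: disjoint_family_on_def)
  have setL: "set L = insert ?H {A i |i. i < n \<and> i \<noteq> i0 \<and> A i \<noteq> {}}"
    unfolding L_def by auto
  have dR: "A i0 \<inter> R n = {}" using n(1) by (auto simp: R_def)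
  have "disjoint_list L"
  proof -
    have "disjoint_list (map A (filter (\<lambda>i. i \<noteq> i0) [0..<n]))"
      unfolding sorted_wrt_map
      by (rule sorted_wrt_mono_rel[OF _ sorted_wrt_filter[OF sorted_wrt_upt]]) (use disj in auto)
    moreover have "?H \<inter> A i = {}" if "i < n" "i \<noteq> i0" for i
      using disj[of i0 i] that by (auto simp: R_def)
    ultimately show ?thesis unfolding L_def by (auto intro!: sorted_wrt_filter)
  qed
  moreover have "\<Union>(set L) = F"
  proof
    show "\<Union>(set L) \<subseteq> F" using A(4) R(2)[of n] unfolding setL by blast
    show "F \<subseteq> \<Union>(set L)"
    proof
      fix x assume "x \<in> F"
      then consider "x \<in> R n" | i where "i < n" "x \<in> A i" unfolding R_def by blast
      then show "x \<in> \<Union>(set L)" unfolding setL by (cases) blast+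
    qed
  qed
  moreover have "H \<in> sets M \<and> measure M H > 0 \<and> \<epsilon> / 2 * measure M H \<le> q (\<nu> H - sc (measure M H) a)"
    if "H \<in> set L" for H
  proof (cases "H = ?H")
    case True
    have mH: "measure M H = measure M (A i0) + measure M (R n)"
      unfolding True using A(3) R(1) dR by (rule finite_measure_Union)
    have "\<nu> H = \<nu> (A i0) + \<nu> (R n)"
      unfolding True using A(3) R(1) dR by (rule nu_Un)
    then have eq: "\<nu> (A i0) - sc (measure M (A i0)) a
        = (\<nu> H - sc (measure M H) a) - (\<nu> (R n) - sc (measure M (R n)) a)"
      by (simp add: mH scale_left_distrib algebra_simps)
    have "\<epsilon> * measure M (A i0) < q (\<nu> (A i0) - sc (measure M (A i0)) a)" using Ai0 by simp
    also have "\<dots> \<le> q (\<nu> H - sc (measure M H) a) + q (\<nu> (R n) - sc (measure M (R n)) a)"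
      unfolding eq by (rule norm_diff)
    also have "q (\<nu> (R n) - sc (measure M (R n)) a) \<le> K * measure M (R n) + measure M (R n) * q a"
      using norm_diff[of "\<nu> (R n)" "sc (measure M (R n)) a"] K[OF R(1) R(2), of n] by (simp add: q_scale)
    finally have "\<epsilon> / 2 * measure M H \<le> q (\<nu> H - sc (measure M H) a)"
      using n(2) by (simp add: mH algebra_simps)
    moreover have "measure M H > 0"
      unfolding mH using member[OF Ai0] by (simp add: add_pos_nonneg)
    moreover have "H \<in> sets M" unfolding True using A(3) R(1) by (rule sets.Un)
    ultimately show ?thesis by blast
  next
    case False
    then obtain i where i: "H = A i" "A i \<noteq> {}" using \<open>H \<in> set L\<close> unfolding setL by blast
    then have "H \<in> ?\<G>" using A(2)[of i] by blast
    moreover from this have "measure M H > 0" by (rule member)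
    moreover have "\<epsilon> / 2 * measure M H \<le> \<epsilon> * measure M H" using \<open>\<epsilon> > 0\<close> by simp
    ultimately show ?thesis by auto
  qed
  ultimately show ?thesis by blast
qed

text \<open>If no piece were good, every piece could be split relative to its own average, and
  iteration would yield a tree whose averages jump by \<open>\<epsilon> / 2\<close> from parent to
  child. The jumps also force the measures of the pieces to shrink geometrically. This excludes
  atoms and lets the unions of prefixes determine a set of every measure \<open>t\<close>.\<close>

lemma good_piece:
  assumes diff: "\<And>F. lipschitz_curve q F \<Longrightarrow> \<exists>s. curve_differentiable_at sc q F s"
    and E: "E \<in> sets M" "measure M E > 0"
    and K: "\<And>G. G \<in> sets M \<Longrightarrow> G \<subseteq> E \<Longrightarrow> q (\<nu> G) \<le> K * measure M G"
    and "\<epsilon> > 0"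
  shows "\<exists>H x. H \<in> sets M \<and> H \<subseteq> E \<and> measure M H > 0 \<and> good \<epsilon> H x"
proof (rule ccontr)
  assume "\<nexists>H x. H \<in> sets M \<and> H \<subseteq> E \<and> measure M H > 0 \<and> good \<epsilon> H x"
  then have nogood: "\<And>H x. H \<in> sets M \<Longrightarrow> H \<subseteq> E \<Longrightarrow> measure M H > 0 \<Longrightarrow> \<not> good \<epsilon> H x" by blast
  let ?\<mu> = "measure M"
  define piece where "piece H \<longleftrightarrow> H \<in> sets M \<and> H \<subseteq> E \<and> ?\<mu> H > 0" for H
  define avg where "avg H = sc (1 / ?\<mu> H) (\<nu> H)" for H
  have K0: "K \<ge> 0"
    using K[OF E(1) order_refl] q_nonneg[of "\<nu> E"] E(2) zero_le_mult_iff[of K "?\<mu> E"] by linarith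
  define sp where "sp H = (SOME L. disjoint_list L \<and> \<Union>(set L) = H \<and> (\<forall>G\<in>set L. G \<in> sets M \<and> ?\<mu> G > 0 \<and>
    \<epsilon> / 2 * ?\<mu> G \<le> q (\<nu> G - sc (?\<mu> G) (avg H))))" for H
  have sp: "disjoint_list (sp H) \<and> \<Union>(set (sp H)) = H \<and> (\<forall>G\<in>set (sp H). G \<in> sets M \<and> ?\<mu> G > 0 \<and>
      \<epsilon> / 2 * ?\<mu> G \<le> q (\<nu> G - sc (?\<mu> G) (avg H)))" if "piece H" for H
    unfolding sp_def
  proof (rule someI_ex, rule split_piece)
    show "q (\<nu> G) \<le> K * ?\<mu> G" if "G \<in> sets M" "G \<subseteq> H" for G
      using K that \<open>piece H\<close> unfolding piece_def by blast
    show "\<not> good \<epsilon> G (avg H)" if "G \<in> sets M" "G \<subseteq> H" "?\<mu> G > 0" for G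
      using nogood that \<open>piece H\<close> unfolding piece_def by blast
  qed (use that \<open>\<epsilon> > 0\<close> in \<open>auto simp: piece_def\<close>)
  have sp_piece: "piece G" if "piece H" "G \<in> set (sp H)" for G H
    using sp[OF that(1)] that unfolding piece_def by blast
  \<comment> \<open>Obtained by solving \<open>\<epsilon> / 2 * ?\<mu> G \<le> 2 * K * (?\<mu> H -
    ?\<mu> G)\<close> for \<open>?\<mu> G\<close>: a child filling almost all of \<open>H\<close>
    would have nearly the average of \<open>H\<close>.\<close>
  define \<theta> where "\<theta> = 2 * K / (2 * K + \<epsilon> / 2)"
  have \<theta>: "0 \<le> \<theta>" "\<theta> < 1" using K0 \<open>\<epsilon> > 0\<close> by (auto simp: \<theta>_def)
  have sp_small: "?\<mu> G \<le> \<theta> * ?\<mu> H" if H: "piece H" and G: "G \<in> set (sp H)" for G H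
  proof -
    have Hm: "H \<in> sets M" "H \<subseteq> E" "?\<mu> H > 0" using H by (auto simp: piece_def)
    have Gm: "G \<in> sets M" "G \<subseteq> H" "\<epsilon> / 2 * ?\<mu> G \<le> q (\<nu> G - sc (?\<mu> G) (avg H))"
      using sp[OF H] G by auto
    have D: "?\<mu> (H - G) = ?\<mu> H - ?\<mu> G" using Hm(1) Gm(1,2) by (rule finite_measure_Diff)
    have "sc (?\<mu> H) (avg H) = \<nu> H" using Hm(3) by (simp add: avg_def)
    \<comment> \<open>The deviations from \<open>avg H\<close> over \<open>G\<close> and over
      \<open>H - G\<close> cancel, since they add up to
      \<open>\<nu> H - sc (?\<mu> H) (avg H) = 0\<close>.\<close>
    then have eq: "\<nu> G - sc (?\<mu> G) (avg H) = - (\<nu> (H - G) - sc (?\<mu> (H - G)) (avg H))"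
      unfolding nu_Diff[OF Hm(1) Gm(1,2)] D scale_left_diff_distrib by simp
    have qa: "q (avg H) \<le> K"
      using K[OF Hm(1,2)] Hm(3) by (simp add: avg_def q_scale pos_divide_le_eq)
    have "\<epsilon> / 2 * ?\<mu> G \<le> q (\<nu> (H - G) - sc (?\<mu> (H - G)) (avg H))"
      using Gm(3) unfolding eq q_minus .
    also have "\<dots> \<le> q (\<nu> (H - G)) + ?\<mu> (H - G) * q (avg H)"
      using norm_diff[of "\<nu> (H - G)" "sc (?\<mu> (H - G)) (avg H)"] by (simp add: q_scale)
    also have "\<dots> \<le> K * ?\<mu> (H - G) + ?\<mu> (H - G) * K"
      using Hm Gm by (intro add_mono K mult_left_mono qa) auto
    finally have "\<epsilon> / 2 * ?\<mu> G \<le> 2 * K * (?\<mu> H - ?\<mu> G)" unfolding D by (simp add: algebra_simps)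
    moreover have "2 * K + \<epsilon> / 2 > 0" using K0 \<open>\<epsilon> > 0\<close> by simp
    ultimately show ?thesis unfolding \<theta>_def by (simp add: pos_le_divide_eq algebra_simps)
  qed

  \<comment> \<open>Children replace their parent in place, so the union of a prefix of one level is
    also the union of a prefix of every later level.\<close>
  define \<L> where "\<L> = rec_nat [E] (\<lambda>_ L. concat (map sp L))"
  have L0: "\<L> 0 = [E]" and LS: "\<L> (Suc n) = concat (map sp (\<L> n))" for n by (simp_all add: \<L>_def)
  have Lpiece: "piece H \<and> ?\<mu> H \<le> \<theta> ^ n * ?\<mu> E" if "H \<in> set (\<L> n)" for n H
    using that
  proof (induction n arbitrary: H)
    case 0
    then show ?case using E by (simp add: L0 piece_def)
  next
    case (Suc n)
    then obtain H' where H': "H' \<in> set (\<L> n)" "H \<in> set (sp H')" by (auto simp: LS)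
    then have "piece H'" "?\<mu> H' \<le> \<theta> ^ n * ?\<mu> E" using Suc.IH by blast+
    then have "?\<mu> H \<le> \<theta> * ?\<mu> H'" "\<theta> * ?\<mu> H' \<le> \<theta> * (\<theta> ^ n * ?\<mu> E)"
      using sp_small H'(2) \<theta>(1) by (auto intro: mult_left_mono)
    then show ?case using sp_piece[OF \<open>piece H'\<close> H'(2)] by (simp add: mult.assoc)
  qed
  have concat_ok: "\<Union>(set (concat (map sp xs))) = \<Union>(set xs) \<and>
      (disjoint_list xs \<longrightarrow> disjoint_list (concat (map sp xs)))" if "\<And>H. H \<in> set xs \<Longrightarrow> piece H" for xs
    using that
  proof (induction xs)
    case (Cons x xs)
    have x: "disjoint_list (sp x)" "\<Union>(set (sp x)) = x" using sp[of x] Cons.prems by auto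
    have IH: "\<Union>(set (concat (map sp xs))) = \<Union>(set xs)"
      "disjoint_list xs \<longrightarrow> disjoint_list (concat (map sp xs))"
      using Cons.IH Cons.prems by auto
    have "\<Union>(set (concat (map sp (x # xs)))) = \<Union>(set (x # xs))"
      using x(2) IH(1) by simp
    moreover have "disjoint_list (concat (map sp (x # xs)))" if "disjoint_list (x # xs)"
    proof -
      have "x \<inter> \<Union>(set xs) = {}" using that by auto
      then have "A \<inter> B = {}" if "A \<in> set (sp x)" "B \<in> set (concat (map sp xs))" for A B
        using that x(2) IH(1) by blast
      then show ?thesis using x(1) IH(2) that by (auto simp: sorted_wrt_append)
    qed
    ultimately show ?case by blast
  qed simp
  have Lok: "disjoint_list (\<L> n) \<and> \<Union>(set (\<L> n)) = E" for n
  proof (induction n)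
    case (Suc n)
    then show ?case using concat_ok[of "\<L> n"] Lpiece by (simp only: LS)
  qed (simp add: L0)
  define w where "w xs = sum_list (map ?\<mu> xs)" for xs
  have additive: "\<nu> (\<Union>(set xs)) = sum_list (map \<nu> xs)" "?\<mu> (\<Union>(set xs)) = w xs" "\<Union>(set xs) \<in> sets M"
    "\<Union>(set xs) \<subseteq> E"
    if "\<L> n = xs @ ys" for n xs ys
  proof -
    have "disjoint_list xs" using Lok[of n] that by (simp add: sorted_wrt_append)
    moreover have m: "set xs \<subseteq> sets M" using Lpiece[of _ n] that by (auto simp: piece_def)
    ultimately show "\<nu> (\<Union>(set xs)) = sum_list (map \<nu> xs)" "?\<mu> (\<Union>(set xs)) = w xs"
      using disjoint_list_additive[of xs] by (auto simp: w_def)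
    show "\<Union>(set xs) \<in> sets M" using m by auto
    show "\<Union>(set xs) \<subseteq> E" using Lok[of n] that by auto
  qed
  have wL: "w (\<L> n) = ?\<mu> E" for n using additive(2)[of n "\<L> n" "[]"] Lok[of n] by simp

  \<comment> \<open>Prefix unions of all levels together form a countable chain, so that unions of
    subfamilies stay measurable.\<close>
  define \<C> where "\<C> = (\<lambda>(n, k). \<Union>(set (take k (\<L> n)))) ` UNIV"
  have prefix_C: "\<Union>(set xs) \<in> \<C>" if "\<L> n = xs @ ys" for n xs ys
  proof -
    have "\<Union>(set xs) = (\<lambda>(n, k). \<Union>(set (take k (\<L> n)))) (n, length xs)" using that by simp
    then show ?thesis unfolding \<C>_def by blast
  qed
  have C_prefix: "\<exists>n xs ys. \<L> n = xs @ ys \<and> C = \<Union>(set xs)" if C_in: "C \<in> \<C>" for C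
  proof -
    obtain n k where C: "C = \<Union>(set (take k (\<L> n)))" using C_in unfolding \<C>_def by auto
    have "\<L> n = take k (\<L> n) @ drop k (\<L> n)" by simp
    with C show ?thesis by blast
  qed
  have refine: "\<exists>xs' ys'. \<L> (n + k) = xs' @ ys' \<and> \<Union>(set xs') = \<Union>(set xs)" if "\<L> n = xs @ ys" for n k xs ys
  proof (induction k)
    case 0
    then show ?case using that by auto
  next
    case (Suc k)
    then obtain xs' ys' where *: "\<L> (n + k) = xs' @ ys'" "\<Union>(set xs') = \<Union>(set xs)"
      by (elim exE conjE) (rule that)
    then have "\<L> (n + Suc k) = concat (map sp xs') @ concat (map sp ys')" by (simp add: LS)
    moreover have "\<Union>(set (concat (map sp xs'))) = \<Union>(set xs')"
      using concat_ok[of xs'] Lpiece[of _ "n + k"] *(1) by auto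
    ultimately have "\<L> (n + Suc k) = concat (map sp xs') @ concat (map sp ys') \<and>
        \<Union>(set (concat (map sp xs'))) = \<Union>(set xs)" using *(2) by simp
    then show ?case by (intro exI)
  qed
  have chain: "C \<subseteq> D \<or> D \<subseteq> C" if CD: "C \<in> \<C>" "D \<in> \<C>" for C D
  proof -
    obtain n xs ys where C: "\<L> n = xs @ ys" "C = \<Union>(set xs)" 
      using C_prefix[OF CD(1)] by (elim exE conjE) (rule that)
    obtain m us vs where D: "\<L> m = us @ vs" "D = \<Union>(set us)" 
      using C_prefix[OF CD(2)] by (elim exE conjE) (rule that)
    \<comment> \<open>Both sets are refined to level \<open>n + m\<close>, where they come from
      prefixes of one and the same list.\<close>
    obtain xs' ys' where C': "\<L> (n + m) = xs' @ ys'" "C = \<Union>(set xs')"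
      using refine[OF C(1), of m] unfolding C(2)[symmetric] by (elim exE conjE) (rule that[OF _ sym])
    obtain us' vs' where D': "\<L> (n + m) = us' @ vs'" "D = \<Union>(set us')"
      using refine[OF D(1), of n] unfolding D(2)[symmetric] add.commute[of m n]
      by (elim exE conjE) (rule that[OF _ sym])
    have "xs' @ ys' = us' @ vs'" using C' D' by simp
    then have "(\<exists>zs. xs' = us' @ zs) \<or> (\<exists>zs. us' = xs' @ zs)"
      unfolding append_eq_append_conv2 by blast
    then show ?thesis using C'(2) D'(2) by auto
  qed
  have C_sets: "C \<in> sets M" "C \<subseteq> E" if C_in: "C \<in> \<C>" for C
  proof -
    obtain n xs ys where "\<L> n = xs @ ys" "C = \<Union>(set xs)"
      using C_prefix[OF C_in] by (elim exE conjE) (rule that)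
    then show "C \<in> sets M" "C \<subseteq> E" using additive(3,4) by simp_all
  qed
  have C_count: "countable \<C>" by (simp add: \<C>_def)

  \<comment> \<open>Only members of measure strictly below \<open>t\<close> enter; hence
    \<open>T 0\<close> is empty, and \<open>T t\<close> is contained in every member of measure at
    least \<open>t\<close>.\<close>
  define T where "T t = \<Union>{C \<in> \<C>. ?\<mu> C < t}" for t
  have T_sets: "T t \<in> sets M" for t
    unfolding T_def
  proof (rule sets.countable_Union)
    show "countable {C \<in> \<C>. ?\<mu> C < t}" using C_count by (rule countable_subset[rotated]) blast
    show "{C \<in> \<C>. ?\<mu> C < t} \<subseteq> sets M" using C_sets(1) by blast
  qed
  have T_sub: "T t \<subseteq> C" if "C \<in> \<C>" "t \<le> ?\<mu> C" for t C
  proof -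
    have "D \<subseteq> C" if D: "D \<in> \<C>" "?\<mu> D < t" for D
    proof (rule ccontr)
      assume "\<not> D \<subseteq> C"
      then have "C \<subseteq> D" using chain D(1) \<open>C \<in> \<C>\<close> by blast
      then have "?\<mu> C \<le> ?\<mu> D" using C_sets(1)[OF D(1)] by (rule finite_measure_mono)
      then show False using D(2) \<open>t \<le> ?\<mu> C\<close> by simp
    qed
    then show ?thesis unfolding T_def by blast
  qed
  have T_mono: "T s \<subseteq> T t" if "s \<le> t" for s t
    using that unfolding T_def by auto
  have \<theta>lim: "(\<lambda>n. \<theta> ^ n * ?\<mu> E) \<longlonglongrightarrow> 0"
    by (auto intro!: tendsto_eq_intros LIMSEQ_power_zero simp: \<theta>)
  have T_measure: "?\<mu> (T t) = t" if t: "0 \<le> t" "t \<le> ?\<mu> E" for t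
  proof (cases "t = 0")
    case True
    have "T 0 = {}" unfolding T_def by (auto simp: not_less[of 0, symmetric])
    then show ?thesis using True by simp
  next
    case False
    have "\<bar>?\<mu> (T t) - t\<bar> \<le> \<theta> ^ n * ?\<mu> E" for n
    proof -
      \<comment> \<open>Two consecutive prefixes of level \<open>n\<close> enclose
        \<open>T t\<close>, and their measures enclose \<open>t\<close>; they differ by a single
        small piece.\<close>
      obtain us x vs where *: "\<L> n = us @ x # vs" "w us < t" "t \<le> w us + ?\<mu> x"
        using list_locate_strict[of t ?\<mu> "\<L> n"] wL[of n] False t unfolding w_def by auto
      have x: "?\<mu> x \<le> \<theta> ^ n * ?\<mu> E" using Lpiece[of x n] * by simp
      have C1: "\<Union>(set us) \<in> \<C>" "?\<mu> (\<Union>(set us)) = w us"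
        using prefix_C additive(2) * by blast+
      have C2: "\<Union>(set (us @ [x])) \<in> \<C>" "?\<mu> (\<Union>(set (us @ [x]))) = w us + ?\<mu> x"
        using prefix_C[of n "us @ [x]" vs] additive(2)[of n "us @ [x]" vs] * by (simp_all add: w_def)
      have "\<Union>(set us) \<subseteq> T t" using C1 *(2) unfolding T_def by auto
      then have "w us \<le> ?\<mu> (T t)" using finite_measure_mono[OF _ T_sets] C1(2) by metis
      moreover have "T t \<subseteq> \<Union>(set (us @ [x]))" using C2 *(3) by (intro T_sub) auto
      then have "?\<mu> (T t) \<le> w us + ?\<mu> x"
        using finite_measure_mono[OF _ C_sets(1)[OF C2(1)]] C2(2) by metis
      ultimately show ?thesis using *(2,3) x by linarith
    qed
    then have "\<bar>?\<mu> (T t) - t\<bar> \<le> 0" using \<theta>lim by (intro LIMSEQ_le_const[OF \<theta>lim]) blast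
    then show ?thesis by simp
  qed
  define F where "F t = \<nu> (T t)" for t
  \<comment> \<open>\<open>T (?\<mu> C)\<close> may miss part of \<open>C\<close>, but only a null
    set, on which \<open>\<nu>\<close> vanishes.\<close>
  have F_C: "F (?\<mu> C) = \<nu> C" if "C \<in> \<C>" for C
  proof -
    have "?\<mu> C \<le> ?\<mu> E" using C_sets[OF that] E(1) by (intro finite_measure_mono)
    then have "?\<mu> (T (?\<mu> C)) = ?\<mu> C" by (intro T_measure) auto
    moreover have sub: "T (?\<mu> C) \<subseteq> C" using that by (intro T_sub) auto
    ultimately have "?\<mu> (C - T (?\<mu> C)) = 0"
      using finite_measure_Diff[OF C_sets(1)[OF that] T_sets] by simp
    then have "\<nu> (C - T (?\<mu> C)) = 0" using C_sets(1)[OF that] T_sets by (intro nu_null) auto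
    then show ?thesis using nu_Diff[OF C_sets(1)[OF that] T_sets sub] by (simp add: F_def)
  qed
  have TE: "T t \<subseteq> E" for t unfolding T_def using C_sets(2) by blast
  have lip: "q (F t - F s) \<le> K * \<bar>t - s\<bar>" if "s \<in> {0..?\<mu> E}" "t \<in> {0..?\<mu> E}" for s t
  proof -
    have *: "q (F t - F s) \<le> K * (t - s)" if st: "0 \<le> s" "s \<le> t" "t \<le> ?\<mu> E" for s t
    proof -
      have "F t - F s = \<nu> (T t - T s)"
        unfolding F_def using nu_Diff[OF T_sets T_sets T_mono[OF st(2)]] by simp
      then have "q (F t - F s) \<le> K * ?\<mu> (T t - T s)" using K[of "T t - T s"] T_sets TE by auto
      also have "?\<mu> (T t - T s) = t - s"
        using finite_measure_Diff[OF T_sets T_sets T_mono[OF st(2)]] T_measure st by simp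
      finally show ?thesis .
    qed
    show ?thesis
      using *[of s t] *[of t s] that q_diff_commute[of "F t" "F s"] by (cases "s \<le> t") auto
  qed
  have step: "F (w us) = sum_list (map \<nu> us)" "w us \<le> ?\<mu> E" if "\<L> n = us @ vs" for n us vs
  proof -
    show "F (w us) = sum_list (map \<nu> us)"
      using F_C[OF prefix_C[OF that]] additive(1,2)[OF that] by simp
    show "w us \<le> ?\<mu> E"
      using finite_measure_mono[OF additive(4)[OF that] E(1)] additive(2)[OF that] by simp
  qed
  have w0: "0 \<le> w us" for us unfolding w_def by (rule sum_list_nonneg) auto
  \<comment> \<open>At break points \<open>F\<close> sums \<open>\<nu>\<close> over a prefix, so the
    single piece \<open>x\<close> accounts for the whole increment.\<close>
  have slope: "slope F (w us) (w us + ?\<mu> x) = avg x \<and> w us + ?\<mu> x \<le> ?\<mu> E"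
    if "\<L> n = us @ x # vs" for n us x vs
    using step[of n us "x # vs"] step[of n "us @ [x]" vs] that by (simp add: slope_def avg_def w_def)
  have "\<not> has_derivative_within F {0..?\<mu> E} t v" if t: "t \<in> {0..?\<mu> E}" for t v
  proof (rule not_differentiable_withinI)
    show "\<epsilon> / 2 > 0" using \<open>\<epsilon> > 0\<close> by simp
    fix d :: real assume "d > 0"
    then have "\<forall>\<^sub>F n in sequentially. \<theta> ^ n * ?\<mu> E < d" using \<theta>lim by (intro order_tendstoD(2))
    then obtain n where n: "\<theta> ^ n * ?\<mu> E < d" unfolding eventually_sequentially by blast
    have "\<L> n \<noteq> []" using Lok[of n] E(2) by auto
    \<comment> \<open>\<open>x\<close> is a piece of level \<open>n\<close> whose interval contains
      \<open>t\<close>, and \<open>y\<close> below is a child of \<open>x\<close> with the same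
      property. Their averages are the two slopes to be compared.\<close>
    then obtain us x vs where x: "\<L> n = us @ x # vs" "w us \<le> t" "t \<le> w us + ?\<mu> x"
      using list_locate[of "\<L> n" ?\<mu> t] t wL[of n] unfolding w_def by auto
    have px: "piece x" "?\<mu> x < d" using Lpiece[of x n] x(1) n by auto
    have "disjoint_list (sp x)" "\<Union>(set (sp x)) = x" "set (sp x) \<subseteq> sets M" using sp[OF px(1)] by auto
    then have wsp: "sum_list (map ?\<mu> (sp x)) = ?\<mu> x" "sp x \<noteq> []"
      using disjoint_list_additive[of "sp x"] px(1) by (auto simp: piece_def)
    obtain us' y vs' where y: "sp x = us' @ y # vs'" "sum_list (map ?\<mu> us') \<le> t - w us"
      "t - w us \<le> sum_list (map ?\<mu> us') + ?\<mu> y"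
      using list_locate[OF wsp(2), of ?\<mu> "t - w us"] x wsp(1) by auto
    have yin: "y \<in> set (sp x)" using y(1) by simp
    have py: "piece y" using sp_piece[OF px(1) yin] .
    have "y \<subseteq> x" using sp[OF px(1)] yin by blast
    then have dy: "?\<mu> y < d"
      using finite_measure_mono[of y x] px by (auto simp: piece_def)
    let ?zs = "concat (map sp us) @ us'"
    have Lz: "\<L> (Suc n) = ?zs @ y # (vs' @ concat (map sp vs))" using x(1) y(1) by (simp add: LS)
    have wz: "w ?zs = w us + sum_list (map ?\<mu> us')"
    proof -
      have "\<L> (Suc n) = concat (map sp us) @ (us' @ y # (vs' @ concat (map sp vs)))" using Lz by simp
      then have "w (concat (map sp us)) = ?\<mu> (\<Union>(set (concat (map sp us))))" using additive(2) by metis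
      also have "\<Union>(set (concat (map sp us))) = \<Union>(set us)"
        using concat_ok[of us] Lpiece[of _ n] x(1) by auto
      also have "?\<mu> (\<Union>(set us)) = w us" using additive(2)[OF x(1)] .
      finally show ?thesis by (simp add: w_def)
    qed
    have sx: "slope F (w us) (w us + ?\<mu> x) = avg x" "w us + ?\<mu> x \<le> ?\<mu> E"
      using slope[OF x(1)] by auto
    have sy: "slope F (w ?zs) (w ?zs + ?\<mu> y) = avg y" "w ?zs + ?\<mu> y \<le> ?\<mu> E"
      using slope[OF Lz] by auto
    have "\<epsilon> / 2 \<le> q (avg y - avg x)"
    proof -
      have my: "?\<mu> y > 0" using py by (simp add: piece_def)
      have "\<epsilon> / 2 * ?\<mu> y \<le> q (\<nu> y - sc (?\<mu> y) (avg x))" using sp[OF px(1)] yin by blast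
      moreover have "q (avg y - avg x) = q (\<nu> y - sc (?\<mu> y) (avg x)) / ?\<mu> y"
        unfolding avg_def[of y] using q_quotient_diff[of "?\<mu> y" "\<nu> y" "avg x"] my
        by (simp add: inverse_eq_divide)
      ultimately show ?thesis using my by (simp add: pos_le_divide_eq)
    qed
    then show "\<exists>a b a' b'. {a, b, a', b'} \<subseteq> {0..?\<mu> E} \<and> a \<le> t \<and> t \<le> b \<and> a < b \<and> b - a < d \<and>
        a' \<le> t \<and> t \<le> b' \<and> a' < b' \<and> b' - a' < d \<and> \<epsilon> / 2 \<le> q (slope F a b - slope F a' b')"
      using sx sy x(2,3) y(2,3) wz px py dy w0[of us] w0[of ?zs]
      by (intro exI[of _ "w ?zs"] exI[of _ "w ?zs + ?\<mu> y"] exI[of _ "w us"] exI[of _ "w us + ?\<mu> x"])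
        (auto simp: piece_def)
  qed
  then show False using differentiable_somewhere_within[OF diff E(2) lip] by blast
qed

end

section \<open>Construction of densities\<close>

lemma (in finite_measure) simple_function_partition:
  assumes "finite I" "\<And>i. i \<in> I \<Longrightarrow> P i \<in> sets M" "disjoint_family_on P I" "(\<Union>i\<in>I. P i) = space M"
    and s: "\<And>i \<omega>. i \<in> I \<Longrightarrow> \<omega> \<in> P i \<Longrightarrow> s \<omega> = c i"
  shows "simple_function M s"
    "\<And>y. measure M (s -` {y} \<inter> space M) = (\<Sum>i\<in>{i \<in> I. c i = y}. measure M (P i))"
proof -
  have vim: "s -` {y} \<inter> space M = (\<Union>i\<in>{i \<in> I. c i = y}. P i)" for y
    using assms(4) s by (auto simp flip: assms(4))
  have "s ` space M \<subseteq> c ` I" using assms(4) s by (auto simp flip: assms(4))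
  then have "finite (s ` space M)" using assms(1) finite_subset by blast
  moreover have "s -` {y} \<inter> space M \<in> sets M" for y
    unfolding vim using assms(1,2) by (intro sets.finite_UN) auto
  ultimately show "simple_function M s" unfolding simple_function_def by blast
  show "measure M (s -` {y} \<inter> space M) = (\<Sum>i\<in>{i \<in> I. c i = y}. measure M (P i))" for y
    unfolding vim using assms(1-3)
    by (intro finite_measure_finite_Union) (auto simp: disjoint_family_on_def)
qed

context normed_finite_measure
begin

text \<open>The definition sums over distinct values, whereas here several pieces may share a value
  and pieces may be empty; grouping the pieces by value reconciles the two.\<close>

lemma simple_vector_integral_partition:
  assumes "finite I" "\<And>i. i \<in> I \<Longrightarrow> P i \<in> sets M" "disjoint_family_on P I" "(\<Union>i\<in>I. P i) = space M"
    and s: "\<And>i \<omega>. i \<in> I \<Longrightarrow> \<omega> \<in> P i \<Longrightarrow> s \<omega> = c i"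
  shows "simple_vector_integral sc M s = (\<Sum>i\<in>I. sc (measure M (P i)) (c i))"
proof -
  have m: "measure M (s -` {y} \<inter> space M) = (\<Sum>i\<in>{i \<in> I. c i = y}. measure M (P i))" for y
    using assms by (rule simple_function_partition(2))
  have sub: "s ` space M \<subseteq> c ` I" using assms(4) s by (auto simp flip: assms(4))
  have z: "measure M (s -` {y} \<inter> space M) = 0" if "y \<notin> s ` space M" for y
  proof -
    have "s -` {y} \<inter> space M = {}" using that by auto
    then show ?thesis by simp
  qed
  have "simple_vector_integral sc M s
      = (\<Sum>y\<in>c ` I. sc (measure M (s -` {y} \<inter> space M)) y)"
    unfolding simple_vector_integral_def of_real_eq_id id_apply
    using assms(1) sub z by (intro sum.mono_neutral_left) auto
  also have "\<dots> = (\<Sum>y\<in>c ` I. \<Sum>i\<in>{i \<in> I. c i = y}. sc (measure M (P i)) (c i))"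
  proof (rule sum.cong[OF refl])
    fix y
    show "sc (measure M (s -` {y} \<inter> space M)) y = (\<Sum>i\<in>{i \<in> I. c i = y}. sc (measure M (P i)) (c i))"
      unfolding m[of y] scale_sum_left by (rule sum.cong) auto
  qed
  also have "\<dots> = (\<Sum>i\<in>I. sc (measure M (P i)) (c i))"
    using assms(1) by (rule sum.image_gen[symmetric])
  finally show ?thesis .
qed

end

section \<open>From almost constant averages to a density\<close>

context vector_measure_space
begin

lemma good_subset: "good \<epsilon> F x \<Longrightarrow> G \<subseteq> F \<Longrightarrow> good \<epsilon> G x"
  unfolding good_def by blast

text \<open>Both points are close to the average of \<open>\<nu>\<close> over \<open>F\<close>,
  which makes sense because \<open>F\<close> has positive measure.\<close>

lemma good_unique:
  assumes "good \<epsilon> F x" "good \<epsilon>' F y" "F \<in> sets M" "measure M F > 0"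
  shows "q (x - y) \<le> \<epsilon> + \<epsilon>'"
proof -
  let ?m = "measure M F"
  have "sc ?m (x - y) = (\<nu> F - sc ?m y) - (\<nu> F - sc ?m x)"
    by (simp add: scale_right_diff_distrib)
  then have "?m * q (x - y) \<le> q (\<nu> F - sc ?m y) + q (\<nu> F - sc ?m x)"
    using norm_diff[of "\<nu> F - sc ?m y" "\<nu> F - sc ?m x"] q_scale[of ?m "x - y"] by simp
  also have "\<dots> \<le> \<epsilon>' * ?m + \<epsilon> * ?m"
    using assms unfolding good_def by (intro add_mono) auto
  finally have "?m * q (x - y) \<le> ?m * (\<epsilon> + \<epsilon>')" by (simp add: algebra_simps)
  then show ?thesis using assms(4) by simp
qed

lemma good_partition:
  assumes "\<And>E. E \<in> sets M \<Longrightarrow> measure M E > 0 \<Longrightarrow>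
      \<exists>H x. H \<in> sets M \<and> H \<subseteq> E \<and> measure M H > 0 \<and> good \<epsilon> H x"
  shows "\<exists>(A :: nat \<Rightarrow> 'w set) x. disjoint_family A \<and> (\<forall>n. A n \<in> sets M) \<and>
    measure M (space M - (\<Union>n. A n)) = 0 \<and> (\<forall>n. good \<epsilon> (A n) (x n))"
proof -
  let ?\<G> = "{H \<in> sets M. \<exists>x. good \<epsilon> H x}"
  obtain A :: "nat \<Rightarrow> _" where A: "disjoint_family A" "\<And>n. A n \<in> insert {} ?\<G>" "\<And>n. A n \<in> sets M"
    "\<And>n. A n \<subseteq> space M" "\<And>G. G \<in> ?\<G> \<Longrightarrow> G \<subseteq> space M - (\<Union>n. A n) \<Longrightarrow> measure M G = 0"
    by (rule exhaustion[OF _ sets.top, of ?\<G>]) (blast, rule that)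
  let ?R = "space M - (\<Union>n. A n)"
  have R: "?R \<in> sets M"
    using sets.countable_nat_UN[OF image_subsetI[OF A(3)]] by (intro sets.Diff) auto
  have "measure M ?R = 0"
  proof (rule ccontr)
    assume "measure M ?R \<noteq> 0"
    then have "measure M ?R > 0" by (simp add: zero_less_measure_iff)
    then obtain H x where H: "H \<in> sets M" "H \<subseteq> ?R" "measure M H > 0" "good \<epsilon> H x"
      using assms[OF R] by blast
    have "measure M H = 0" using H by (intro A(5)) auto
    then show False using H(3) by simp
  qed
  \<comment> \<open>The exhaustion may return empty sets, which are good for any point.\<close>
  moreover have "good \<epsilon> {} 0" unfolding good_def by auto
  then have "\<exists>x. good \<epsilon> (A n) x" for n using A(2)[of n] by auto
  then have "good \<epsilon> (A n) (SOME x. good \<epsilon> (A n) x)" for n by (rule someI_ex)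
  ultimately show ?thesis using A(1,3) by (intro exI conjI allI)
qed

text \<open>The functions \<open>f k\<close> take countably many values and converge uniformly off a
  null set, but integrals are built from functions with finitely many values. So each partition is
  cut off at an index \<open>m k\<close> such that the measure of the remainder, the integral of
  \<open>f k\<close> over it and the values of \<open>\<nu>\<close> on its subsets are all at most
  \<open>e k\<close> in size.\<close>

lemma density_exists:
  assumes compl: "complete_wrt q"
    and bv: "bounded_variation q M \<nu>"
    and good_pieces: "\<And>E \<epsilon>. E \<in> sets M \<Longrightarrow> measure M E > 0 \<Longrightarrow> \<epsilon> > 0 \<Longrightarrow>
      \<exists>H x. H \<in> sets M \<and> H \<subseteq> E \<and> measure M H > 0 \<and> good \<epsilon> H x"
  shows "\<exists>f. has_density sc q M \<nu> f"
proof -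
  let ?\<mu> = "measure M"
  \<comment> \<open>Summability of these bounds is used in the Borel-Cantelli argument.\<close>
  define e where "e k = (1 / 2 :: real) ^ k" for k :: nat
  have e: "e k > 0" for k by (simp add: e_def)
  have "\<forall>k. \<exists>p. disjoint_family (fst p :: nat \<Rightarrow> 'w set) \<and> (\<forall>n. fst p n \<in> sets M) \<and>
    ?\<mu> (space M - (\<Union>n. fst p n)) = 0 \<and> (\<forall>n. good (e k) (fst p n) (snd p n))"
  proof
    fix k
    obtain A :: "nat \<Rightarrow> 'w set" and x where "disjoint_family A" "\<forall>n. A n \<in> sets M"
      "?\<mu> (space M - (\<Union>n. A n)) = 0" "\<forall>n. good (e k) (A n) (x n)"
      using good_partition[of "e k"] good_pieces[OF _ _ e[of k]] by blast
    then show "\<exists>p. disjoint_family (fst p :: nat \<Rightarrow> 'w set) \<and> (\<forall>n. fst p n \<in> sets M) \<and>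
        ?\<mu> (space M - (\<Union>n. fst p n)) = 0 \<and> (\<forall>n. good (e k) (fst p n) (snd p n))"
      by (intro exI[of _ "(A, x)"]) simp
  qed
  from choice[OF this] obtain p where p: "\<forall>k. disjoint_family (fst (p k) :: nat \<Rightarrow> 'w set) \<and>
    (\<forall>n. fst (p k) n \<in> sets M) \<and> ?\<mu> (space M - (\<Union>n. fst (p k) n)) = 0 \<and>
    (\<forall>n. good (e k) (fst (p k) n) (snd (p k) n))" ..
  define A where "A k = fst (p k)" for k
  define x where "x k = snd (p k)" for k
  have A: "disjoint_family (A k)" "A k n \<in> sets M" "?\<mu> (space M - (\<Union>n. A k n)) = 0" "good (e k) (A k n) (x k n)"
    for k n using p by (auto simp: A_def x_def)
  have A_disj: "A k i \<inter> A k j = {}" if "i \<noteq> j" for k i j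
    using A(1)[of k] that by (auto simp: disjoint_family_on_def)
  \<comment> \<open>The pieces are disjoint, so the index is unique where it exists; the points of
    the space without one form a null set.\<close>
  define f where "f k \<omega> = x k (SOME n. \<omega> \<in> A k n)" for k \<omega>
  have f: "f k \<omega> = x k n" if "\<omega> \<in> A k n" for k n \<omega>
  proof -
    have "(SOME n. \<omega> \<in> A k n) = n" using that A_disj[of _ n k] by (intro some_equality) blast+
    then show ?thesis by (simp add: f_def)
  qed
  define g where "g \<omega> = (SOME l. (\<lambda>k. q (f k \<omega> - l)) \<longlonglongrightarrow> 0)" for \<omega>
  have "AE \<omega> in M. \<forall>k. \<omega> \<in> (\<Union>n. A k n)"
    unfolding AE_all_countable
  proof
    fix k
    have "space M - (\<Union>n. A k n) \<in> sets M" using A(2) by (intro sets.Diff sets.countable_nat_UN) auto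
    then have "space M - (\<Union>n. A k n) \<in> null_sets M"
      using A(3)[of k] by (simp add: null_sets_def emeasure_eq_measure)
    then show "AE \<omega> in M. \<omega> \<in> (\<Union>n. A k n)" by (rule AE_I') auto
  qed
  \<comment> \<open>Null intersections are discarded so that at every remaining point
    \<open>good_unique\<close> can compare the values for two partitions.\<close>
  moreover have "AE \<omega> in M. \<forall>k j n i. \<omega> \<in> A k n \<longrightarrow> \<omega> \<in> A j i \<longrightarrow> ?\<mu> (A k n \<inter> A j i) > 0"
    unfolding AE_all_countable
  proof (intro allI)
    fix k j n i
    show "AE \<omega> in M. \<omega> \<in> A k n \<longrightarrow> \<omega> \<in> A j i \<longrightarrow> ?\<mu> (A k n \<inter> A j i) > 0"
    proof (cases "?\<mu> (A k n \<inter> A j i) > 0")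
      case False
      then have "A k n \<inter> A j i \<in> null_sets M"
        using A(2) measure_nonneg[of M "A k n \<inter> A j i"] by (auto simp: null_sets_def emeasure_eq_measure)
      then show ?thesis by (rule AE_I') auto
    qed simp
  qed
  ultimately have ae: "AE \<omega> in M. \<forall>k. \<omega> \<in> (\<Union>n. A k n) \<and> q (f k \<omega> - g \<omega>) \<le> 2 * e k"
  proof eventually_elim
    case (elim \<omega>)
    have cauchy: "q (f k \<omega> - f j \<omega>) \<le> e k + e j" for k j
    proof -
      obtain n i where ni: "\<omega> \<in> A k n" "\<omega> \<in> A j i" using elim(1) by blast
      then have "?\<mu> (A k n \<inter> A j i) > 0" using elim(2) by blast
      then have "q (x k n - x j i) \<le> e k + e j"
        using A(2) good_subset[OF A(4)] by (intro good_unique[of _ "A k n \<inter> A j i"]) auto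
      then show ?thesis using f ni by simp
    qed
    have e_lim: "e \<longlonglongrightarrow> 0" unfolding e_def[abs_def] by (rule LIMSEQ_power_zero) simp
    have "\<exists>n0. \<forall>m\<ge>n0. \<forall>n\<ge>n0. q (f m \<omega> - f n \<omega>) < d" if d: "d > 0" for d
    proof -
      have "\<forall>\<^sub>F n in sequentially. e n < d / 2" using order_tendstoD(2)[OF e_lim, of "d / 2"] d by simp
      then obtain n0 where "\<And>n. n \<ge> n0 \<Longrightarrow> e n < d / 2" unfolding eventually_sequentially by blast
      then have "q (f m \<omega> - f n \<omega>) < d" if "m \<ge> n0" "n \<ge> n0" for m n
        using cauchy[of m n] that by (smt (verit) field_sum_of_halves)
      then show ?thesis by blast
    qed
    then have "\<exists>l. (\<lambda>k. q (f k \<omega> - l)) \<longlonglongrightarrow> 0"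
      using compl[unfolded complete_wrt_def, THEN spec, of "\<lambda>k. f k \<omega>"] by simp
    then have lim: "(\<lambda>k. q (f k \<omega> - g \<omega>)) \<longlonglongrightarrow> 0" unfolding g_def by (rule someI_ex)
    have "q (f k \<omega> - g \<omega>) \<le> 2 * e k" for k
    proof -
      have "q (g \<omega> - f k \<omega>) \<le> 1 * (2 * e k)"
      proof (rule q_limit_le)
        show "(\<lambda>n. q (f n \<omega> - f k \<omega> - (g \<omega> - f k \<omega>))) \<longlonglongrightarrow> 0" using lim by simp
        have "e n \<le> e k" if "n \<ge> k" for n using that by (simp add: e_def power_decreasing)
        then have "q (f n \<omega> - f k \<omega>) \<le> 2 * e k" if "n \<ge> k" for n
          using cauchy[of n k] that by fastforce
        then show "\<forall>\<^sub>F n in sequentially. q (f n \<omega> - f k \<omega>) \<le> 2 * e k"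
          unfolding eventually_sequentially by blast
      qed
      then show ?thesis by (simp add: q_diff_commute)
    qed
    then show ?case using elim(1) by blast
  qed

  obtain C where C: "C \<ge> 0"
    "\<And>(A :: nat \<Rightarrow> 'w set) n. disjoint_family A \<Longrightarrow> range A \<subseteq> sets M \<Longrightarrow> (\<Sum>i<n. q (\<nu> (A i))) \<le> C"
    by (rule bounded_variation_sum[OF bv]) (rule that)
  have sums\<mu>: "(\<lambda>n. ?\<mu> (A k n)) sums ?\<mu> (space M)" for k
  proof -
    have "(\<lambda>n. ?\<mu> (A k n)) sums ?\<mu> (\<Union>n. A k n)"
      by (rule finite_measure_UNION[OF _ A(1)]) (use A(2) in blast)
    moreover have "?\<mu> (space M - (\<Union>n. A k n)) = ?\<mu> (space M) - ?\<mu> (\<Union>n. A k n)"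
      by (rule finite_measure_Diff[OF sets.top])
        (use A(2)[of k] sets.sets_into_space[OF A(2)[of k]] in \<open>auto intro!: sets.countable_nat_UN\<close>)
    ultimately show ?thesis using A(3)[of k] by simp
  qed
  \<comment> \<open>Bounded variation gives integrability of \<open>f k\<close>: on each piece the
    integral of its size exceeds \<open>q (\<nu> (A k n))\<close> by at most \<open>e k\<close>
    times the measure.\<close>
  have summ: "summable (\<lambda>n. q (x k n) * ?\<mu> (A k n))" for k
  proof (rule bounded_imp_summable)
    show "0 \<le> q (x k n) * ?\<mu> (A k n)" for n by (simp add: q_nonneg)
    show "(\<Sum>i\<le>n. q (x k i) * ?\<mu> (A k i)) \<le> C + e k * ?\<mu> (space M)" for n
    proof -
      have le: "q (x k i) * ?\<mu> (A k i) \<le> q (\<nu> (A k i)) + e k * ?\<mu> (A k i)" for i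
      proof -
        have "q (\<nu> (A k i) - sc (?\<mu> (A k i)) (x k i)) \<le> e k * ?\<mu> (A k i)"
          using A(2,4) unfolding good_def by blast
        moreover have "?\<mu> (A k i) * q (x k i) \<le> q (\<nu> (A k i)) + q (\<nu> (A k i) - sc (?\<mu> (A k i)) (x k i))"
          using norm_diff[of "\<nu> (A k i)" "\<nu> (A k i) - sc (?\<mu> (A k i)) (x k i)"] by (simp add: q_scale)
        ultimately show ?thesis by (simp add: mult.commute)
      qed
      have "(\<Sum>i<Suc n. q (x k i) * ?\<mu> (A k i)) \<le> (\<Sum>i<Suc n. q (\<nu> (A k i)) + e k * ?\<mu> (A k i))"
        using le by (rule sum_mono)
      also have "\<dots> = (\<Sum>i<Suc n. q (\<nu> (A k i))) + e k * (\<Sum>i<Suc n. ?\<mu> (A k i))"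
        by (simp only: sum.distrib sum_distrib_left)
      also have "\<dots> \<le> C + e k * ?\<mu> (space M)"
      proof (intro add_mono mult_left_mono)
        show "(\<Sum>i<Suc n. q (\<nu> (A k i))) \<le> C" by (rule C(2)[OF A(1)]) (use A(2) in blast)
        have "(\<Sum>i<Suc n. ?\<mu> (A k i)) \<le> (\<Sum>i. ?\<mu> (A k i))"
          by (rule sum_le_suminf) (use sums\<mu>[of k] in \<open>auto simp: sums_iff\<close>)
        then show "(\<Sum>i<Suc n. ?\<mu> (A k i)) \<le> ?\<mu> (space M)" using sums\<mu>[of k] by (simp add: sums_iff)
      qed (use e[of k] in simp)
      finally show ?thesis by (simp only: lessThan_Suc_atMost)
    qed
  qed
  define B where "B k m = (\<Union>n<m. A k n)" for k m
  have B: "B k m \<in> sets M" for k m using A(2) by (auto simp: B_def)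
  have restB: "?\<mu> (space M - B k m) = ?\<mu> (space M) - (\<Sum>n<m. ?\<mu> (A k n))" for k m
  proof -
    have "?\<mu> (B k m) = (\<Sum>n<m. ?\<mu> (A k n))" unfolding B_def
      by (rule finite_measure_finite_Union)
        (use A(2) disjoint_family_on_mono[OF subset_UNIV A(1)] in blast)+
    then show ?thesis using finite_measure_Diff[OF sets.top B sets.sets_into_space[OF B]] by simp
  qed
  have ex: "\<exists>m. (\<Sum>n. q (x k (n + m)) * ?\<mu> (A k (n + m))) \<le> e k \<and> ?\<mu> (space M - B k m) \<le> e k \<and>
      (\<forall>H\<in>sets M. H \<subseteq> space M - B k m \<longrightarrow> q (\<nu> H) \<le> e k)" for k
  proof -
    obtain d where d: "d > 0" "\<And>H. H \<in> sets M \<Longrightarrow> ?\<mu> H < d \<Longrightarrow> q (\<nu> H) < e k"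
      using absolutely_continuous e[of k] unfolding measure_continuous_def by metis
    obtain m1 where m1: "\<And>m. m \<ge> m1 \<Longrightarrow> norm (\<Sum>n. q (x k (n + m)) * ?\<mu> (A k (n + m))) < e k"
      using suminf_exist_split[OF e summ] by blast
    have "(\<lambda>m. ?\<mu> (space M - B k m)) \<longlonglongrightarrow> ?\<mu> (space M) - ?\<mu> (space M)"
      unfolding restB using sums\<mu>[of k] unfolding sums_def by (intro tendsto_diff tendsto_const)
    then have "\<forall>\<^sub>F m in sequentially. ?\<mu> (space M - B k m) < min (e k) d"
      using e[of k] d(1) by (intro order_tendstoD(2)) auto
    then obtain m2 where m2: "\<And>m. m \<ge> m2 \<Longrightarrow> ?\<mu> (space M - B k m) < min (e k) d"
      unfolding eventually_sequentially by blast
    let ?m = "max m1 m2"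
    have "q (\<nu> H) \<le> e k" if "H \<in> sets M" "H \<subseteq> space M - B k ?m" for H
    proof -
      have "?\<mu> H \<le> ?\<mu> (space M - B k ?m)" using that(2) B by (intro finite_measure_mono) auto
      then show ?thesis using m2[of ?m] d(2)[OF that(1)] by simp
    qed
    then show ?thesis using m1[of ?m] m2[of ?m] by (intro exI[of _ ?m]) auto
  qed
  from choice[OF allI[OF ex]] obtain m where
    "\<forall>k. (\<Sum>n. q (x k (n + m k)) * ?\<mu> (A k (n + m k))) \<le> e k \<and> ?\<mu> (space M - B k (m k)) \<le> e k \<and>
      (\<forall>H\<in>sets M. H \<subseteq> space M - B k (m k) \<longrightarrow> q (\<nu> H) \<le> e k)" ..
  then have m: "\<And>k. (\<Sum>n. q (x k (n + m k)) * ?\<mu> (A k (n + m k))) \<le> e k"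
    "\<And>k. ?\<mu> (space M - B k (m k)) \<le> e k"
    "\<And>k H. H \<in> sets M \<Longrightarrow> H \<subseteq> space M - B k (m k) \<Longrightarrow> q (\<nu> H) \<le> e k"
    by simp_all
  have e_summable: "summable e" unfolding e_def[abs_def] by (rule summable_geometric) simp
  \<comment> \<open>Almost every point is in the kept part for all large \<open>k\<close>, so
    cutting off does not disturb convergence almost everywhere.\<close>
  have bc: "AE \<omega> in M. \<forall>\<^sub>F k in sequentially. \<omega> \<in> space M - (space M - B k (m k))"
  proof (rule borel_cantelli_AE1)
    show "space M - B k (m k) \<in> sets M" for k using B by blast
    show "emeasure M (space M - B k (m k)) < \<infinity>" for k by (simp add: emeasure_eq_measure)
    show "summable (\<lambda>k. ?\<mu> (space M - B k (m k)))"
      by (rule summable_comparison_test'[OF e_summable]) (use m(2) in simp)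
  qed

  \<comment> \<open>\<open>h\<close> is prescribed only on \<open>space M\<close>, which covers both
    the density itself, with \<open>E = space M\<close>, and its restrictions to measurable
    sets.\<close>
  have main: "has_vector_integral sc q M h (\<nu> E)"
    if E: "E \<in> sets M" and h: "\<And>\<omega>. \<omega> \<in> space M \<Longrightarrow> h \<omega> = (if \<omega> \<in> E then g \<omega> else 0)" for E h
  proof -
    define s where "s k \<omega> = (if \<omega> \<in> E \<inter> B k (m k) then f k \<omega> else 0)" for k \<omega>
    \<comment> \<open>The last index \<open>m k\<close> carries the set where \<open>s k\<close> is
      set to zero, completing the pieces to a partition of the space.\<close>
    define P where "P k i = (if i < m k then E \<inter> A k i else space M - E \<inter> B k (m k))" for k i
    define c where "c k i = (if i < m k then x k i else 0)" for k i
    have part: "finite {..m k}" "\<And>i. i \<in> {..m k} \<Longrightarrow> P k i \<in> sets M" "disjoint_family_on (P k) {..m k}"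
      "(\<Union>i\<in>{..m k}. P k i) = space M" "\<And>i \<omega>. i \<in> {..m k} \<Longrightarrow> \<omega> \<in> P k i \<Longrightarrow> s k \<omega> = c k i" for k
    proof -
      show "P k i \<in> sets M" for i using E A(2) B by (auto simp: P_def)
      show "disjoint_family_on (P k) {..m k}"
        unfolding disjoint_family_on_def
      proof (intro ballI impI)
        fix i j assume ij: "i \<in> {..m k}" "j \<in> {..m k}" "i \<noteq> j"
        then show "P k i \<inter> P k j = {}"
          using A_disj[OF ij(3), of k] by (auto simp: P_def B_def)
      qed
      have "E \<subseteq> space M" "\<And>i. A k i \<subseteq> space M" using E A(2) sets.sets_into_space by blast+
      moreover have "{..m k} = insert (m k) {..<m k}" by auto
      ultimately show "(\<Union>i\<in>{..m k}. P k i) = space M" by (auto simp: P_def B_def)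
      show "s k \<omega> = c k i" if "i \<in> {..m k}" "\<omega> \<in> P k i" for i \<omega>
        using that f[of \<omega> k i] by (auto simp: s_def c_def P_def B_def split: if_splits)
    qed simp
    have simp_s: "simple_function M (s k)" for k by (rule simple_function_partition(1)[of "{..m k}" "P k" for k, OF part])
    have "strongly_measurable q M h"
      unfolding strongly_measurable_def
    proof (intro exI[of _ s] conjI allI simp_s)
      show "AE \<omega> in M. (\<lambda>k. q (h \<omega> - s k \<omega>)) \<longlonglongrightarrow> 0"
        using ae bc AE_space
      proof eventually_elim
        case (elim \<omega>)
        show ?case
        proof (rule tendsto_sandwich[OF _ _ tendsto_const])
          show "(\<lambda>k. 2 * e k) \<longlonglongrightarrow> 0"
            using summable_LIMSEQ_zero[OF e_summable] by (auto intro: tendsto_eq_intros)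
          show "\<forall>\<^sub>F k in sequentially. q (h \<omega> - s k \<omega>) \<le> 2 * e k"
            using elim(2)
          proof eventually_elim
            case (elim k)
            have "q (g \<omega> - f k \<omega>) \<le> 2 * e k"
              using \<open>\<forall>k. \<omega> \<in> (\<Union>n. A k n) \<and> q (f k \<omega> - g \<omega>) \<le> 2 * e k\<close> by (simp add: q_diff_commute)
            then show ?case using elim h[OF \<open>\<omega> \<in> space M\<close>] e[of k] by (auto simp: s_def)
          qed
        qed (simp add: q_nonneg)
      qed
    qed
    moreover have "(\<lambda>k. \<integral>\<^sup>+ \<omega>. ennreal (q (h \<omega> - s k \<omega>)) \<partial>M) \<longlonglongrightarrow> 0"
    proof (rule tendsto_sandwich[OF _ _ tendsto_const])
      \<comment> \<open>A measurable majorant, since the integrand need not be measurable: the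
        uniform error everywhere and, on the pieces cut off, the size of the lost value.\<close>
      define u where "u k \<omega> = ennreal (2 * e k) +
        (\<Sum>n. ennreal (q (x k (n + m k))) * indicator (A k (n + m k)) \<omega>)" for k \<omega>
      have le: "(\<integral>\<^sup>+ \<omega>. ennreal (q (h \<omega> - s k \<omega>)) \<partial>M) \<le> (\<integral>\<^sup>+ \<omega>. u k \<omega> \<partial>M)" for k
      proof (rule nn_integral_mono_AE)
        show "AE \<omega> in M. ennreal (q (h \<omega> - s k \<omega>)) \<le> u k \<omega>"
          using ae AE_space
        proof eventually_elim
          case (elim \<omega>)
          then obtain n where n: "\<omega> \<in> A k n" by blast
          have gf: "q (g \<omega> - f k \<omega>) \<le> 2 * e k" using elim by (simp add: q_diff_commute)
          show ?case
          proof (cases "\<omega> \<in> E \<and> n \<ge> m k")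
            case True
            define j where "j = n - m k"
            have j: "\<omega> \<in> A k (j + m k)" "f k \<omega> = x k (j + m k)"
              using n True f[OF n] by (auto simp: j_def)
            have "\<omega> \<notin> B k (m k)"
            proof
              assume "\<omega> \<in> B k (m k)"
              then obtain i where "i < m k" "\<omega> \<in> A k i" by (auto simp: B_def)
              then show False using A_disj[of n i k] n True by auto
            qed
            then have "q (h \<omega> - s k \<omega>) = q (g \<omega>)" using True h elim by (simp add: s_def)
            also have "\<dots> \<le> 2 * e k + q (x k (j + m k))"
              using norm_add[of "g \<omega> - f k \<omega>" "f k \<omega>"] gf j(2) by simp
            finally have "ennreal (q (h \<omega> - s k \<omega>)) \<le> ennreal (2 * e k) + ennreal (q (x k (j + m k)))"
              using e[of k] q_nonneg by (simp add: ennreal_leI flip: ennreal_plus)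
            also have "\<dots> \<le> u k \<omega>"
            proof -
              let ?t = "\<lambda>n. ennreal (q (x k (n + m k))) * indicator (A k (n + m k)) \<omega>"
              have "t j \<le> (\<Sum>n. t n)" for t :: "nat \<Rightarrow> ennreal"
                using sum_le_suminf[of t "{j}"] by simp
              from this[of ?t] show ?thesis unfolding u_def using j(1) by (intro add_left_mono) simp
            qed
            finally show ?thesis .
          next
            case False
            then have "\<omega> \<in> E \<Longrightarrow> \<omega> \<in> B k (m k)" using n by (auto simp: B_def)
            then have "q (h \<omega> - s k \<omega>) \<le> 2 * e k"
              using gf h elim e[of k] by (auto simp: s_def)
            then have "ennreal (q (h \<omega> - s k \<omega>)) \<le> ennreal (2 * e k)" by (rule ennreal_leI)
            also have "\<dots> \<le> u k \<omega>" unfolding u_def by simp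
            finally show ?thesis .
          qed
        qed
      qed
      have u: "(\<integral>\<^sup>+ \<omega>. u k \<omega> \<partial>M) \<le> ennreal (2 * e k * ?\<mu> (space M) + e k)" for k
      proof -
        have "(\<integral>\<^sup>+ \<omega>. u k \<omega> \<partial>M) = (\<integral>\<^sup>+ \<omega>. ennreal (2 * e k) \<partial>M) +
            (\<integral>\<^sup>+ \<omega>. (\<Sum>n. ennreal (q (x k (n + m k))) * indicator (A k (n + m k)) \<omega>) \<partial>M)"
          unfolding u_def using A(2) by (intro nn_integral_add) auto
        also have "(\<integral>\<^sup>+ \<omega>. (\<Sum>n. ennreal (q (x k (n + m k))) * indicator (A k (n + m k)) \<omega>) \<partial>M)
            = (\<Sum>n. \<integral>\<^sup>+ \<omega>. ennreal (q (x k (n + m k))) * indicator (A k (n + m k)) \<omega> \<partial>M)"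
          using A(2) by (intro nn_integral_suminf) auto
        also have "\<dots> = (\<Sum>n. ennreal (q (x k (n + m k)) * ?\<mu> (A k (n + m k))))"
          using A(2) by (simp add: nn_integral_cmult_indicator emeasure_eq_measure q_nonneg ennreal_mult)
        also have "\<dots> = ennreal (\<Sum>n. q (x k (n + m k)) * ?\<mu> (A k (n + m k)))"
          by (rule suminf_ennreal2) (auto simp: q_nonneg summable_iff_shift[of "\<lambda>n. q (x k n) * ?\<mu> (A k n)"] summ)
        also have "\<dots> \<le> ennreal (e k)" using m(1) by (rule ennreal_leI)
        also have "(\<integral>\<^sup>+ \<omega>. ennreal (2 * e k) \<partial>M) = ennreal (2 * e k * ?\<mu> (space M))"
          using e[of k] by (simp add: emeasure_eq_measure ennreal_mult)
        finally show ?thesis using e[of k] by (simp add: ennreal_plus add_left_mono)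
      qed
      show "\<forall>\<^sub>F k in sequentially. (\<integral>\<^sup>+ \<omega>. ennreal (q (h \<omega> - s k \<omega>)) \<partial>M)
          \<le> ennreal (2 * e k * ?\<mu> (space M) + e k)"
        using order_trans[OF le u] by simp
      have "(\<lambda>k. 2 * e k * ?\<mu> (space M) + e k) \<longlonglongrightarrow> 0"
        using summable_LIMSEQ_zero[OF e_summable] by (auto intro!: tendsto_eq_intros)
      then show "(\<lambda>k. ennreal (2 * e k * ?\<mu> (space M) + e k)) \<longlonglongrightarrow> 0"
        using tendsto_ennrealI by fastforce
    qed simp
    moreover have "(\<lambda>k. q (simple_vector_integral sc M (s k) - \<nu> E)) \<longlonglongrightarrow> 0"
    proof (rule q_tendsto_0I)
      show "q (simple_vector_integral sc M (s k) - \<nu> E) \<le> e k * ?\<mu> (space M) + e k" for k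
      proof -
        have "simple_vector_integral sc M (s k) = (\<Sum>i\<in>{..m k}. sc (?\<mu> (P k i)) (c k i))"
          by (rule simple_vector_integral_partition[of "{..m k}" "P k" "s k" "c k", OF part])
        also have "\<dots> = (\<Sum>i<m k. sc (?\<mu> (E \<inter> A k i)) (x k i))"
          by (simp add: P_def c_def flip: lessThan_Suc_atMost)
        finally have S: "simple_vector_integral sc M (s k) = \<dots>" .
        have dis: "disjoint_family_on (\<lambda>i. E \<inter> A k i) {..<m k}"
          using A_disj[of _ _ k] unfolding disjoint_family_on_def by blast
        have "\<nu> E = \<nu> (E \<inter> B k (m k)) + \<nu> (E - B k (m k))"
        proof -
          have "E \<inter> B k (m k) \<inter> (E - B k (m k)) = {}" by blast
          then show ?thesis
            using nu_Un[of "E \<inter> B k (m k)" "E - B k (m k)"] E B by (simp add: Int_Diff_Un)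
        qed
        also have "E \<inter> B k (m k) = (\<Union>i<m k. E \<inter> A k i)" by (auto simp: B_def)
        also have "\<nu> \<dots> = (\<Sum>i<m k. \<nu> (E \<inter> A k i))"
          using E A(2) dis by (intro nu_finite_Union) auto
        finally have "q (simple_vector_integral sc M (s k) - \<nu> E)
            = q ((\<Sum>i<m k. sc (?\<mu> (E \<inter> A k i)) (x k i) - \<nu> (E \<inter> A k i)) - \<nu> (E - B k (m k)))"
          unfolding S by (simp add: sum_subtractf algebra_simps)
        also have "\<dots> \<le> (\<Sum>i<m k. q (sc (?\<mu> (E \<inter> A k i)) (x k i) - \<nu> (E \<inter> A k i))) + q (\<nu> (E - B k (m k)))"
          by (rule order_trans[OF norm_diff add_right_mono[OF norm_sum]])
        also have "\<dots> \<le> (\<Sum>i<m k. e k * ?\<mu> (E \<inter> A k i)) + e k"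
        proof (intro add_mono sum_mono)
          fix i
          show "q (sc (?\<mu> (E \<inter> A k i)) (x k i) - \<nu> (E \<inter> A k i)) \<le> e k * ?\<mu> (E \<inter> A k i)"
            using A(4)[of k i] E A(2) unfolding good_def by (subst q_diff_commute) auto
          show "q (\<nu> (E - B k (m k))) \<le> e k" using E B sets.sets_into_space[OF E] by (intro m(3)) auto
        qed
        also have "(\<Sum>i<m k. e k * ?\<mu> (E \<inter> A k i)) = e k * ?\<mu> (\<Union>i<m k. E \<inter> A k i)"
          unfolding sum_distrib_left[symmetric] using E A(2) dis
          by (subst finite_measure_finite_Union) auto
        also have "\<dots> \<le> e k * ?\<mu> (space M)"
          using e[of k] bounded_measure by (intro mult_left_mono) auto
        finally show "q (simple_vector_integral sc M (s k) - \<nu> E) \<le> e k * ?\<mu> (space M) + e k" by simp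
      qed
      show "(\<lambda>k. e k * ?\<mu> (space M) + e k) \<longlonglongrightarrow> 0"
        using summable_LIMSEQ_zero[OF e_summable] by (auto intro!: tendsto_eq_intros)
    qed
    ultimately show ?thesis unfolding has_vector_integral_def using simp_s by blast
  qed
  have "has_density sc q M \<nu> g"
    unfolding has_density_def vector_integrable_def
  proof (intro conjI ballI exI)
    show "has_vector_integral sc q M g (\<nu> (space M))" by (rule main) auto
  qed (rule main, auto)
  then show ?thesis by (intro exI[of _ g])
qed

end

section \<open>Lebesgue differentiation and transport of measure spaces\<close>

definition averages_below :: "real measure \<Rightarrow> real \<Rightarrow> real \<Rightarrow> bool" where
  "averages_below N s c \<longleftrightarrow>
    (\<exists>d>0. \<forall>u v. u \<le> s \<and> s \<le> v \<and> u < v \<and> v - u < d \<longrightarrow> emeasure N {u..v} \<le> ennreal (c * (v - u)))"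

lemma averages_below_mono:
  assumes "averages_below N s b" "b \<le> c"
  shows "averages_below N s c"
proof -
  have "ennreal (b * (v - u)) \<le> ennreal (c * (v - u))" if "u < v" for u v :: real
    using assms(2) that by (intro ennreal_leI mult_right_mono) auto
  with assms(1) show ?thesis unfolding averages_below_def by (meson order_trans)
qed

text \<open>Vitali covering: the bad points lie in \<open>H\<close>, the set where \<open>g\<close>
  is below \<open>a\<close>, and an open superset \<open>U\<close> of \<open>H\<close> has nearly
  the same \<open>N\<close>-measure. Disjoint intervals in \<open>U\<close> with
  \<open>N\<close>-average above \<open>b\<close> cover almost all bad points. Their union
  \<open>T\<close> has \<open>N\<close>-measure at least \<open>b\<close> times its length, but at
  most \<open>a\<close> times its length plus \<open>\<epsilon>\<close>.\<close>

lemma negligible_large_averages: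
  fixes g :: "real \<Rightarrow> real"
  defines "N \<equiv> density lborel (\<lambda>x. ennreal (g x))"
  assumes g [measurable]: "g \<in> borel_measurable borel" and fin: "emeasure N UNIV < \<infinity>"
    and ab: "0 < a" "a < b"
  shows "negligible {s. g s < a \<and> \<not> averages_below N s b}" (is "negligible ?S")
proof -
  have setsN [measurable_cong]: "sets N = sets borel" by (simp add: N_def)
  interpret N: finite_measure N
    using fin by (intro finite_measureI) (simp add: N_def)
  define H where "H = {s. g s < a}"
  have H [measurable]: "H \<in> sets borel" unfolding H_def by measurable
  have "\<exists>T. ?S \<subseteq> T \<and> T \<in> lmeasurable \<and> measure lebesgue T \<le> e" if "e > 0" for e
  proof -
    \<comment> \<open>Chosen so that a bound \<open>\<epsilon>\<close> for
      \<open>(b - a) * measure lborel T\<close> bounds the length of \<open>T\<close> by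
      \<open>e\<close>.\<close>
    define \<epsilon> where "\<epsilon> = e * (b - a)"
    have \<epsilon>: "\<epsilon> > 0" using that ab by (simp add: \<epsilon>_def)
    have "emeasure N H = (INF U\<in>{U. H \<subseteq> U \<and> open U}. emeasure N U)"
      by (rule outer_regular) (use fin in \<open>auto simp: N_def\<close>)
    moreover have "emeasure N H < emeasure N H + ennreal \<epsilon>"
      using \<epsilon> by (simp add: N.emeasure_eq_measure ennreal_less_iff flip: ennreal_plus)
    ultimately have "\<exists>U\<in>{U. H \<subseteq> U \<and> open U}. emeasure N U < emeasure N H + ennreal \<epsilon>"
      unfolding INF_less_iff[symmetric] by simp
    then obtain U where U: "H \<subseteq> U" "open U" "emeasure N U < emeasure N H + ennreal \<epsilon>" by blast
    have [measurable]: "U \<in> sets borel" using U(2) by auto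
    have UH: "measure N (U - H) \<le> \<epsilon>"
      using U(3) N.finite_measure_Diff[of U H] U(1) \<epsilon>
      by (simp add: N.emeasure_eq_measure setsN ennreal_less_iff flip: ennreal_plus)
    \<comment> \<open>Intervals are coded by their end points; the covering theorem speaks of balls,
      whence the midpoints and radii.\<close>
    define K where "K = {(u, v). u < v \<and> {u..v} \<subseteq> U \<and> ennreal (b * (v - u)) < emeasure N {u..v}}"
    let ?c = "\<lambda>(u, v). (u + v) / 2 :: real" and ?r = "\<lambda>(u, v). (v - u) / 2 :: real"
    have cball: "cball (?c p) (?r p) = {fst p..snd p}" for p
      by (cases p) (simp add: cball_eq_atLeastAtMost field_simps)
    obtain C where C: "countable C" "C \<subseteq> K"
      "pairwise (\<lambda>i j. disjnt (cball (?c i) (?r i)) (cball (?c j) (?r j))) C"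
      "negligible (?S - (\<Union>i\<in>C. cball (?c i) (?r i)))"
    proof (rule Vitali_covering_theorem_cballs)
      show "0 < ?r i" if "i \<in> K" for i using that by (auto simp: K_def)
    next
      fix x d :: real assume x: "x \<in> ?S" and "d > 0"
      then have "x \<in> U" using U(1) by (auto simp: H_def)
      then obtain \<rho> where \<rho>: "\<rho> > 0" "ball x \<rho> \<subseteq> U" using U(2) openE by blast
      have "\<exists>u v. u \<le> x \<and> x \<le> v \<and> u < v \<and> v - u < d' \<and> ennreal (b * (v - u)) < emeasure N {u..v}"
        if "d' > 0" for d'
        using x that unfolding averages_below_def by (auto simp: not_le)
      moreover have "min d \<rho> > 0" using \<open>d > 0\<close> \<rho>(1) by simp
      ultimately obtain u v where uv: "u \<le> x" "x \<le> v" "u < v" "v - u < min d \<rho>"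
        "ennreal (b * (v - u)) < emeasure N {u..v}"
        by blast
      have "{u..v} \<subseteq> ball x \<rho>" using uv by (auto simp: dist_real_def)
      then have "(u, v) \<in> K" using uv \<rho>(2) by (auto simp: K_def)
      moreover have "x \<in> cball (?c (u, v)) (?r (u, v))" unfolding cball using uv by simp
      ultimately show "\<exists>i. i \<in> K \<and> x \<in> cball (?c i) (?r i) \<and> ?r i < d"
        using uv by (intro exI[of _ "(u, v)"]) auto
    qed
    define I where "I p = {fst p..snd p :: real}" for p
    have I: "disjoint_family_on I C" "negligible (?S - (\<Union>i\<in>C. I i))"
      using C(3,4) unfolding cball I_def by (auto simp: disjoint_family_on_def pairwise_def disjnt_def)
    define T where "T = (\<Union>i\<in>C. I i)"
    have [measurable]: "I p \<in> sets borel" for p by (simp add: I_def)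
    have T [measurable]: "T \<in> sets borel" unfolding T_def using C(1) by (intro sets.countable_UN') auto
    have "ennreal b * emeasure lborel T = (\<integral>\<^sup>+i. ennreal b * emeasure lborel (I i) \<partial>count_space C)"
      unfolding T_def using C(1) I(1)
      by (subst emeasure_UN_countable) (auto simp: nn_integral_cmult)
    also have "\<dots> \<le> (\<integral>\<^sup>+i. emeasure N (I i) \<partial>count_space C)"
    proof (rule nn_integral_mono)
      fix i assume "i \<in> space (count_space C)"
      then have "i \<in> K" using C(2) by auto
      then show "ennreal b * emeasure lborel (I i) \<le> emeasure N (I i)"
        using ab by (auto simp: K_def I_def ennreal_mult dest: less_imp_le)
    qed
    also have "\<dots> = emeasure N T"
      unfolding T_def using C(1) I(1) by (subst emeasure_UN_countable) (auto simp: setsN)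
    finally have bT: "ennreal b * emeasure lborel T \<le> emeasure N T" .
    also have "emeasure N T < \<infinity>" by (simp add: N.emeasure_eq_measure)
    finally have "ennreal b * emeasure lborel T < \<infinity>" .
    then have finT: "emeasure lborel T < \<infinity>" using ab by (auto simp: ennreal_mult_less_top)
    have mT: "emeasure lborel T = ennreal (measure lborel T)"
      using finT by (simp add: emeasure_eq_ennreal_measure)
    have "T \<subseteq> U" unfolding T_def I_def using C(2) by (fastforce simp: K_def)
    have "emeasure N (T \<inter> H) \<le> (\<integral>\<^sup>+x. ennreal a * indicator T x \<partial>lborel)"
      unfolding N_def by (subst emeasure_density) (auto simp: H_def indicator_def intro!: nn_integral_mono ennreal_leI)
    then have TH: "measure N (T \<inter> H) \<le> a * measure lborel T"
      using ab by (simp add: nn_integral_cmult_indicator mT N.emeasure_eq_measure flip: ennreal_mult)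
    have "b * measure lborel T \<le> measure N T"
      using bT ab by (simp add: mT N.emeasure_eq_measure flip: ennreal_mult)
    also have "\<dots> \<le> measure N (T \<inter> H) + measure N (U - H)"
    proof -
      have "measure N T \<le> measure N ((T \<inter> H) \<union> (U - H))"
        using \<open>T \<subseteq> U\<close> by (intro N.finite_measure_mono) (auto simp: setsN)
      also have "\<dots> = measure N (T \<inter> H) + measure N (U - H)"
        by (rule N.finite_measure_Union) (auto simp: setsN)
      finally show ?thesis .
    qed
    also have "\<dots> \<le> a * measure lborel T + \<epsilon>" using TH UH by (rule add_mono)
    finally have "(b - a) * measure lborel T \<le> (b - a) * e" by (simp add: \<epsilon>_def algebra_simps)
    then have Te: "measure lborel T \<le> e" using ab by simp
    have TL: "T \<in> lmeasurable" "measure lebesgue T = measure lborel T"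
      using finT by (auto simp: fmeasurable_def)
    let ?Z = "?S - T"
    have Z: "negligible ?Z" using I(2) by (simp add: T_def)
    have "measure lebesgue (T \<union> ?Z) = measure lebesgue T"
      using Z by (intro measure_negligible_symdiff[OF TL(1)]) (auto intro: negligible_subset)
    moreover have "T \<union> ?Z \<in> lmeasurable"
      using TL(1) negligible_imp_measurable[OF Z] by (rule fmeasurable.Un)
    moreover have "?S \<subseteq> T \<union> ?Z" by blast
    ultimately show ?thesis using TL(2) Te by (intro exI[of _ "T \<union> ?Z"] conjI) simp_all
  qed
  then show ?thesis unfolding negligible_outer_le by blast
qed

text \<open>A failure for some \<open>c > g s\<close> is already a failure for rational
  \<open>a < b\<close> with \<open>g s < a\<close> and \<open>b < c\<close>, so only countably many
  negligible sets arise.\<close>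

lemma averages_eventually_le:
  fixes g :: "real \<Rightarrow> real"
  defines "N \<equiv> density lborel (\<lambda>x. ennreal (g x))"
  assumes g: "g \<in> borel_measurable borel" and fin: "emeasure N UNIV < \<infinity>" and nonneg: "\<And>x. 0 \<le> g x"
  shows "AE s in lebesgue. \<forall>c>g s. averages_below N s c"
proof -
  let ?B = "\<lambda>p. {s. g s < fst p \<and> \<not> averages_below N s (snd p)}"
  let ?P = "{p :: real \<times> real. fst p \<in> \<rat> \<and> snd p \<in> \<rat> \<and> 0 < fst p \<and> fst p < snd p}"
  have "countable ?P"
    by (rule countable_subset[of _ "\<rat> \<times> \<rat>"]) (auto simp: countable_rat)
  then have neg: "negligible (\<Union>p\<in>?P. ?B p)"
    using negligible_large_averages[OF g] fin unfolding N_def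
    by (intro negligible_countable_Union) auto
  have "s \<in> (\<Union>p\<in>?P. ?B p)" if c: "g s < c" "\<not> averages_below N s c" for s c
  proof -
    obtain a where a: "a \<in> \<rat>" "g s < a" "a < c" using Rats_dense_in_real[OF c(1)] by blast
    obtain b where b: "b \<in> \<rat>" "a < b" "b < c" using Rats_dense_in_real[OF a(3)] by blast
    have "\<not> averages_below N s b" using c(2) b(3) averages_below_mono by fastforce
    moreover have "(a, b) \<in> ?P" using a b nonneg[of s] by auto
    ultimately show ?thesis using a(2) by (intro UN_I[of "(a, b)"]) auto
  qed
  then show ?thesis
    by (intro AE_I'[where N = "\<Union>p\<in>?P. ?B p"]) (use neg negligible_iff_null_sets in blast)+
qed

context normed_finite_measure
begin

text \<open>Domination upgrades finite to countable additivity: the part of the union not yet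
  reached has small measure, hence a small value.\<close>

lemma vector_measure_if_dominated:
  assumes add: "\<And>A B. A \<in> sets M \<Longrightarrow> B \<in> sets M \<Longrightarrow> A \<inter> B = {} \<Longrightarrow> \<nu> (A \<union> B) = \<nu> A + \<nu> B"
    and le: "\<And>E. E \<in> sets M \<Longrightarrow> q (\<nu> E) \<le> L * measure M E" and "L \<ge> 0"
  shows "vector_measure q M \<nu>" "measure_continuous q M \<nu>" "bounded_variation q M \<nu>"
proof -
  show "vector_measure q M \<nu>"
    unfolding vector_measure_def
  proof (intro allI impI)
    fix A :: "nat \<Rightarrow> 'w set" assume A: "range A \<subseteq> sets M" "disjoint_family A"
    have Am: "A i \<in> sets M" for i using A(1) by blast
    have empty: "\<nu> {} = 0" using add[of "{}" "{}"] by simp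
    have sum: "\<nu> (\<Union>i<n. A i) = (\<Sum>i<n. \<nu> (A i))" for n
    proof (induction n)
      case (Suc n)
      have "A n \<inter> A i = {}" if "i < n" for i
        using A(2)[unfolded disjoint_family_on_def, rule_format, of n i] that by simp
      then have "A n \<inter> (\<Union>i<n. A i) = {}" by blast
      then have "\<nu> (A n \<union> (\<Union>i<n. A i)) = \<nu> (A n) + \<nu> (\<Union>i<n. A i)" using Am by (intro add) auto
      then show ?case using Suc by (simp add: lessThan_Suc add.commute)
    qed (simp add: empty)
    let ?U = "\<Union>i. A i"
    have U: "?U \<in> sets M" using Am by auto
    show "(\<lambda>n. q ((\<Sum>i<n. \<nu> (A i)) - \<nu> ?U)) \<longlonglongrightarrow> 0"
    proof (rule q_tendsto_0I)
      have "(\<lambda>n. L * (measure M ?U - (\<Sum>i<n. measure M (A i)))) \<longlonglongrightarrow> L * (measure M ?U - measure M ?U)"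
        using finite_measure_UNION[OF A] unfolding sums_def by (intro tendsto_intros)
      then show "(\<lambda>n. L * (measure M ?U - (\<Sum>i<n. measure M (A i)))) \<longlonglongrightarrow> 0" by simp
      show "q ((\<Sum>i<n. \<nu> (A i)) - \<nu> ?U) \<le> L * (measure M ?U - (\<Sum>i<n. measure M (A i)))" for n
      proof -
        let ?V = "\<Union>i<n. A i"
        have V: "?V \<in> sets M" "?V \<subseteq> ?U" using Am by auto
        have "\<nu> (?V \<union> (?U - ?V)) = \<nu> ?V + \<nu> (?U - ?V)" using U V(1) by (intro add) auto
        moreover have "?V \<union> (?U - ?V) = ?U" by blast
        ultimately have "(\<Sum>i<n. \<nu> (A i)) - \<nu> ?U = - \<nu> (?U - ?V)" by (simp add: sum)
        then have "q ((\<Sum>i<n. \<nu> (A i)) - \<nu> ?U) \<le> L * measure M (?U - ?V)" using le U V(1) by simp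
        also have "measure M (?U - ?V) = measure M ?U - measure M ?V" using U V by (rule finite_measure_Diff)
        also have "measure M ?V = (\<Sum>i<n. measure M (A i))"
          using Am disjoint_family_on_mono[OF subset_UNIV A(2)] by (intro finite_measure_finite_Union) auto
        finally show ?thesis .
      qed
    qed
  qed
  show "measure_continuous q M \<nu>"
    unfolding measure_continuous_def
  proof (intro allI impI)
    fix e :: real assume "e > 0"
    \<comment> \<open>\<open>L + 1\<close> instead of \<open>L\<close>, since \<open>L\<close> may
      be zero.\<close>
    have "q (\<nu> E) < e" if "E \<in> sets M" "measure M E < e / (L + 1)" for E
    proof -
      have "q (\<nu> E) \<le> (L + 1) * measure M E" using le[OF that(1)] by (simp add: distrib_right add_increasing2)
      also have "\<dots> < e" using that(2) \<open>L \<ge> 0\<close> by (simp add: pos_less_divide_eq mult.commute)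
      finally show ?thesis .
    qed
    then show "\<exists>d>0. \<forall>E\<in>sets M. measure M E < d \<longrightarrow> q (\<nu> E) < e"
      using \<open>e > 0\<close> \<open>L \<ge> 0\<close> by (intro exI[of _ "e / (L + 1)"]) auto
  qed
  show "bounded_variation q M \<nu>"
    unfolding bounded_variation_def
  proof (intro exI allI impI)
    fix P assume P: "finite P" "P \<subseteq> sets M" "disjoint P"
    have "(\<Sum>E\<in>P. q (\<nu> E)) \<le> (\<Sum>E\<in>P. L * measure M E)" using le P(2) by (intro sum_mono) auto
    also have "\<dots> = L * measure M (\<Union>E\<in>P. E)"
      unfolding sum_distrib_left[symmetric] using P
      by (subst finite_measure_finite_Union) (auto simp: disjoint_family_on_def disjoint_def)
    also have "\<dots> \<le> L * measure M (space M)" using \<open>L \<ge> 0\<close> bounded_measure by (intro mult_left_mono) auto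
    finally show "(\<Sum>E\<in>P. q (\<nu> E)) \<le> L * measure M (space M)" .
  qed
qed

end

context real_normed
begin

text \<open>Strong measurability makes the pointwise distances measurable up to a null set, so that the
  lower integrals in \<^const>\<open>has_vector_integral\<close> behave additively.\<close>

lemma distance_AE_measurable:
  assumes "strongly_measurable q M f" "simple_function M s"
  shows "\<exists>u\<in>borel_measurable M. (\<forall>x. 0 \<le> u x) \<and> (AE x in M. q (f x - s x) = (u x :: real))"
proof -
  obtain r where r: "\<And>n. simple_function M (r n)" "AE x in M. (\<lambda>n. q (f x - r n x)) \<longlonglongrightarrow> 0"
    using assms(1) unfolding strongly_measurable_def by blast
  define w where "w n x = q (r n x - s x)" for n x
  have w [measurable]: "w n \<in> borel_measurable M" for n
  proof (rule borel_measurable_simple_function)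
    have "simple_function M ((\<lambda>(a, b). q (a - b)) \<circ> (\<lambda>x. (r n x, s x)))"
      using r(1)[of n] assms(2) by (intro simple_function_compose simple_function_Pair)
    then show "simple_function M (w n)" by (simp add: w_def[abs_def] comp_def)
  qed
  define u where "u x = max 0 (lim (\<lambda>n. w n x))" for x
  have [measurable]: "u \<in> borel_measurable M" unfolding u_def[abs_def] by measurable
  have "0 \<le> u x" for x by (simp add: u_def)
  moreover have "AE x in M. q (f x - s x) = u x"
    using r(2)
  proof eventually_elim
    case (elim x)
    have "(\<lambda>n. w n x) \<longlonglongrightarrow> q (f x - s x)"
    proof (rule LIM_zero_cancel, rule Lim_null_comparison)
      have "norm (w n x - q (f x - s x)) \<le> q (f x - r n x)" for n
        using norm_add[of "r n x - f x" "f x - s x"] norm_add[of "f x - r n x" "r n x - s x"]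
        by (simp add: w_def q_diff_commute)
      then show "\<forall>\<^sub>F n in sequentially. norm (w n x - q (f x - s x)) \<le> q (f x - r n x)" by simp
    qed (rule elim)
    then show ?case by (simp add: u_def limI q_nonneg)
  qed
  ultimately show ?thesis by (intro bexI[of _ u]) auto
qed

end

section \<open>Transport of measure spaces along an injective map\<close>

context
  fixes g :: "'v \<Rightarrow> 'w"
  assumes g: "inj g"
begin

lemma embed_measure_vimage: "E \<in> sets (embed_measure M g) \<Longrightarrow> g -` E \<in> sets M"
  using g by (auto simp: sets_embed_measure inj_vimage_image_eq)

lemma measure_embed_vimage:
  assumes "E \<in> sets (embed_measure M g)"
  shows "measure (embed_measure M g) E = measure M (g -` E)"
proof -
  have "g -` E \<inter> space M = g -` E" using embed_measure_vimage[OF assms] sets.sets_into_space by blast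
  then show ?thesis using emeasure_embed_measure[OF g assms] by (simp add: measure_def)
qed

lemma simple_function_embed:
  assumes "simple_function (embed_measure M g) s"
  shows "simple_function M (s \<circ> g)"
    "simple_vector_integral smul M (s \<circ> g) = simple_vector_integral smul (embed_measure M g) s"
proof -
  have im: "(s \<circ> g) ` space M = s ` space (embed_measure M g)" by (simp add: space_embed_measure image_comp)
  have vim: "(s \<circ> g) -` {y} \<inter> space M = g -` (s -` {y} \<inter> space (embed_measure M g))" for y
    using g by (auto simp: space_embed_measure dest: injD)
  have S: "s -` {y} \<inter> space (embed_measure M g) \<in> sets (embed_measure M g)" for y
    using assms by (rule simple_functionD)
  show "simple_function M (s \<circ> g)"
    using assms embed_measure_vimage[OF S] unfolding simple_function_def im vim by blast
  show "simple_vector_integral smul M (s \<circ> g) = simple_vector_integral smul (embed_measure M g) s"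
    unfolding simple_vector_integral_def im vim measure_embed_vimage[OF S] ..
qed

lemma has_vector_integral_embed:
  assumes "real_normed (\<lambda>r. smul (of_real r)) q"
    and "has_vector_integral smul q (embed_measure M g) f I"
  shows "has_vector_integral smul q M (f \<circ> g) I"
proof -
  interpret real_normed "\<lambda>r. smul (of_real r)" q by fact
  let ?M = "embed_measure M g"
  obtain s where sm: "strongly_measurable q ?M f" and s: "\<And>n. simple_function ?M (s n)"
    "(\<lambda>n. \<integral>\<^sup>+ x. ennreal (q (f x - s n x)) \<partial>?M) \<longlonglongrightarrow> 0"
    "(\<lambda>n. q (simple_vector_integral smul ?M (s n) - I)) \<longlonglongrightarrow> 0"
    using assms(2) unfolding has_vector_integral_def by blast
  have "strongly_measurable q M (f \<circ> g)"
  proof -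
    obtain r where "\<And>n. simple_function ?M (r n)" "AE x in ?M. (\<lambda>n. q (f x - r n x)) \<longlonglongrightarrow> 0"
      using sm unfolding strongly_measurable_def by blast
    then show ?thesis
      unfolding strongly_measurable_def AE_embed_measure[OF g]
      by (intro exI[of _ "\<lambda>n. r n \<circ> g"]) (simp add: simple_function_embed)
  qed
  moreover have "(\<integral>\<^sup>+ x. ennreal (q ((f \<circ> g) x - (s n \<circ> g) x)) \<partial>M)
      = (\<integral>\<^sup>+ x. ennreal (q (f x - s n x)) \<partial>?M)" for n
  proof -
    \<comment> \<open>The change of variables is applied to a measurable function, so the distance
      is replaced by its measurable version and back.\<close>
    obtain u where u: "u \<in> borel_measurable ?M" "AE x in ?M. q (f x - s n x) = u x"
      using distance_AE_measurable[OF sm s(1)] by blast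
    have "(\<integral>\<^sup>+ x. ennreal (q (f x - s n x)) \<partial>?M) = (\<integral>\<^sup>+ x. ennreal (u x) \<partial>?M)"
      using u(2) by (intro nn_integral_cong_AE) (auto elim: eventually_mono)
    also have "\<dots> = (\<integral>\<^sup>+ x. ennreal (u (g x)) \<partial>M)"
      using g u(1) by (intro nn_integral_embed_measure) auto
    also have "\<dots> = (\<integral>\<^sup>+ x. ennreal (q ((f \<circ> g) x - (s n \<circ> g) x)) \<partial>M)"
      using u(2) unfolding AE_embed_measure[OF g]
      by (intro nn_integral_cong_AE) (auto elim: eventually_mono)
    finally show ?thesis ..
  qed
  ultimately show ?thesis
    unfolding has_vector_integral_def using s(2,3)
    by (intro conjI exI[of _ "\<lambda>n. s n \<circ> g"]) (simp_all add: simple_function_embed[OF s(1)])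
qed

text \<open>A measure space on \<open>'v\<close> is copied onto the image of \<open>g\<close>, and a
  density found there is pulled back by composition with \<open>g\<close>. This leads from the point
  type of the theorem to the reals.\<close>

lemma radon_nikodym_property_inj:
  assumes "real_normed (\<lambda>r. smul (of_real r)) q"
    and RNP: "radon_nikodym_property TYPE('w) smul q"
  shows "radon_nikodym_property TYPE('v) smul q"
  unfolding radon_nikodym_property_def
proof (intro allI impI)
  fix M :: "'v measure" and \<nu>
  assume fin: "finite_measure M" and vm: "vector_measure q M \<nu>"
    and mc: "measure_continuous q M \<nu>" and bv: "bounded_variation q M \<nu>"
  let ?M = "embed_measure M g" and ?\<nu> = "\<lambda>E. \<nu> (g -` E)"
  note vim = embed_measure_vimage[of _ M]
  interpret M: finite_measure M by fact
  have "finite_measure ?M"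
  proof (rule finite_measureI)
    show "emeasure ?M (space ?M) \<noteq> \<infinity>" using emeasure_embed_measure[OF g sets.top, of M] by simp
  qed
  moreover have "vector_measure q ?M ?\<nu>"
    unfolding vector_measure_def
  proof (intro allI impI)
    fix A :: "nat \<Rightarrow> _" assume A: "range A \<subseteq> sets ?M" "disjoint_family A"
    have "range (\<lambda>i. g -` A i) \<subseteq> sets M" using A(1) vim by auto
    moreover have "disjoint_family (\<lambda>i. g -` A i)"
      using A(2) unfolding disjoint_family_on_def vimage_Int[symmetric] by simp
    ultimately have "(\<lambda>n. q ((\<Sum>i<n. \<nu> (g -` A i)) - \<nu> (\<Union>i. g -` A i))) \<longlonglongrightarrow> 0"
      using vm unfolding vector_measure_def by blast
    then show "(\<lambda>n. q ((\<Sum>i<n. \<nu> (g -` A i)) - \<nu> (g -` (\<Union>i. A i)))) \<longlonglongrightarrow> 0"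
      by (simp add: vimage_UN)
  qed
  moreover have "measure_continuous q ?M ?\<nu>"
    using mc vim unfolding measure_continuous_def by (metis measure_embed_vimage)
  moreover have "bounded_variation q ?M ?\<nu>"
  proof -
    obtain C where C: "\<And>P. finite P \<Longrightarrow> P \<subseteq> sets M \<Longrightarrow> disjoint P \<Longrightarrow> \<Union>P = space M \<Longrightarrow> (\<Sum>E\<in>P. q (\<nu> E)) \<le> C"
      using bv unfolding bounded_variation_def by blast
    have "(\<Sum>E\<in>P. q (?\<nu> E)) \<le> C" if P: "finite P" "P \<subseteq> sets ?M" "disjoint P" "\<Union>P = space ?M" for P
    proof -
      \<comment> \<open>Measurable sets of the copied space lie in \<open>range g\<close>, so they
        are determined by their preimages and no summand is lost in reindexing.\<close>
      have inj: "inj_on ((-`) g) P"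
      proof (rule inj_onI)
        fix A B assume AB: "A \<in> P" "B \<in> P" "g -` A = g -` B"
        have "A \<subseteq> range g" "B \<subseteq> range g" using AB P(2) g by (auto simp: sets_embed_measure)
        then have "A = g ` (g -` A)" "B = g ` (g -` B)" by auto
        then show "A = B" using AB(3) by simp
      qed
      have "(\<Sum>E\<in>P. q (?\<nu> E)) = (\<Sum>E\<in>(-`) g ` P. q (\<nu> E))"
        using inj by (simp add: sum.reindex)
      also have "\<dots> \<le> C"
      proof (rule C)
        show "(-`) g ` P \<subseteq> sets M" using P(2) vim by auto
        show "disjoint ((-`) g ` P)"
          using P(3) unfolding disjoint_def by (auto simp flip: vimage_Int)
        have "\<Union>((-`) g ` P) = g -` (\<Union>P)" by auto
        then show "\<Union>((-`) g ` P) = space M" using g by (simp add: P(4) space_embed_measure inj_vimage_image_eq)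
      qed (use P in simp)
      finally show ?thesis .
    qed
    then show ?thesis unfolding bounded_variation_def by blast
  qed
  ultimately obtain f where f: "has_density smul q ?M ?\<nu> f"
    using RNP unfolding radon_nikodym_property_def by blast
  have "has_density smul q M \<nu> (f \<circ> g)"
    unfolding has_density_def
  proof (intro conjI ballI)
    show "vector_integrable smul q M (f \<circ> g)"
      using f has_vector_integral_embed[OF assms(1)] unfolding has_density_def vector_integrable_def by blast
    fix E assume E: "E \<in> sets M"
    then have "has_vector_integral smul q ?M (\<lambda>x. if x \<in> g ` E then f x else 0) (?\<nu> (g ` E))"
      using f in_sets_embed_measure unfolding has_density_def by blast
    then have "has_vector_integral smul q M ((\<lambda>x. if x \<in> g ` E then f x else 0) \<circ> g) (?\<nu> (g ` E))"
      by (rule has_vector_integral_embed[OF assms(1)])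
    moreover have "(\<lambda>x. if x \<in> g ` E then f x else 0) \<circ> g = (\<lambda>x. if x \<in> E then (f \<circ> g) x else 0)"
      using g by (auto simp: inj_image_mem_iff)
    ultimately show "has_vector_integral smul q M (\<lambda>x. if x \<in> E then (f \<circ> g) x else 0) (\<nu> E)"
      using g by (simp add: inj_vimage_image_eq)
  qed
  then show "\<exists>f. has_density smul q M \<nu> f" by (intro exI[of _ "f \<circ> g"])
qed

end

section \<open>The vector measure of a Lipschitz curve\<close>

context normed_finite_measure
begin

text \<open>On the common refinement of the level sets of \<open>s\<close> and \<open>t\<close> both
  claims hold term by term.\<close>

lemma simple_vector_integral_diff:
  assumes s: "simple_function M s" and t: "simple_function M t"
  shows "simple_vector_integral sc M (\<lambda>x. s x - t x) = simple_vector_integral sc M s - simple_vector_integral sc M t"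
    "ennreal (q (simple_vector_integral sc M (\<lambda>x. s x - t x))) \<le> (\<integral>\<^sup>+ x. ennreal (q (s x - t x)) \<partial>M)"
proof -
  define J where "J = s ` space M \<times> t ` space M"
  define P where "P i = (s -` {fst i} \<inter> space M) \<inter> (t -` {snd i} \<inter> space M)" for i
  have J: "finite J" using s t by (auto simp: J_def simple_function_def)
  have P: "P i \<in> sets M" for i unfolding P_def using s t by (intro sets.Int simple_functionD)
  have disj: "disjoint_family_on P J" by (auto simp: disjoint_family_on_def P_def prod_eq_iff)
  have cover: "(\<Union>i\<in>J. P i) = space M" by (auto simp: J_def P_def)
  have Ss: "simple_vector_integral sc M s = (\<Sum>i\<in>J. sc (measure M (P i)) (fst i))"
    by (rule simple_vector_integral_partition[OF J P disj cover]) (auto simp: P_def)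
  have St: "simple_vector_integral sc M t = (\<Sum>i\<in>J. sc (measure M (P i)) (snd i))"
    by (rule simple_vector_integral_partition[OF J P disj cover]) (auto simp: P_def)
  have Sd: "simple_vector_integral sc M (\<lambda>x. s x - t x) = (\<Sum>i\<in>J. sc (measure M (P i)) (fst i - snd i))"
    by (rule simple_vector_integral_partition[OF J P disj cover]) (auto simp: P_def)
  show "simple_vector_integral sc M (\<lambda>x. s x - t x) = simple_vector_integral sc M s - simple_vector_integral sc M t"
    unfolding Ss St Sd by (simp add: scale_right_diff_distrib sum_subtractf)
  have "(\<integral>\<^sup>+ x. ennreal (q (s x - t x)) \<partial>M)
      = (\<integral>\<^sup>+ x. (\<Sum>i\<in>J. ennreal (q (fst i - snd i)) * indicator (P i) x) \<partial>M)"
  proof (rule nn_integral_cong)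
    fix x assume x: "x \<in> space M"
    let ?i = "(s x, t x)"
    have "?i \<in> J" using x by (simp add: J_def)
    have "(\<Sum>i\<in>J. ennreal (q (fst i - snd i)) * indicator (P i) x)
        = (\<Sum>i\<in>{?i}. ennreal (q (fst i - snd i)) * indicator (P i) x)"
      using J \<open>?i \<in> J\<close> by (intro sum.mono_neutral_right) (auto simp: P_def indicator_def)
    also have "\<dots> = ennreal (q (s x - t x))" using x by (simp add: P_def)
    finally show "ennreal (q (s x - t x)) = (\<Sum>i\<in>J. ennreal (q (fst i - snd i)) * indicator (P i) x)" ..
  qed
  also have "\<dots> = (\<Sum>i\<in>J. \<integral>\<^sup>+ x. ennreal (q (fst i - snd i)) * indicator (P i) x \<partial>M)"
    using P by (intro nn_integral_sum) auto
  also have "\<dots> = (\<Sum>i\<in>J. ennreal (q (sc (measure M (P i)) (fst i - snd i))))"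
    using P by (intro sum.cong)
      (auto simp: nn_integral_cmult_indicator emeasure_eq_measure q_scale q_nonneg mult.commute simp flip: ennreal_mult)
  also have "\<dots> = ennreal (\<Sum>i\<in>J. q (sc (measure M (P i)) (fst i - snd i)))"
    by (rule sum_ennreal) (rule q_nonneg)
  also have "\<dots> \<ge> ennreal (q (simple_vector_integral sc M (\<lambda>x. s x - t x)))"
    unfolding Sd by (intro ennreal_leI norm_sum)
  finally show "ennreal (q (simple_vector_integral sc M (\<lambda>x. s x - t x))) \<le> (\<integral>\<^sup>+ x. ennreal (q (s x - t x)) \<partial>M)" .
qed

text \<open>The norm of an integral is at most the integral of the norm. A measurable
  \<open>u\<close> stands for the distance, so that the integral of a sum of distances can be
  split.\<close>

lemma vector_integral_distance:
  assumes h: "has_vector_integral sc q M h I" and t: "simple_function M t"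
    and u: "u \<in> borel_measurable M" "AE x in M. q (h x - t x) = u x"
  shows "ennreal (q (I - simple_vector_integral sc M t)) \<le> (\<integral>\<^sup>+ x. ennreal (u x) \<partial>M)"
proof -
  obtain s where sm: "strongly_measurable q M h" and s: "\<And>n. simple_function M (s n)"
    "(\<lambda>n. \<integral>\<^sup>+ x. ennreal (q (h x - s n x)) \<partial>M) \<longlonglongrightarrow> 0"
    "(\<lambda>n. q (simple_vector_integral sc M (s n) - I)) \<longlonglongrightarrow> 0"
    using h unfolding has_vector_integral_def by blast
  have step: "ennreal (q (I - simple_vector_integral sc M t))
      \<le> ennreal (q (simple_vector_integral sc M (s n) - I)) +
        ((\<integral>\<^sup>+ x. ennreal (q (h x - s n x)) \<partial>M) + (\<integral>\<^sup>+ x. ennreal (u x) \<partial>M))" for n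
  proof -
    obtain w where w: "w \<in> borel_measurable M" "AE x in M. q (h x - s n x) = w x"
      using distance_AE_measurable[OF sm s(1)] by blast
    have "ennreal (q (simple_vector_integral sc M (s n) - simple_vector_integral sc M t))
        \<le> (\<integral>\<^sup>+ x. ennreal (q (s n x - t x)) \<partial>M)"
      using simple_vector_integral_diff[OF s(1) t] by simp
    also have "\<dots> \<le> (\<integral>\<^sup>+ x. ennreal (w x) + ennreal (u x) \<partial>M)"
    proof (rule nn_integral_mono_AE)
      show "AE x in M. ennreal (q (s n x - t x)) \<le> ennreal (w x) + ennreal (u x)"
        using w(2) u(2)
      proof eventually_elim
        case (elim x)
        have "q (s n x - t x) \<le> q (h x - s n x) + q (h x - t x)"
          using norm_add[of "s n x - h x" "h x - t x"] by (simp add: q_diff_commute)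
        then have "ennreal (q (s n x - t x)) \<le> ennreal (q (h x - s n x) + q (h x - t x))" by (rule ennreal_leI)
        then show ?case using elim q_nonneg[of "h x - s n x"] q_nonneg[of "h x - t x"]
          by (simp add: ennreal_plus)
      qed
    qed
    also have "\<dots> = (\<integral>\<^sup>+ x. ennreal (w x) \<partial>M) + (\<integral>\<^sup>+ x. ennreal (u x) \<partial>M)"
      using w(1) u(1) by (intro nn_integral_add) auto
    also have "(\<integral>\<^sup>+ x. ennreal (w x) \<partial>M) = (\<integral>\<^sup>+ x. ennreal (q (h x - s n x)) \<partial>M)"
      using w(2) by (intro nn_integral_cong_AE) (auto elim: eventually_mono)
    finally have 1: "ennreal (q (simple_vector_integral sc M (s n) - simple_vector_integral sc M t))
        \<le> (\<integral>\<^sup>+ x. ennreal (q (h x - s n x)) \<partial>M) + (\<integral>\<^sup>+ x. ennreal (u x) \<partial>M)" .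
    have "q (I - simple_vector_integral sc M t) \<le> q (simple_vector_integral sc M (s n) - I)
        + q (simple_vector_integral sc M (s n) - simple_vector_integral sc M t)"
      using norm_add[of "I - simple_vector_integral sc M (s n)"
          "simple_vector_integral sc M (s n) - simple_vector_integral sc M t"]
      by (simp add: q_diff_commute)
    then have "ennreal (q (I - simple_vector_integral sc M t))
        \<le> ennreal (q (simple_vector_integral sc M (s n) - I)
        + q (simple_vector_integral sc M (s n) - simple_vector_integral sc M t))" by (rule ennreal_leI)
    also have "\<dots> = ennreal (q (simple_vector_integral sc M (s n) - I))
        + ennreal (q (simple_vector_integral sc M (s n) - simple_vector_integral sc M t))"
      by (intro ennreal_plus q_nonneg)
    finally show ?thesis using add_left_mono[OF 1] by (rule order_trans)
  qed
  have "(\<lambda>n. ennreal (q (simple_vector_integral sc M (s n) - I)) +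
      ((\<integral>\<^sup>+ x. ennreal (q (h x - s n x)) \<partial>M) + (\<integral>\<^sup>+ x. ennreal (u x) \<partial>M)))
      \<longlonglongrightarrow> ennreal 0 + (0 + (\<integral>\<^sup>+ x. ennreal (u x) \<partial>M))"
    by (intro tendsto_add tendsto_const tendsto_ennrealI s)
  then show ?thesis using step LIMSEQ_le_const by fastforce
qed

end

text \<open>Lebesgue measure of a unit interval, kept on all Borel sets of the line: half-lines
  remain measurable and no subspace sigma-algebra appears.\<close>

abbreviation (input) unit_measure :: "real \<Rightarrow> real measure" where
  "unit_measure a \<equiv> density lborel (indicator {a..<a + 1})"

lemma emeasure_unit_measure:
  assumes "E \<in> sets borel"
  shows "emeasure (unit_measure a) E = emeasure lborel (E \<inter> {a..<a + 1})"
  using assms by (simp add: emeasure_restricted Int_commute)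

lemma finite_unit_measure: "finite_measure (unit_measure a)"
  by (rule finite_measureI) (simp add: emeasure_unit_measure)

lemma measure_unit_measure_atLeastLessThan:
  assumes "a \<le> u" "u \<le> v" "v \<le> a + 1"
  shows "measure (unit_measure a) {u..<v} = v - u"
proof -
  have "{u..<v} \<inter> {a..<a + 1} = {u..<v}" using assms by auto
  then show ?thesis using assms by (simp add: measure_def emeasure_unit_measure)
qed

locale lipschitz_unit = normed_finite_measure sc q "unit_measure a"
  for sc :: "real \<Rightarrow> 'a::ab_group_add \<Rightarrow> 'a" and q :: "'a \<Rightarrow> real" and a :: real +
  fixes F :: "real \<Rightarrow> 'a" and L :: real
  assumes lip: "q (F t - F s) \<le> L * \<bar>t - s\<bar>" and compl: "complete_wrt q"
begin

abbreviation M where "M \<equiv> unit_measure a"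

lemma L_nonneg: "L \<ge> 0"
  using lip[of 1 0] q_nonneg[of "F 1 - F 0"] by simp

definition grid :: "nat \<Rightarrow> nat \<Rightarrow> real" where
  "grid n k = a + real k / real (Suc n)"

definition cell :: "nat \<Rightarrow> nat \<Rightarrow> real set" where
  "cell n k = {grid n k..<grid n (Suc k)}"

text \<open>The integral over \<open>E\<close> of the derivative of the polygon through the points \<open>F (grid n k)\<close>.\<close>

definition step_measure :: "nat \<Rightarrow> real set \<Rightarrow> 'a" where
  "step_measure n E = (\<Sum>k<Suc n. sc (real (Suc n) * measure M (E \<inter> cell n k)) (F (grid n (Suc k)) - F (grid n k)))"

lemma grid_step: "grid n (Suc k) - grid n k = 1 / real (Suc n)"
  by (simp add: grid_def add_divide_distrib)

lemma grid_mono: "j \<le> k \<Longrightarrow> grid n j \<le> grid n k"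
  by (simp add: grid_def divide_right_mono)

lemma grid_bounds: "a \<le> grid n k" "k \<le> Suc n \<Longrightarrow> grid n k \<le> a + 1"
  by (auto simp: grid_def divide_le_eq)

lemma cell_disjoint: "disjoint_family_on (cell n) I"
proof -
  have "cell n j \<inter> cell n k = {}" if "j < k" for j k
    using grid_mono[of "Suc j" k n] that by (auto simp: cell_def)
  then show ?thesis unfolding disjoint_family_on_def by (metis Int_commute nat_neq_iff)
qed

lemma step_measure_Un:
  assumes "A \<in> sets M" "B \<in> sets M" "A \<inter> B = {}"
  shows "step_measure n (A \<union> B) = step_measure n A + step_measure n B"
proof -
  have "measure M ((A \<union> B) \<inter> cell n k) = measure M (A \<inter> cell n k) + measure M (B \<inter> cell n k)" for k
    using assms finite_measure_Union[of "A \<inter> cell n k" "B \<inter> cell n k"]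
    by (auto simp: Int_Un_distrib2 cell_def)
  then show ?thesis
    unfolding step_measure_def by (simp only: distrib_left scale_left_distrib sum.distrib)
qed

lemma step_measure_le:
  assumes "E \<in> sets M"
  shows "q (step_measure n E) \<le> L * measure M E"
proof -
  have "q (step_measure n E) \<le> (\<Sum>k<Suc n. q (sc (real (Suc n) * measure M (E \<inter> cell n k))
      (F (grid n (Suc k)) - F (grid n k))))"
    unfolding step_measure_def by (rule norm_sum)
  also have "\<dots> \<le> (\<Sum>k<Suc n. L * measure M (E \<inter> cell n k))"
  proof (rule sum_mono)
    fix k
    have "q (sc (real (Suc n) * measure M (E \<inter> cell n k)) (F (grid n (Suc k)) - F (grid n k)))
        = real (Suc n) * measure M (E \<inter> cell n k) * q (F (grid n (Suc k)) - F (grid n k))"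
      by (simp add: q_scale abs_mult)
    also have "\<dots> \<le> real (Suc n) * measure M (E \<inter> cell n k) * (L * \<bar>grid n (Suc k) - grid n k\<bar>)"
      by (intro mult_left_mono lip) simp
    also have "\<dots> = L * measure M (E \<inter> cell n k)" unfolding grid_step by simp
    finally show "q (sc (real (Suc n) * measure M (E \<inter> cell n k)) (F (grid n (Suc k)) - F (grid n k)))
        \<le> L * measure M (E \<inter> cell n k)" .
  qed
  also have "\<dots> = L * measure M (\<Union>k<Suc n. E \<inter> cell n k)"
  proof -
    have "disjoint_family_on (\<lambda>k. E \<inter> cell n k) {..<Suc n}"
      using cell_disjoint[of n "{..<Suc n}"] unfolding disjoint_family_on_def by blast
    then show ?thesis
      unfolding sum_distrib_left[symmetric] using assms
      by (subst finite_measure_finite_Union) (auto simp: cell_def)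
  qed
  also have "\<dots> \<le> L * measure M E"
    using assms L_nonneg by (intro mult_left_mono finite_measure_mono) auto
  finally show ?thesis .
qed

lemma step_measure_grid:
  assumes "j \<le> Suc n"
  shows "step_measure n {..<grid n j} = F (grid n j) - F a"
proof -
  have m: "real (Suc n) * measure M ({..<grid n j} \<inter> cell n k) = (if k < j then 1 else 0)" if "k < Suc n" for k
  proof (cases "k < j")
    case True
    then have "{..<grid n j} \<inter> cell n k = cell n k"
      using grid_mono[of "Suc k" j n] by (auto simp: cell_def)
    moreover have "measure M (cell n k) = grid n (Suc k) - grid n k"
      unfolding cell_def using that grid_bounds grid_mono by (intro measure_unit_measure_atLeastLessThan) auto
    ultimately show ?thesis using True by (simp add: grid_step)
  next
    case False
    then have "{..<grid n j} \<inter> cell n k = {}" using grid_mono[of j k n] by (auto simp: cell_def)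
    then show ?thesis using False by simp
  qed
  have "step_measure n {..<grid n j} = (\<Sum>k<Suc n. if k < j then F (grid n (Suc k)) - F (grid n k) else 0)"
    unfolding step_measure_def using m by (intro sum.cong refl) simp
  also have "\<dots> = (\<Sum>k<j. F (grid n (Suc k)) - F (grid n k))"
    using assms by (intro sum.mono_neutral_cong_right) auto
  also have "\<dots> = F (grid n j) - F (grid n 0)" by (rule sum_lessThan_telescope)
  finally show ?thesis by (simp add: grid_def)
qed

text \<open>The value is exact at grid points. From the last grid point not beyond \<open>x\<close>
  onwards, the step measure and the curve each change by at most \<open>L / real (Suc n)\<close>,
  whence the factor two.\<close>

lemma step_measure_lessThan:
  assumes "a \<le> x" "x \<le> a + 1"
  shows "q (step_measure n {..<x} - (F x - F a)) \<le> 2 * L / real (Suc n)"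
proof -
  define j where "j = nat \<lfloor>(x - a) * real (Suc n)\<rfloor>"
  have j: "real j \<le> (x - a) * real (Suc n)" "(x - a) * real (Suc n) < real j + 1"
    using assms unfolding j_def by (auto simp: of_nat_floor)
  have "(x - a) * real (Suc n) \<le> 1 * real (Suc n)" using assms by (intro mult_right_mono) auto
  with j(1) have "real j \<le> 1 * real (Suc n)" by (rule order_trans)
  then have "real j \<le> real (Suc n)" by (simp only: mult_1)
  then have "j \<le> Suc n" by (simp only: of_nat_le_iff)
  have g: "grid n j \<le> x" "x - grid n j \<le> 1 / real (Suc n)"
  proof -
    have "real j / real (Suc n) \<le> x - a" "x - a \<le> (real j + 1) / real (Suc n)"
      using j by (simp_all only: pos_divide_le_eq pos_le_divide_eq of_nat_0_less_iff zero_less_Suc less_imp_le)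
    then show "grid n j \<le> x" "x - grid n j \<le> 1 / real (Suc n)"
      by (simp_all add: grid_def add_divide_distrib)
  qed
  have "{..<x} = {..<grid n j} \<union> {grid n j..<x}" using g(1) by auto
  moreover have "step_measure n ({..<grid n j} \<union> {grid n j..<x})
      = step_measure n {..<grid n j} + step_measure n {grid n j..<x}"
    by (rule step_measure_Un) auto
  ultimately have "step_measure n {..<x} = step_measure n {..<grid n j} + step_measure n {grid n j..<x}"
    by (rule ssubst)
  then have "step_measure n {..<x} - (F x - F a) = step_measure n {grid n j..<x} - (F x - F (grid n j))"
    by (simp add: step_measure_grid[OF \<open>j \<le> Suc n\<close>])
  then have "q (step_measure n {..<x} - (F x - F a)) \<le> q (step_measure n {grid n j..<x}) + q (F x - F (grid n j))"
    using norm_diff by (simp only:)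
  also have "\<dots> \<le> L * measure M {grid n j..<x} + L * \<bar>x - grid n j\<bar>"
    by (intro add_mono step_measure_le lip) simp
  also have "measure M {grid n j..<x} = x - grid n j"
    using grid_bounds(1) g assms by (intro measure_unit_measure_atLeastLessThan) auto
  also have "L * (x - grid n j) + L * \<bar>x - grid n j\<bar> = 2 * L * (x - grid n j)" using g by simp
  also have "\<dots> \<le> 2 * L * (1 / real (Suc n))" using g L_nonneg by (intro mult_left_mono) auto
  finally show ?thesis by simp
qed

section \<open>Convergence of the step measures on Borel sets\<close>

definition has_limit :: "real set \<Rightarrow> 'a \<Rightarrow> bool" where
  "has_limit E l \<longleftrightarrow> (\<lambda>n. q (step_measure n E - l)) \<longlonglongrightarrow> 0"

lemma has_limit_unique:
  assumes "has_limit E l" "has_limit E l'"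
  shows "l = l'"
proof -
  have lim: "(\<lambda>n. q (step_measure n E - l) + q (step_measure n E - l')) \<longlonglongrightarrow> 0 + 0"
    using assms unfolding has_limit_def by (rule tendsto_add)
  have le: "q (l - l') \<le> q (step_measure n E - l) + q (step_measure n E - l')" for n
    using norm_add[of "l - step_measure n E" "step_measure n E - l'"] by (simp add: q_diff_commute)
  have "q (l - l') \<le> 0 + 0" by (rule LIMSEQ_le_const[OF lim]) (use le in blast)
  then show ?thesis using q_nonneg[of "l - l'"] by (simp add: order_antisym)
qed

lemma has_limit_Un:
  assumes "A \<in> sets M" "B \<in> sets M" "A \<inter> B = {}" "has_limit A l" "has_limit B l'"
  shows "has_limit (A \<union> B) (l + l')"
  unfolding has_limit_def
proof (rule q_tendsto_0I)
  show "(\<lambda>n. q (step_measure n A - l) + q (step_measure n B - l')) \<longlonglongrightarrow> 0"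
    using tendsto_add[OF assms(4,5)[unfolded has_limit_def]] by simp
  show "q (step_measure n (A \<union> B) - (l + l')) \<le> q (step_measure n A - l) + q (step_measure n B - l')" for n
    using norm_add[of "step_measure n A - l" "step_measure n B - l'"]
    by (simp add: step_measure_Un[OF assms(1-3)] algebra_simps)
qed

lemma has_limit_lessThan:
  assumes "a \<le> x" "x \<le> a + 1"
  shows "has_limit {..<x} (F x - F a)"
  unfolding has_limit_def
proof (rule q_tendsto_0I)
  show "(\<lambda>n. 2 * L / real (Suc n)) \<longlonglongrightarrow> 0"
    by (rule LIMSEQ_Suc[OF lim_const_over_n])
qed (rule step_measure_lessThan[OF assms])

lemma step_measure_cong:
  assumes "A \<inter> {a..<a + 1} = B \<inter> {a..<a + 1}" "A \<in> sets borel" "B \<in> sets borel"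
  shows "step_measure n A = step_measure n B"
proof -
  have "measure M (A \<inter> cell n k) = measure M (B \<inter> cell n k)" for k
  proof -
    have "A \<inter> cell n k \<inter> {a..<a + 1} = B \<inter> cell n k \<inter> {a..<a + 1}" using assms(1) by blast
    then show ?thesis using assms(2,3) by (simp add: measure_def emeasure_unit_measure cell_def)
  qed
  then show ?thesis unfolding step_measure_def by simp
qed

text \<open>The sets with a limit form a Dynkin system containing the half-lines. For countable
  disjoint unions, the bound \<open>L * measure M E\<close> is uniform in \<open>n\<close>, so
  finitely many members approximate the union for all step measures at once.\<close>

lemma has_limit_ex:
  assumes "E \<in> sets borel"
  shows "\<exists>l. has_limit E l"
proof -
  let ?G = "range lessThan :: real set set"
  have sig: "sets borel = sigma_sets UNIV ?G"
  proof -
    have "(borel :: real measure) = sigma UNIV ?G"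
      using borel_eq_lessThan[where 'a = real] unfolding eucl_lessThan .
    then show ?thesis by (metis sets_measure_of subset_Pow_Union top_greatest Pow_UNIV)
  qed
  have stable: "Int_stable ?G"
    unfolding Int_stable_def
  proof (intro ballI)
    fix A B assume "A \<in> ?G" "B \<in> ?G"
    then obtain x y where "A = {..<x}" "B = {..<y}" by blast
    then have "A \<inter> B = {..<min x y}" by auto
    then show "A \<inter> B \<in> ?G" by (rule range_eqI)
  qed
  have E: "E \<in> sigma_sets UNIV ?G" using assms sig by simp
  have "Int_stable ?G \<Longrightarrow> ?G \<subseteq> Pow UNIV \<Longrightarrow> E \<in> sigma_sets UNIV ?G \<Longrightarrow> \<exists>l. has_limit E l"
  proof (induction rule: sigma_sets_induct_disjoint)
    case (basic A)
    then obtain x where x: "A = {..<x}" by blast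
    \<comment> \<open>Clipping the end point to the unit interval leaves the trace of the half-line
      on that interval unchanged.\<close>
    let ?x = "max a (min (a + 1) x)"
    have "A \<inter> {a..<a + 1} = {..<?x} \<inter> {a..<a + 1}" unfolding x by auto
    then have "has_limit A l \<longleftrightarrow> has_limit {..<?x} l" for l
      unfolding has_limit_def using step_measure_cong[of A "{..<?x}"] by (simp add: x)
    moreover have "has_limit {..<?x} (F ?x - F a)" by (rule has_limit_lessThan) auto
    ultimately show ?case by blast
  next
    case empty
    have "has_limit {} 0" by (simp add: has_limit_def step_measure_def)
    then show ?case by blast
  next
    case (compl A)
    then obtain l where l: "has_limit A l" by blast
    have A: "A \<in> sets M" using compl(1) sig by simp
    \<comment> \<open>The whole line and \<open>{..<a + 1}\<close> have the same trace on the unit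
      interval, so complements reduce to a half-line with known limit.\<close>
    have stepc: "step_measure n (UNIV - A) = step_measure n {..<a + 1} - step_measure n A" for n
    proof -
      have "step_measure n UNIV = step_measure n A + step_measure n (UNIV - A)"
        using step_measure_Un[of A "UNIV - A" n] A by auto
      moreover have "step_measure n UNIV = step_measure n {..<a + 1}"
        by (rule step_measure_cong) auto
      ultimately show ?thesis by (simp add: algebra_simps)
    qed
    have lim1: "has_limit {..<a + 1} (F (a + 1) - F a)" by (rule has_limit_lessThan) auto
    have "has_limit (UNIV - A) (F (a + 1) - F a - l)"
      unfolding has_limit_def
    proof (rule q_tendsto_0I)
      show "(\<lambda>n. q (step_measure n {..<a + 1} - (F (a + 1) - F a)) + q (step_measure n A - l)) \<longlonglongrightarrow> 0"
        using tendsto_add[OF lim1[unfolded has_limit_def] l[unfolded has_limit_def]] by simp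
      show "q (step_measure n (UNIV - A) - (F (a + 1) - F a - l))
          \<le> q (step_measure n {..<a + 1} - (F (a + 1) - F a)) + q (step_measure n A - l)" for n
        using norm_diff[of "step_measure n {..<a + 1} - (F (a + 1) - F a)" "step_measure n A - l"]
        by (simp add: stepc algebra_simps)
    qed
    then show ?case by blast
  next
    case (union A)
    have A: "A i \<in> sets M" for i using union(2) sig by auto
    let ?U = "\<Union>i. A i"
    have U: "?U \<in> sets M" using A by auto
    have part: "\<exists>l. has_limit (\<Union>i<m. A i) l" for m
    proof (induction m)
      case 0
      have "has_limit {} 0" by (simp add: has_limit_def step_measure_def)
      then show ?case by auto
    next
      case (Suc m)
      then obtain l where l: "has_limit (\<Union>i<m. A i) l" by blast
      obtain l' where l': "has_limit (A m) l'" using union(3) by blast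
      have "A m \<inter> A i = {}" if "i < m" for i
        using union(1)[unfolded disjoint_family_on_def, rule_format, of m i] that by simp
      then have "A m \<inter> (\<Union>i<m. A i) = {}" by blast
      then have "has_limit (A m \<union> (\<Union>i<m. A i)) (l' + l)"
        using A by (intro has_limit_Un l l') auto
      then show ?case by (auto simp: lessThan_Suc)
    qed
    have "\<exists>l. (\<lambda>n. q (step_measure n ?U - l)) \<longlonglongrightarrow> 0"
    proof (rule compl[unfolded complete_wrt_def, THEN spec, THEN mp], intro allI impI)
      fix e :: real assume e: "e > 0"
      have "(\<lambda>m. L * (measure M ?U - (\<Sum>i<m. measure M (A i)))) \<longlonglongrightarrow> L * (measure M ?U - measure M ?U)"
        using finite_measure_UNION[OF _ union(1)] A unfolding sums_def by (intro tendsto_intros) auto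
      then have "\<forall>\<^sub>F m in sequentially. L * (measure M ?U - (\<Sum>i<m. measure M (A i))) < e / 4"
        using e by (intro order_tendstoD(2)) auto
      then obtain m where m: "L * (measure M ?U - (\<Sum>i<m. measure M (A i))) < e / 4"
        unfolding eventually_sequentially by blast
      let ?V = "\<Union>i<m. A i"
      have V: "?V \<in> sets M" "?V \<subseteq> ?U" using A by auto
      have "measure M ?V = (\<Sum>i<m. measure M (A i))"
        using A disjoint_family_on_mono[OF subset_UNIV union(1)] by (intro finite_measure_finite_Union) auto
      then have mUV: "L * measure M (?U - ?V) < e / 4"
        using m finite_measure_Diff[OF U V] by simp
      have UV: "q (step_measure n ?U - step_measure n ?V) < e / 4" for n
      proof -
        have "?V \<union> (?U - ?V) = ?U" by blast
        then have "step_measure n ?U = step_measure n ?V + step_measure n (?U - ?V)"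
          using step_measure_Un[of ?V "?U - ?V" n] U V by auto
        then have "q (step_measure n ?U - step_measure n ?V) \<le> L * measure M (?U - ?V)"
          using step_measure_le[of "?U - ?V" n] U V by simp
        then show ?thesis using mUV by simp
      qed
      obtain l where "has_limit ?V l" using part by blast
      then have "\<forall>\<^sub>F n in sequentially. q (step_measure n ?V - l) < e / 4"
        unfolding has_limit_def using e by (intro order_tendstoD(2)) auto
      then obtain n0 where n0: "\<And>n. n \<ge> n0 \<Longrightarrow> q (step_measure n ?V - l) < e / 4"
        unfolding eventually_sequentially by blast
      \<comment> \<open>Four errors of a quarter each: two tails of the union and two distances to
        the limit over \<open>?V\<close>.\<close>
      have "q (step_measure i ?U - step_measure j ?U) < e" if ij: "i \<ge> n0" "j \<ge> n0" for i j
      proof -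
        have "q (step_measure i ?U - step_measure j ?U)
            \<le> q (step_measure i ?U - step_measure i ?V) + q (step_measure i ?V - step_measure j ?U)"
          using q_triangle[of "step_measure i ?U" "step_measure j ?U" "step_measure i ?V"] by simp
        also have "q (step_measure i ?V - step_measure j ?U)
            \<le> q (step_measure i ?V - l) + q (l - step_measure j ?U)"
          using q_triangle[of "step_measure i ?V" "step_measure j ?U" l] by simp
        also have "q (l - step_measure j ?U) \<le> q (l - step_measure j ?V) + q (step_measure j ?V - step_measure j ?U)"
          using q_triangle[of l "step_measure j ?U" "step_measure j ?V"] by simp
        finally show ?thesis
          using UV[of i] UV[of j] n0[OF ij(1)] n0[OF ij(2)]
            q_diff_commute[of l "step_measure j ?V"] q_diff_commute[of "step_measure j ?V" "step_measure j ?U"]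
          by linarith
      qed
      then show "\<exists>n0. \<forall>i\<ge>n0. \<forall>j\<ge>n0. q (step_measure i ?U - step_measure j ?U) < e" by blast
    qed
    then show ?case unfolding has_limit_def .
  qed
  then show ?thesis using stable E by simp
qed

definition deriv_measure :: "real set \<Rightarrow> 'a" where
  "deriv_measure E = (SOME l. has_limit E l)"

lemma deriv_measure: "E \<in> sets borel \<Longrightarrow> has_limit E (deriv_measure E)"
  unfolding deriv_measure_def by (rule someI_ex) (rule has_limit_ex)

lemma deriv_measure_eq: "E \<in> sets borel \<Longrightarrow> has_limit E l \<Longrightarrow> deriv_measure E = l"
  using deriv_measure has_limit_unique by blast

lemma deriv_measure_Un:
  assumes "A \<in> sets M" "B \<in> sets M" "A \<inter> B = {}"
  shows "deriv_measure (A \<union> B) = deriv_measure A + deriv_measure B"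
  using assms by (intro deriv_measure_eq has_limit_Un deriv_measure) auto

lemma deriv_measure_le:
  assumes "E \<in> sets M"
  shows "q (deriv_measure E) \<le> L * measure M E"
proof -
  have "q (deriv_measure E) \<le> 1 * (L * measure M E)"
    by (rule q_limit_le[OF deriv_measure[unfolded has_limit_def]]) (use assms step_measure_le in auto)
  then show ?thesis by simp
qed

lemma deriv_measure_interval:
  assumes "a \<le> u" "u \<le> v" "v \<le> a + 1"
  shows "deriv_measure {u..<v} = F v - F u"
proof -
  have "{..<v} = {..<u} \<union> {u..<v}" using assms by auto
  then have "deriv_measure {..<v} = deriv_measure {..<u} + deriv_measure {u..<v}"
  proof -
    have "deriv_measure ({..<u} \<union> {u..<v}) = deriv_measure {..<u} + deriv_measure {u..<v}"
      by (rule deriv_measure_Un) auto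
    then show ?thesis using \<open>{..<v} = {..<u} \<union> {u..<v}\<close> by simp
  qed
  moreover have "deriv_measure {..<v} = F v - F a" "deriv_measure {..<u} = F u - F a"
    using assms by (auto intro!: deriv_measure_eq has_limit_lessThan)
  ultimately show ?thesis by (simp add: algebra_simps)
qed

lemma density_of_deriv_measure:
  assumes "radon_nikodym_property TYPE(real) sc q"
  shows "\<exists>f. has_density sc q M deriv_measure f"
  using assms finite_unit_measure vector_measure_if_dominated[OF deriv_measure_Un deriv_measure_le L_nonneg]
  unfolding radon_nikodym_property_def by blast

end

section \<open>Differentiability almost everywhere\<close>

lemma (in normed_finite_measure) simple_vector_integral_indicator:
  assumes "E \<in> sets M"
  shows "simple_function M (\<lambda>x. if x \<in> E then y else 0)"
    "simple_vector_integral sc M (\<lambda>x. if x \<in> E then y else 0) = sc (measure M E) y"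
proof -
  define P where "P b = (if b then E else space M - E)" for b
  have P: "finite (UNIV :: bool set)" "P b \<in> sets M" "disjoint_family_on P UNIV" "(\<Union>b\<in>UNIV. P b) = space M" for b
    using assms sets.sets_into_space[OF assms] by (auto simp: P_def disjoint_family_on_def UNIV_bool)
  have c: "(if x \<in> E then y else 0) = (if b then y else 0)" if "x \<in> P b" for x b
    using that by (auto simp: P_def split: if_splits)
  show "simple_function M (\<lambda>x. if x \<in> E then y else 0)"
    by (rule simple_function_partition(1)[OF P]) (rule c)
  have "simple_vector_integral sc M (\<lambda>x. if x \<in> E then y else 0)
      = (\<Sum>b\<in>UNIV. sc (measure M (P b)) (if b then y else 0))"
    by (rule simple_vector_integral_partition[OF P]) (rule c)
  then show "simple_vector_integral sc M (\<lambda>x. if x \<in> E then y else 0) = sc (measure M E) y"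
    by (simp add: UNIV_bool P_def)
qed

context lipschitz_unit
begin

text \<open>Lebesgue's argument for vector-valued functions: apply the scalar theorem to the distances
  of the density \<open>f\<close> from the countably many values of simple functions approximating it.\<close>

lemma AE_differentiable:
  assumes dens: "has_density sc q M deriv_measure f"
  shows "AE s in lebesgue. a < s \<longrightarrow> s < a + 1 \<longrightarrow> has_derivative_within F UNIV s (f s)"
proof -
  have [simp]: "space M = UNIV" "sets M = sets borel" by simp_all
  obtain I where I: "has_vector_integral sc q M f I"
    using dens unfolding has_density_def vector_integrable_def by blast
  then have sm: "strongly_measurable q M f" unfolding has_vector_integral_def by blast
  obtain r where r: "\<And>n. simple_function M (r n)" "AE x in M. (\<lambda>n. q (f x - r n x)) \<longlonglongrightarrow> 0"
    using sm unfolding strongly_measurable_def by blast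
  \<comment> \<open>Almost everywhere \<open>f\<close> is a limit of points of this countable set,
    so countably many scalar statements suffice although the space need not be separable.\<close>
  define D where "D = (\<Union>n. range (r n))"
  have D: "countable D"
    using simple_functionD(1)[OF r(1)] unfolding D_def by (auto intro: countable_finite)
  \<comment> \<open>The exceptional null set of the measurable version depends on \<open>y\<close>;
    only those for \<open>y\<close> in \<open>D\<close> are united later.\<close>
  have "\<forall>y. \<exists>w. w \<in> borel_measurable M \<and> (\<forall>x. 0 \<le> w x) \<and> (AE x in M. q (f x - y) = (w x :: real))"
    using distance_AE_measurable[OF sm simple_function_const] by blast
  from choice[OF this] obtain u where u: "\<forall>y. u y \<in> borel_measurable M \<and> (\<forall>x. 0 \<le> u y x) \<and>
      (AE x in M. q (f x - y) = (u y x :: real))" ..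
  have um [measurable]: "u y \<in> borel_measurable borel" and u0: "0 \<le> u y x"
    and uAE: "AE x in M. q (f x - y) = u y x" for y x using u by auto
  \<comment> \<open>Compare \<open>f\<close> with a simple function at integral distance below one;
    that function is bounded, so its distance to \<open>y\<close> has finite integral.\<close>
  have ufin: "(\<integral>\<^sup>+ x. ennreal (u y x) \<partial>M) < \<infinity>" for y
  proof -
    obtain s where s: "\<And>n. simple_function M (s n)"
      "(\<lambda>n. \<integral>\<^sup>+ x. ennreal (q (f x - s n x)) \<partial>M) \<longlonglongrightarrow> 0"
      using I unfolding has_vector_integral_def by blast
    have "\<forall>\<^sub>F n in sequentially. (\<integral>\<^sup>+ x. ennreal (q (f x - s n x)) \<partial>M) < 1"
      using s(2) by (rule order_tendstoD(2)) simp
    then obtain n where n: "(\<integral>\<^sup>+ x. ennreal (q (f x - s n x)) \<partial>M) < 1"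
      unfolding eventually_sequentially by blast
    obtain w where w: "w \<in> borel_measurable M" "AE x in M. q (f x - s n x) = (w x :: real)"
      using distance_AE_measurable[OF sm s(1)] by blast
    have fin: "finite ((\<lambda>x. q (s n x - y)) ` UNIV)"
      using simple_functionD(1)[OF s(1), of n] finite_imageI[of "range (s n)" "\<lambda>z. q (z - y)"]
      by (simp add: image_image)
    define B where "B = Max ((\<lambda>x. q (s n x - y)) ` UNIV)"
    have B: "q (s n x - y) \<le> B" for x unfolding B_def using fin by (rule Max_ge) blast
    have "(\<integral>\<^sup>+ x. ennreal (u y x) \<partial>M) \<le> (\<integral>\<^sup>+ x. ennreal (w x) + ennreal B \<partial>M)"
    proof (rule nn_integral_mono_AE)
      show "AE x in M. ennreal (u y x) \<le> ennreal (w x) + ennreal B"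
        using uAE[of y] w(2)
      proof eventually_elim
        case (elim x)
        have "u y x \<le> w x + B"
          using norm_add[of "f x - s n x" "s n x - y"] elim B[of x] by simp
        moreover have "0 \<le> w x" "0 \<le> B"
          using elim q_nonneg[of "f x - s n x"] q_nonneg[of "s n x - y"] B[of x] by auto
        ultimately show ?case by (simp add: ennreal_leI flip: ennreal_plus)
      qed
    qed
    also have "\<dots> = (\<integral>\<^sup>+ x. ennreal (w x) \<partial>M) + (\<integral>\<^sup>+ x. ennreal B \<partial>M)"
      using w(1) by (intro nn_integral_add) auto
    also have "(\<integral>\<^sup>+ x. ennreal (w x) \<partial>M) = (\<integral>\<^sup>+ x. ennreal (q (f x - s n x)) \<partial>M)"
      using w(2) by (intro nn_integral_cong_AE) (auto elim: eventually_mono)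
    also have "\<dots> + (\<integral>\<^sup>+ x. ennreal B \<partial>M) < \<infinity>"
    proof -
      have "(\<integral>\<^sup>+ x. ennreal B \<partial>M) = ennreal B * ennreal (measure M (space M))"
        by (simp only: nn_integral_const emeasure_eq_measure)
      then have "(\<integral>\<^sup>+ x. ennreal B \<partial>M) \<noteq> top" by (simp only: ennreal_mult_eq_top_iff) simp
      moreover have "(\<integral>\<^sup>+ x. ennreal (q (f x - s n x)) \<partial>M) \<noteq> top" using n by auto
      ultimately show ?thesis unfolding infinity_ennreal_def less_top[symmetric] ennreal_add_eq_top by blast
    qed
    finally show ?thesis .
  qed
  \<comment> \<open>Cut off to the unit interval, so that the scalar theorem for
    \<open>lborel\<close> applies.\<close>
  define g where "g y x = u y x * indicator {a..<a + 1} x" for y x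
  define N where "N y = density lborel (\<lambda>x. ennreal (g y x))" for y
  have gm [measurable]: "g y \<in> borel_measurable borel" for y unfolding g_def[abs_def] by measurable
  have N_eq: "emeasure (N y) E = (\<integral>\<^sup>+ x. ennreal (u y x) * indicator E x \<partial>M)" if [measurable]: "E \<in> sets borel" for y E
  proof -
    have "emeasure (N y) E = (\<integral>\<^sup>+ x. ennreal (g y x) * indicator E x \<partial>lborel)"
      unfolding N_def by (rule emeasure_density) auto
    also have "\<dots> = (\<integral>\<^sup>+ x. indicator {a..<a + 1} x * (ennreal (u y x) * indicator E x) \<partial>lborel)"
      by (intro nn_integral_cong) (auto simp: g_def indicator_def)
    also have "\<dots> = (\<integral>\<^sup>+ x. ennreal (u y x) * indicator E x \<partial>M)"
      by (rule nn_integral_density[symmetric]) auto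
    finally show ?thesis .
  qed
  \<comment> \<open>Integrate \<open>f\<close> minus the constant \<open>y\<close>. The vector
    measure is known on half-open intervals, while averages are taken over closed ones.\<close>
  have key: "ennreal (q (F t - F s - sc (t - s) y)) \<le> emeasure (N y) {s..t}"
    if st: "a \<le> s" "s \<le> t" "t \<le> a + 1" for s t y
  proof -
    let ?E = "{s..<t}"
    have E: "?E \<in> sets M" by simp
    then have "has_vector_integral sc q M (\<lambda>x. if x \<in> ?E then f x else 0) (deriv_measure ?E)"
      using dens unfolding has_density_def by blast
    then have h: "has_vector_integral sc q M (\<lambda>x. if x \<in> ?E then f x else 0) (F t - F s)"
      using deriv_measure_interval[OF st] by simp
    have "ennreal (q (F t - F s - simple_vector_integral sc M (\<lambda>x. if x \<in> ?E then y else 0)))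
        \<le> (\<integral>\<^sup>+ x. ennreal (u y x * indicator ?E x) \<partial>M)"
    proof (rule vector_integral_distance[OF h simple_vector_integral_indicator(1)[OF E]])
      show "AE x in M. q ((if x \<in> ?E then f x else 0) - (if x \<in> ?E then y else 0)) = u y x * indicator ?E x"
        using uAE[of y] by eventually_elim (simp add: indicator_def)
    qed auto
    also have "\<dots> \<le> (\<integral>\<^sup>+ x. ennreal (u y x) * indicator {s..t} x \<partial>M)"
      by (intro nn_integral_mono) (auto simp: indicator_def)
    finally show ?thesis
      unfolding simple_vector_integral_indicator(2)[OF E] measure_unit_measure_atLeastLessThan[OF st]
      by (subst N_eq) simp_all
  qed
  have "AE s in lebesgue. \<forall>y\<in>D. \<forall>c>g y s. averages_below (N y) s c"
  proof (subst AE_ball_countable[OF D], intro ballI)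
    fix y
    show "AE s in lebesgue. \<forall>c>g y s. averages_below (N y) s c"
      unfolding N_def
    proof (rule averages_eventually_le[OF gm])
      show "emeasure (density lborel (\<lambda>x. ennreal (g y x))) UNIV < \<infinity>"
        using ufin[of y] N_eq[of UNIV y] by (simp add: N_def)
      show "0 \<le> g y x" for x by (simp add: g_def u0)
    qed
  qed
  moreover have "AE s in lebesgue. a < s \<longrightarrow> s < a + 1 \<longrightarrow>
      (\<forall>y\<in>D. q (f s - y) = u y s) \<and> (\<lambda>n. q (f s - r n s)) \<longlonglongrightarrow> 0"
  proof -
    have "AE s in M. (\<forall>y\<in>D. q (f s - y) = u y s) \<and> (\<lambda>n. q (f s - r n s)) \<longlonglongrightarrow> 0"
      using r(2) uAE by (simp add: AE_ball_countable[OF D])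
    then have "AE s in lborel. 0 < (indicator {a..<a + 1} s :: ennreal) \<longrightarrow>
        (\<forall>y\<in>D. q (f s - y) = u y s) \<and> (\<lambda>n. q (f s - r n s)) \<longlonglongrightarrow> 0"
      by (subst (asm) AE_density) auto
    then have "AE s in lborel. a < s \<longrightarrow> s < a + 1 \<longrightarrow>
        (\<forall>y\<in>D. q (f s - y) = u y s) \<and> (\<lambda>n. q (f s - r n s)) \<longlonglongrightarrow> 0"
      by eventually_elim (simp add: indicator_def)
    then show ?thesis by (rule AE_completion)
  qed
  ultimately show ?thesis
  proof eventually_elim
    case (elim s)
    show ?case
    proof (intro impI)
      assume as: "a < s" "s < a + 1"
      show "has_derivative_within F UNIV s (f s)"
        unfolding has_derivative_within_def
      proof (intro allI impI)
        fix e :: real assume e: "e > 0"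
        have "\<forall>\<^sub>F n in sequentially. q (f s - r n s) < e / 4"
          using elim(2) as e by (intro order_tendstoD(2)) auto
        then obtain n where n: "q (f s - r n s) < e / 4" unfolding eventually_sequentially by blast
        define y where "y = r n s"
        have y: "y \<in> D" by (auto simp: y_def D_def)
        \<comment> \<open>At \<open>s\<close> the density of \<open>N y\<close> equals
          \<open>q (f s - y)\<close>, which this choice of \<open>y\<close> makes small.\<close>
        have "g y s < e / 4" using n elim(2) as y by (simp add: g_def y_def)
        then obtain d where d: "d > 0" "\<And>u v. u \<le> s \<Longrightarrow> s \<le> v \<Longrightarrow> u < v \<Longrightarrow> v - u < d \<Longrightarrow>
            emeasure (N y) {u..v} \<le> ennreal (e / 4 * (v - u))"
          using elim(1) y unfolding averages_below_def by blast
        have step: "q (F v - F u - sc (v - u) (f s)) \<le> e * (v - u)"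
          if uv: "u \<le> s" "s \<le> v" "u < v" "v - u < d" "a \<le> u" "v \<le> a + 1" for u v
        proof -
          have "ennreal (q (F v - F u - sc (v - u) y)) \<le> ennreal (e / 4 * (v - u))"
            using key[of u v y] d(2)[OF uv(1-4)] uv by (meson less_imp_le order_trans)
          then have 1: "q (F v - F u - sc (v - u) y) \<le> e / 4 * (v - u)"
            using uv e by (subst (asm) ennreal_le_iff) auto
          have "q (sc (v - u) (y - f s)) \<le> e / 4 * (v - u)"
            using n uv q_diff_commute[of y "f s"] by (simp add: q_scale y_def mult.commute mult_right_mono)
          moreover have "F v - F u - sc (v - u) (f s) = (F v - F u - sc (v - u) y) + sc (v - u) (y - f s)"
            by (simp add: scale_right_diff_distrib)
          then have "q (F v - F u - sc (v - u) (f s)) \<le> q (F v - F u - sc (v - u) y) + q (sc (v - u) (y - f s))"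
            using norm_add by metis
          ultimately have "q (F v - F u - sc (v - u) (f s)) \<le> e / 2 * (v - u)" using 1 by (simp add: field_simps)
          also have "\<dots> \<le> e * (v - u)" using e uv by (intro mult_right_mono) auto
          finally show ?thesis .
        qed
        \<comment> \<open>Keeps \<open>t\<close> inside the unit interval, where the vector measure
          describes \<open>F\<close>.\<close>
        define d' where "d' = min d (min (s - a) (a + 1 - s))"
        have "d' > 0" using d(1) as by (simp add: d'_def)
        moreover have "q (F t - F s - sc (t - s) (f s)) \<le> e * \<bar>t - s\<bar>" if t: "\<bar>t - s\<bar> < d'" for t
        proof -
          have d't: "\<bar>t - s\<bar> < d" "\<bar>t - s\<bar> < s - a" "\<bar>t - s\<bar> < a + 1 - s" using t by (auto simp: d'_def)
          consider "t = s" | "s < t" | "t < s" by linarith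
          then show ?thesis
          proof cases
            case 2
            then show ?thesis using step[of s t] d't as by simp
          next
            case 3
            have "F t - F s - sc (t - s) (f s) = - (F s - F t - sc (s - t) (f s))"
              by (simp add: scale_left_diff_distrib)
            then have "q (F t - F s - sc (t - s) (f s)) = q (F s - F t - sc (s - t) (f s))" by (metis q_minus)
            then show ?thesis using step[of t s] d't as 3 by simp
          qed simp
        qed
        ultimately show "\<exists>d>0. \<forall>t\<in>UNIV. \<bar>t - s\<bar> < d \<longrightarrow> q (F t - F s - sc (t - s) (f s)) \<le> e * \<bar>t - s\<bar>"
          by blast
      qed
    qed
  qed
qed

end

section \<open>Passing between equivalent norms and between scalar fields\<close>

lemma lipschitz_curve_le:
  assumes "lipschitz_curve q F" "\<And>x. p x \<le> C * q x" "C \<ge> 0"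
  shows "lipschitz_curve p F"
proof -
  obtain L where L: "\<And>s t. q (F t - F s) \<le> L * \<bar>t - s\<bar>"
    using assms(1) unfolding lipschitz_curve_def by blast
  have "p (F t - F s) \<le> C * L * \<bar>t - s\<bar>" for s t
    using assms(2)[of "F t - F s"] mult_left_mono[OF L[of t s] assms(3)] by (simp add: mult.assoc)
  then show ?thesis unfolding lipschitz_curve_def by blast
qed

lemma curve_differentiable_at_le:
  assumes "curve_differentiable_at smul q F s" "\<And>x. p x \<le> C * q x" "\<And>x. 0 \<le> p x"
  shows "curve_differentiable_at smul p F s"
proof -
  obtain v where v: "((\<lambda>t. q (smul (of_real (inverse (t - s))) (F t - F s) - v)) \<longlongrightarrow> 0) (at s)"
    using assms(1) unfolding curve_differentiable_at_def by blast
  have "((\<lambda>t. p (smul (of_real (inverse (t - s))) (F t - F s) - v)) \<longlongrightarrow> 0) (at s)"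
  proof (rule tendsto_sandwich[OF _ _ tendsto_const])
    show "((\<lambda>t. C * q (smul (of_real (inverse (t - s))) (F t - F s) - v)) \<longlongrightarrow> 0) (at s)"
      using tendsto_mult_left[OF v, of C] by simp
  qed (use assms in simp_all)
  then show ?thesis unfolding curve_differentiable_at_def by blast
qed

text \<open>Difference quotients involve real factors only, so derivatives over the given field and
  over the reals coincide.\<close>

lemma curve_differentiable_at_rscale:
  "curve_differentiable_at (\<lambda>r. smul (of_real r)) q = curve_differentiable_at smul q"
  by (simp add: curve_differentiable_at_def fun_eq_iff)

text \<open>Integrals of simple functions weight the values by measures of sets, which are
  real.\<close>

lemma has_density_rscale:
  "has_density (\<lambda>r. smul (of_real r)) q M = has_density smul q M"
  by (simp add: has_density_def vector_integrable_def has_vector_integral_def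
      simple_vector_integral_def fun_eq_iff)

lemma radon_nikodym_property_rscale:
  "radon_nikodym_property W (\<lambda>r. smul (of_real r)) q \<longleftrightarrow> radon_nikodym_property W smul q"
  by (simp add: radon_nikodym_property_def has_density_rscale)

lemma (in banach_norm) real_normed_rscale: "real_normed rscale q"
  by unfold_locales
    (auto simp: scale_right_distrib scale_left_distrib nonneg pos homogeneous triangle)

text \<open>\<open>good_piece\<close> asks for domination by a multiple of the measure, while
  \<open>\<nu>\<close> is only of bounded variation; \<open>bounded_piece\<close> supplies the
  domination on a subset of positive measure.\<close>

lemma radon_nikodym_property_if_differentiable:
  assumes "banach_norm smul q"
    and diff: "\<And>F. lipschitz_curve q F \<Longrightarrow> \<exists>s. curve_differentiable_at smul q F s"
  shows "radon_nikodym_property (TYPE('w)) smul q"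
proof -
  let ?sc = "\<lambda>r. smul (of_real r)"
  interpret B: banach_norm smul q by fact
  have "\<exists>f. has_density ?sc q M \<nu> f"
    if M: "finite_measure M" "vector_measure q M \<nu>" "measure_continuous q M \<nu>" "bounded_variation q M \<nu>"
    for M :: "'w measure" and \<nu>
  proof -
    interpret real_normed ?sc q by (rule B.real_normed_rscale)
    interpret finite_measure M by fact
    interpret vector_measure_space ?sc q M \<nu> by unfold_locales fact+
    show ?thesis
    proof (rule density_exists[OF B.complete M(4)])
      fix E and \<epsilon> :: real assume E: "E \<in> sets M" "measure M E > 0" and "\<epsilon> > 0"
      obtain G K where G: "G \<in> sets M" "G \<subseteq> E" "measure M G > 0"
        "\<And>H. H \<in> sets M \<Longrightarrow> H \<subseteq> G \<Longrightarrow> q (\<nu> H) \<le> K * measure M H"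
        using bounded_piece[OF M(4) E] by blast
      have "\<exists>H x. H \<in> sets M \<and> H \<subseteq> G \<and> measure M H > 0 \<and> good \<epsilon> H x"
        using diff G \<open>\<epsilon> > 0\<close> by (intro good_piece) (auto simp: curve_differentiable_at_rscale)
      then show "\<exists>H x. H \<in> sets M \<and> H \<subseteq> E \<and> measure M H > 0 \<and> good \<epsilon> H x"
        using G(2) by blast
    qed
  qed
  then show ?thesis
    unfolding radon_nikodym_property_def has_density_rscale by blast
qed

text \<open>The line is cut into unit intervals because the property concerns finite measures; the
  integers, where the intervals meet, form a null set.\<close>

lemma AE_differentiable_if_radon_nikodym:
  assumes "banach_norm smul q"
    and RNP: "radon_nikodym_property TYPE(real) smul q" and F: "lipschitz_curve q F"
  shows "AE s in lebesgue. curve_differentiable_at smul q F s"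
proof -
  obtain L where L: "\<And>s t. q (F t - F s) \<le> L * \<bar>t - s\<bar>"
    using F unfolding lipschitz_curve_def by blast
  let ?sc = "\<lambda>r. smul (of_real r)"
  interpret B: banach_norm smul q by fact
  interpret real_normed ?sc q by (rule B.real_normed_rscale)
  have "AE s in lebesgue. real_of_int k < s \<longrightarrow> s < real_of_int k + 1 \<longrightarrow> curve_differentiable_at smul q F s" for k :: int
  proof -
    interpret finite_measure "unit_measure (real_of_int k)" by (rule finite_unit_measure)
    interpret lipschitz_unit ?sc q "real_of_int k" F L
      by unfold_locales (use L B.complete in auto)
    obtain f where f: "has_density ?sc q (unit_measure (real_of_int k)) deriv_measure f"
      using density_of_deriv_measure RNP by (auto simp: radon_nikodym_property_rscale)
    show ?thesis
      using AE_differentiable[OF f]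
      by eventually_elim (use curve_differentiable_at_iff in \<open>auto simp: curve_differentiable_at_rscale\<close>)
  qed
  then have "AE s in lebesgue. \<forall>k::int. real_of_int k < s \<longrightarrow> s < real_of_int k + 1 \<longrightarrow> curve_differentiable_at smul q F s"
    unfolding AE_all_countable by blast
  moreover have "AE s :: real in lebesgue. s \<notin> \<int>"
  proof (rule AE_not_in)
    have "countable (\<int> :: real set)" by (simp add: Ints_def)
    then show "(\<int> :: real set) \<in> null_sets lebesgue"
      by (intro null_sets_completionI countable_imp_null_set_lborel)
  qed
  ultimately show ?thesis
  proof eventually_elim
    case (elim s)
    have "real_of_int \<lfloor>s\<rfloor> \<noteq> s" using elim(2) by (metis Ints_of_int)
    then have "real_of_int \<lfloor>s\<rfloor> < s" using of_int_floor_le[of s] by linarith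
    moreover have "s < real_of_int \<lfloor>s\<rfloor> + 1" by linarith
    ultimately show ?case using elim(1) by blast
  qed
qed

theorem theorem2:
  fixes smul :: "'k::real_normed_field \<Rightarrow> 'a::ab_group_add \<Rightarrow> 'a"
    and q :: "'a \<Rightarrow> real"
  assumes "quasi_banach_space smul q"
    and "at_least_continuum TYPE('w)"
  shows "((\<forall>F. lipschitz_curve q F \<longrightarrow> (AE s in lebesgue. curve_differentiable_at smul q F s))
            \<longleftrightarrow> (\<forall>F. lipschitz_curve q F \<longrightarrow> (\<exists>s. curve_differentiable_at smul q F s)))
       \<and> ((\<forall>F. lipschitz_curve q F \<longrightarrow> (\<exists>s. curve_differentiable_at smul q F s))
            \<longleftrightarrow> locally_convex smul q \<and> has_RNP TYPE('w) smul q)"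
proof -
  interpret quasi_banach_space smul q by fact
  let ?i = "\<forall>F. lipschitz_curve q F \<longrightarrow> (AE s in lebesgue. curve_differentiable_at smul q F s)"
  let ?ii = "\<forall>F. lipschitz_curve q F \<longrightarrow> (\<exists>s. curve_differentiable_at smul q F s)"
  let ?iii = "locally_convex smul q \<and> has_RNP TYPE('w) smul q"
  have "?ii" if ?i
  proof (intro allI impI, rule ccontr)
    fix F assume F: "lipschitz_curve q F" "\<nexists>s. curve_differentiable_at smul q F s"
    have "AE s in lebesgue. curve_differentiable_at smul q F s" using that F(1) by blast
    \<comment> \<open>The whole line is not a null set, so what holds almost everywhere holds
      somewhere.\<close>
    then have "AE s in (lebesgue :: real measure). False" by eventually_elim (use F(2) in blast)
    then show False by (simp add: trivial_limit_def[symmetric] ae_filter_eq_bot_iff eventually_False)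
  qed
  moreover have ?iii if ii: ?ii
  proof -
    obtain \<kappa> where "real_quasi_normed rscale q \<kappa>" using real_quasi_normed ..
    then interpret rq: real_quasi_normed rscale q \<kappa> .
    obtain R where "rq.sum_bounded R"
      using rq.sum_bounded_if_differentiable[OF complete] ii
      by (auto simp: curve_differentiable_at_rscale)
    then have bound: "\<And>ys. q (sum_list ys) \<le> R * sum_list (map q ys)"
      unfolding rq.sum_bounded_def by blast
    let ?N = "hull_norm q"
    interpret N: banach_norm smul ?N by (rule banach_norm_if_sum_bounded[OF bound])
    have eq: "equivalent_quasi_norms ?N q" by (rule banach_norm_if_sum_bounded[OF bound])
    obtain c C where cC: "c > 0" "C > 0" "\<And>x. c * q x \<le> ?N x" "\<And>x. ?N x \<le> C * q x"
      using eq unfolding equivalent_quasi_norms_def by blast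
    have qN: "q x \<le> 1 / c * ?N x" for x using cC(1,3) by (simp add: pos_le_divide_eq mult.commute)
    have "\<exists>s. curve_differentiable_at smul ?N F s" if "lipschitz_curve ?N F" for F
    proof -
      have "lipschitz_curve q F" by (rule lipschitz_curve_le[OF that qN]) (use cC(1) in simp)
      then obtain s where "curve_differentiable_at smul q F s" using ii by blast
      then have "curve_differentiable_at smul ?N F s"
        by (rule curve_differentiable_at_le[OF _ cC(4) N.nonneg])
      then show ?thesis ..
    qed
    then have "radon_nikodym_property TYPE('w) smul ?N"
      by (rule radon_nikodym_property_if_differentiable[OF N.banach_norm_axioms])
    then have "has_RNP TYPE('w) smul q"
      unfolding has_RNP_def using eq N.banach_norm_axioms by blast
    moreover have "locally_convex smul q"
      by (rule locally_convex_if_equivalent[OF N.banach_norm_axioms eq])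
    ultimately show ?thesis by blast
  qed
  moreover have ?i if iii: ?iii
  proof (intro allI impI)
    fix F assume F: "lipschitz_curve q F"
    obtain N where N: "banach_norm smul N" "equivalent_quasi_norms N q" "radon_nikodym_property TYPE('w) smul N"
      using iii unfolding has_RNP_def by blast
    interpret N: banach_norm smul N by fact
    obtain c C where cC: "c > 0" "C > 0" "\<And>x. c * q x \<le> N x" "\<And>x. N x \<le> C * q x"
      using N(2) unfolding equivalent_quasi_norms_def by blast
    have qN: "q x \<le> 1 / c * N x" for x using cC(1,3) by (simp add: pos_le_divide_eq mult.commute)
    \<comment> \<open>Here the size of \<open>'w\<close> enters: the property is carried to measure
      spaces on the reals.\<close>
    obtain g :: "real \<Rightarrow> 'w" where "inj g" using assms(2) unfolding at_least_continuum_def by blast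
    then have "radon_nikodym_property TYPE(real) smul N"
      by (rule radon_nikodym_property_inj[OF _ N.real_normed_rscale N(3)])
    moreover have "lipschitz_curve N F" by (rule lipschitz_curve_le[OF F cC(4)]) (use cC(2) in simp)
    ultimately have "AE s in lebesgue. curve_differentiable_at smul N F s"
      by (rule AE_differentiable_if_radon_nikodym[OF N(1)])
    then show "AE s in lebesgue. curve_differentiable_at smul q F s"
      by eventually_elim (rule curve_differentiable_at_le[OF _ qN nonneg])
  qed
  ultimately show ?thesis by blast
qed

end
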